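(* Let $B\subset\mathbb{R}^3$ be a Platonic body (regular convex polyhedron) inscribed in a sphere with center $O$. Let $\mathcal S$ be the set of segments joining $O$ with the vertices of $B$, $\mathcal O$ the set of segments joining $O$ with the centers of the faces of $B$, $\mathcal E$ the set of edges of $B$, and $\mathcal D$ the set of segments joining the center of each face with the vertices of that face. Let $f\colon B\to\mathbb{R}$ be a function whose restriction to every pyramid having a face of $B$ as base and $O$ as apex is convex. Then $$\operatorname{Avg}(f,B)\le\frac14f(O)+\frac34\operatorname{Avg}(f,\partial B),$$ $$\operatorname{Avg}(f,B)\le\frac12\operatorname{Avg}(f,\mathcal O)+\frac12\operatorname{Avg}(f,\mathcal E),$$ $$\operatorname{Avg}(f,B)\le\frac12\operatorname{Avg}(f,\mathcal S)+\frac12\operatorname{Avg}(f,\mathcal D),$$ $$\operatorname{Avg}(f,\partial h_O^{3/4}(B))\le\operatorname{Avg}(f,B).$$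
   Context: $\operatorname{Avg}(f,B)$ is the average of $f$ over $B$ with respect to volume; for a boundary surface $\partial X$, $\operatorname{Avg}(f,\partial X)$ is the average with respect to surface area; for a finite set of segments, $\operatorname{Avg}(f,\cdot)$ denotes the average of $f$ over the union of these segments with respect to length. $h_O^\lambda(\mathbf x)=O+\lambda(\mathbf x-O)$ is the homothety with center $O$ and ratio $\lambda$. *)

theory Defs
  imports "HOL-Analysis.Analysis"
begin

type_synonym pt = "real ^ 3"

definition vertices :: "pt set \<Rightarrow> pt set" where
  "vertices P = {v. v extreme_point_of P}"

definition edges :: "pt set \<Rightarrow> pt set set" where
  "edges P = {E. E face_of P \<and> aff_dim E = 1}"

definition facets :: "pt set \<Rightarrow> pt set set" where
  "facets P = {F. F face_of P \<and> aff_dim F = aff_dim P - 1}"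

definition isometry :: "('a::metric_space \<Rightarrow> 'b::metric_space) \<Rightarrow> bool" where
  "isometry g \<longleftrightarrow> (\<forall>x y. dist (g x) (g y) = dist x y)"

definition cos_angle :: "pt \<Rightarrow> pt \<Rightarrow> pt \<Rightarrow> real" where
  "cos_angle v u w = ((u - v) \<bullet> (w - v)) / (norm (u - v) * norm (w - v))"

definition regular_polygon :: "pt set \<Rightarrow> bool" where
  "regular_polygon F \<longleftrightarrow> polytope F \<and> aff_dim F = 2 \<and>
     (\<forall>E1\<in>edges F. \<forall>E2\<in>edges F. diameter E1 = diameter E2) \<and>
     (\<forall>v u w v' u' w'.
        closed_segment v u \<in> edges F \<and> closed_segment v w \<in> edges F \<and> u \<noteq> w \<and>
        closed_segment v' u' \<in> edges F \<and> closed_segment v' w' \<in> edges F \<and> u' \<noteq> w'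
        \<longrightarrow> cos_angle v u w = cos_angle v' u' w')"

definition platonic :: "pt set \<Rightarrow> bool" where
  "platonic B \<longleftrightarrow> polytope B \<and> aff_dim B = 3 \<and>
     (\<forall>F\<in>facets B. regular_polygon F) \<and>
     (\<forall>F\<in>facets B. \<forall>G\<in>facets B. \<exists>g::pt \<Rightarrow> pt. isometry g \<and> g ` F = G) \<and>
     (\<forall>v\<in>vertices B. \<forall>w\<in>vertices B.
        card {F\<in>facets B. v \<in> F} = card {F\<in>facets B. w \<in> F})"

definition face_center :: "pt set \<Rightarrow> pt" where
  "face_center F = inverse (real (card (vertices F))) *\<^sub>R (\<Sum>v\<in>vertices F. v)"

definition homothety :: "pt \<Rightarrow> real \<Rightarrow> pt \<Rightarrow> pt" where
  "homothety z c x = z + c *\<^sub>R (x - z)"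

text \<open>Integrals of flat (1- or 2-dimensional) pieces w.r.t. length/area, computed
  through an isometric parametrisation of a line/plane containing the piece.\<close>
definition line_param :: "pt set \<Rightarrow> (real \<Rightarrow> pt)" where
  "line_param S = (SOME \<phi>. isometry \<phi> \<and> S \<subseteq> range \<phi>)"

definition plane_param :: "pt set \<Rightarrow> (real^2 \<Rightarrow> pt)" where
  "plane_param S = (SOME \<phi>. isometry \<phi> \<and> S \<subseteq> range \<phi>)"

definition line_integral :: "pt set \<Rightarrow> (pt \<Rightarrow> real) \<Rightarrow> real" where
  "line_integral S f = integral (line_param S -` S) (f \<circ> line_param S)"

definition line_length :: "pt set \<Rightarrow> real" where
  "line_length S = measure lebesgue (line_param S -` S)"

definition plane_integral :: "pt set \<Rightarrow> (pt \<Rightarrow> real) \<Rightarrow> real" where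
  "plane_integral S f = integral (plane_param S -` S) (f \<circ> plane_param S)"

definition plane_area :: "pt set \<Rightarrow> real" where
  "plane_area S = measure lebesgue (plane_param S -` S)"

definition avg_vol :: "(pt \<Rightarrow> real) \<Rightarrow> pt set \<Rightarrow> real" where
  "avg_vol f B = integral B f / measure lebesgue B"

definition avg_bdry :: "(pt \<Rightarrow> real) \<Rightarrow> pt set \<Rightarrow> real" where
  "avg_bdry f P = (\<Sum>F\<in>facets P. plane_integral F f) / (\<Sum>F\<in>facets P. plane_area F)"

definition avg_segs :: "(pt \<Rightarrow> real) \<Rightarrow> pt set set \<Rightarrow> real" where
  "avg_segs f \<S> = (\<Sum>S\<in>\<S>. line_integral S f) / (\<Sum>S\<in>\<S>. line_length S)"

end

theory Submission
  imports Defs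
begin

text \<open>
  Cut \<open>B\<close> into the pyramids over its faces, and cut each pyramid into the tetrahedra spanned by \<open>Z\<close>, the
  centre \<open>c\<close> of the face and an edge \<open>[a, b]\<close>. The tetrahedra have equal volume. A point of a tetrahedron is
  \<open>(1 - s) p + s q\<close> with \<open>p\<close> and \<open>q\<close> on two opposite edges; in these coordinates the volume element is
  proportional to \<open>s (1 - s)\<close>, so convexity bounds the average of \<open>f\<close> by the mean of its averages over the
  two edges. The pair \<open>[Z, c]\<close>, \<open>[a, b]\<close> gives the second inequality, and the pairs \<open>[Z, a]\<close>, \<open>[c, b]\<close> and
  \<open>[Z, b]\<close>, \<open>[c, a]\<close> the third, since each edge lies in two faces and all vertices have the same degree.
  The first and the fourth come from slicing a pyramid parallel to its base: the volume element is
  proportional to \<open>t\<^sup>2\<close> and the average of \<open>f\<close> over the slice at height \<open>t\<close> is convex in \<open>t\<close>.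
\<close>

section \<open>Facets of polytopes\<close>

text \<open>The dissection rests on two facts that \<open>platonic\<close> does not state:
  \<open>Z\<close> is interior to \<open>B\<close>, and the vertex average
  \<open>face_center F\<close> is the foot of the perpendicular from \<open>Z\<close> to the plane
  of \<open>F\<close>. Since \<open>Z\<close> is equidistant from the vertices, so is the foot, and
  each face is inscribed in a circle about it. Equal sides then force the foot to lie inside
  \<open>F\<close> and to be the vertex average. Congruence of the faces makes the circumradii
  equal, hence also the heights \<open>h\<close>, and the same criterion one dimension higher puts
  \<open>Z\<close> inside \<open>B\<close>. All tetrahedra thus share the height, the side and the
  apothem of a face, and the product of these three is six times their volume. A second obstacle is
  regularity: convexity on a closed pyramid allows jumps on its boundary, so every Borel argument
  runs on interiors, and frontiers are discarded as negligible. A third is that the length and area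
  integrals go through parametrisations fixed only by choice; isometries are affine, and this
  determines all that is needed of them.\<close>

lemma affine_hull_insert_decompose:
  fixes z :: "'a::euclidean_space"
  assumes x: "x \<in> affine hull (insert z S)" and c: "c \<in> affine hull S"
  obtains f k where "f \<in> affine hull S" "x = f + k *\<^sub>R (z - c)"
proof -
  let ?A = "{f + k *\<^sub>R (z - c) |f k. f \<in> affine hull S}"
  have aff: "affine ?A"
  proof (rule affine_def[THEN iffD2], intro ballI allI impI)
    fix x y u v assume "x \<in> ?A" "y \<in> ?A" "u + v = (1::real)"
    then obtain f k g l where "f \<in> affine hull S" "g \<in> affine hull S"
      and xy: "x = f + k *\<^sub>R (z - c)" "y = g + l *\<^sub>R (z - c)" by auto
    moreover have "u *\<^sub>R f + v *\<^sub>R g \<in> affine hull S"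
      using calculation \<open>u + v = 1\<close> mem_affine[OF affine_affine_hull] by blast
    ultimately show "u *\<^sub>R x + v *\<^sub>R y \<in> ?A"
      by (intro CollectI exI[of _ "u *\<^sub>R f + v *\<^sub>R g"] exI[of _ "u * k + v * l"])
         (simp add: xy algebra_simps)
  qed
  have "z \<in> ?A"
    using c by (intro CollectI exI[of _ c] exI[of _ 1]) simp
  moreover have "s \<in> ?A" if "s \<in> S" for s
    using that by (intro CollectI exI[of _ s] exI[of _ 0]) (simp add: hull_inc)
  ultimately have "affine hull (insert z S) \<subseteq> ?A"
    using aff by (intro hull_minimal) auto
  then show ?thesis
    using x that by blast
qed

text \<open>Facets of polyhedra are exposed. The equation is extended to the affine hull because the
  functionals are later evaluated at affine combinations that may leave \<open>P\<close>.\<close>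

lemma facet_supporting_hyperplane:
  fixes P :: "'a::euclidean_space set"
  assumes "polyhedron P" "F facet_of P"
  obtains a b where "\<And>x. x \<in> P \<Longrightarrow> a \<bullet> x \<le> b" "\<And>x. x \<in> P \<Longrightarrow> a \<bullet> x = b \<longleftrightarrow> x \<in> F"
    "\<And>x. x \<in> affine hull F \<Longrightarrow> a \<bullet> x = b"
proof -
  from assms have "F exposed_face_of P"
    by (simp add: exposed_face_of_polyhedron facet_of_def)
  then obtain a b where ab: "P \<subseteq> {x. a \<bullet> x \<le> b}" "F = P \<inter> {x. a \<bullet> x = b}"
    by (auto simp: exposed_face_of_def)
  have "affine hull F \<subseteq> {x. a \<bullet> x = b}"
    by (rule hull_minimal) (use ab affine_hyperplane in auto)
  with ab show ?thesis
    by (intro that[of a b]) auto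
qed

lemma facet_insert_affine_hull:
  fixes P :: "'a::euclidean_space set"
  assumes "polyhedron P" "F facet_of P" "z \<in> P" "z \<notin> F"
  shows "affine hull (insert z F) = affine hull P"
proof -
  have "z \<notin> affine hull F"
    using assms face_of_imp_eq_affine_Int[of P F] facet_of_imp_face_of polyhedron_imp_convex by blast
  then have "aff_dim (insert z F) = aff_dim P"
    using assms by (simp add: aff_dim_insert facet_of_def)
  moreover have "insert z F \<subseteq> P"
    using assms facet_of_imp_subset by blast
  ultimately show ?thesis
    by (metis aff_dim_psubset hull_mono less_irrefl psubsetI)
qed

lemma facet_eq_if_subset:
  fixes P :: "'a::euclidean_space set"
  assumes "polyhedron P" "F facet_of P" "G facet_of P" "F \<subseteq> G"
  shows "F = G"
proof (rule ccontr)
  assume "F \<noteq> G"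
  have "F face_of G"
    using assms face_of_subset facet_of_def facet_of_imp_subset by metis
  then have "aff_dim F < aff_dim G"
    using \<open>F \<noteq> G\<close> assms face_of_aff_dim_lt face_of_imp_convex facet_of_imp_face_of by metis
  then show False using assms by (simp add: facet_of_def)
qed

text \<open>At least two facets contain \<open>R\<close>, since \<open>R\<close> is the intersection
  of those that do and is too small to be a facet. A third is excluded by supporting functionals:
  \<open>R\<close> and one point from each of two facets span everything affinely, and expressing a
  point of the third facet through them makes the three inequalities clash. For polygons this yields
  two edges at a vertex, for \<open>B\<close> two faces at an edge.\<close>

lemma ridge_in_two_facets:
  fixes P :: "'a::euclidean_space set"
  assumes P: "polyhedron P" and R: "R face_of P" "R \<noteq> {}" "aff_dim R = aff_dim P - 2"
  shows "card {F. F facet_of P \<and> R \<subseteq> F} = 2"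
proof -
  let ?S = "{F. F facet_of P \<and> R \<subseteq> F}"
  have "R \<noteq> P" using R by auto
  have eq: "R = \<Inter>?S"
    using face_of_polyhedron[OF P R(1,2) \<open>R \<noteq> P\<close>] .
  obtain F1 where F1: "F1 facet_of P" "R \<subseteq> F1"
    using face_of_polyhedron_subset_facet[OF P R(1,2) \<open>R \<noteq> P\<close>] by blast
  have "R \<noteq> F1"
    using F1 R by (auto simp: facet_of_def)
  then obtain F2 where F2: "F2 facet_of P" "R \<subseteq> F2" "F2 \<noteq> F1"
    using eq F1 by blast
  have "F3 = F1 \<or> F3 = F2" if F3: "F3 facet_of P" "R \<subseteq> F3" for F3
  proof (rule ccontr)
    assume "\<not> (F3 = F1 \<or> F3 = F2)"
    then have ne: "F3 \<noteq> F1" "F3 \<noteq> F2" by auto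
    obtain a1 b1 where 1: "\<And>x. x \<in> P \<Longrightarrow> a1 \<bullet> x \<le> b1" "\<And>x. x \<in> P \<Longrightarrow> a1 \<bullet> x = b1 \<longleftrightarrow> x \<in> F1"
      "\<And>x. x \<in> affine hull F1 \<Longrightarrow> a1 \<bullet> x = b1"
      using facet_supporting_hyperplane[OF P F1(1)] by blast
    obtain a2 b2 where 2: "\<And>x. x \<in> P \<Longrightarrow> a2 \<bullet> x \<le> b2" "\<And>x. x \<in> P \<Longrightarrow> a2 \<bullet> x = b2 \<longleftrightarrow> x \<in> F2"
      "\<And>x. x \<in> affine hull F2 \<Longrightarrow> a2 \<bullet> x = b2"
      using facet_supporting_hyperplane[OF P F2(1)] by blast
    obtain a3 b3 where 3: "\<And>x. x \<in> P \<Longrightarrow> a3 \<bullet> x \<le> b3" "\<And>x. x \<in> P \<Longrightarrow> a3 \<bullet> x = b3 \<longleftrightarrow> x \<in> F3"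
      "\<And>x. x \<in> affine hull F3 \<Longrightarrow> a3 \<bullet> x = b3"
      using facet_supporting_hyperplane[OF P F3(1)] by blast
    \<comment> \<open>A face of \<open>P\<close> that meets \<open>rel_interior F\<close> contains
      \<open>F\<close>, so a relative interior point of \<open>F\<close> avoids all other
      facets.\<close>
    have relint: "\<exists>p\<in>F. \<forall>G. G facet_of P \<longrightarrow> G \<noteq> F \<longrightarrow> p \<notin> G" if "F facet_of P" for F
    proof -
      have "rel_interior F \<noteq> {}"
        using that face_of_imp_convex facet_of_def rel_interior_eq_empty by metis
      then obtain p where p: "p \<in> rel_interior F" by blast
      have "p \<notin> G" if "G facet_of P" "G \<noteq> F" for G
        using subset_of_face_of[of G P F] p \<open>F facet_of P\<close> that facet_eq_if_subset[OF P, of F G]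
        by (metis IntI empty_iff facet_of_imp_face_of facet_of_imp_subset)
      then show ?thesis using p rel_interior_subset by blast
    qed
    obtain p1 where p1: "p1 \<in> F1" "p1 \<notin> F2" "p1 \<notin> F3" using relint[OF F1(1)] F2(1,3) F3(1) ne by metis
    obtain p2 where p2: "p2 \<in> F2" "p2 \<notin> F1" "p2 \<notin> F3" using relint[OF F2(1)] F1(1) F2(3) F3(1) ne by metis
    obtain p3 where p3: "p3 \<in> F3" "p3 \<notin> F1" "p3 \<notin> F2" using relint[OF F3(1)] F1(1) F2(1) ne by metis
    have inP: "p1 \<in> P" "p2 \<in> P" "p3 \<in> P"
      using p1 p2 p3 F1 F2 F3 facet_of_imp_subset by (metis in_mono)+
    obtain r where r: "r \<in> R" using R by blast
    have RP: "R \<subseteq> P" using R face_of_imp_subset by blast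
    have "p1 \<notin> affine hull R"
      using 2(2)[OF inP(1)] 2(3)[of p1] p1 hull_mono[OF F2(2), of affine] by blast
    then have d1: "aff_dim (insert p1 R) = aff_dim P - 1"
      using R by (simp add: aff_dim_insert)
    have sub1: "insert p1 R \<subseteq> F1" using p1 F1 by auto
    have "p2 \<notin> affine hull (insert p1 R)"
      using 1(2)[OF inP(2)] 1(3)[of p2] p2 hull_mono[OF sub1, of affine] by blast
    then have "aff_dim (insert p2 (insert p1 R)) = aff_dim P"
      using d1 by (simp add: aff_dim_insert)
    moreover have "insert p2 (insert p1 R) \<subseteq> P"
      using inP RP by auto
    ultimately have "affine hull (insert p2 (insert p1 R)) = affine hull P"
      by (metis aff_dim_psubset hull_mono less_irrefl psubsetI)
    then have "p3 \<in> affine hull (insert p2 (insert p1 R))"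
      using inP by (simp add: hull_inc)
    then obtain f k where f: "f \<in> affine hull (insert p1 R)" "p3 = f + k *\<^sub>R (p2 - r)"
      using r by (meson affine_hull_insert_decompose hull_inc insertI2)
    then obtain g l where g: "g \<in> affine hull R" "f = g + l *\<^sub>R (p1 - r)"
      using r by (meson affine_hull_insert_decompose hull_inc)
    have p3eq: "p3 = g + l *\<^sub>R (p1 - r) + k *\<^sub>R (p2 - r)"
      using f g by simp
    have gF: "g \<in> affine hull F1" "g \<in> affine hull F2" "g \<in> affine hull F3"
      using g hull_mono[OF F1(2), of affine] hull_mono[OF F2(2), of affine] hull_mono[OF F3(2), of affine]
      by blast+
    have rF: "a1 \<bullet> r = b1" "a2 \<bullet> r = b2" "a3 \<bullet> r = b3"
      using r F1 F2 F3 1(3) 2(3) 3(3) hull_inc by (metis in_mono)+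
    have strict: "a1 \<bullet> p2 < b1" "a1 \<bullet> p3 < b1" "a2 \<bullet> p1 < b2" "a2 \<bullet> p3 < b2" "a3 \<bullet> p1 < b3" "a3 \<bullet> p2 < b3"
      using 1 2 3 p1 p2 p3 inP by (metis order_le_less)+
    have eqs: "a1 \<bullet> p1 = b1" "a2 \<bullet> p2 = b2" "a3 \<bullet> p3 = b3"
      using 1 2 3 p1 p2 p3 inP by auto
    \<comment> \<open>The functional of \<open>F1\<close> is constant on \<open>g\<close>,
      \<open>r\<close> and \<open>p1\<close>, so only the \<open>p2\<close> term remains and forces
      \<open>k > 0\<close>; likewise \<open>l > 0\<close>. Both terms then push \<open>p3\<close>
      strictly below the hyperplane of \<open>F3\<close>, on which it lies.\<close>
    have "a1 \<bullet> p3 = b1 + k * (a1 \<bullet> p2 - b1)"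
      unfolding p3eq using 1(3)[OF gF(1)] rF eqs by (simp add: inner_simps)
    then have "k * (a1 \<bullet> p2 - b1) < 0" using strict by linarith
    then have k: "k > 0" using strict by (simp add: mult_less_0_iff)
    have "a2 \<bullet> p3 = b2 + l * (a2 \<bullet> p1 - b2)"
      unfolding p3eq using 2(3)[OF gF(2)] rF eqs by (simp add: inner_simps)
    then have "l * (a2 \<bullet> p1 - b2) < 0" using strict by linarith
    then have l: "l > 0" using strict by (simp add: mult_less_0_iff)
    have "a3 \<bullet> p3 = b3 + l * (a3 \<bullet> p1 - b3) + k * (a3 \<bullet> p2 - b3)"
      unfolding p3eq using 3(3)[OF gF(3)] rF eqs by (simp add: inner_simps)
    moreover have "l * (a3 \<bullet> p1 - b3) < 0" "k * (a3 \<bullet> p2 - b3) < 0"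
      using k l strict by (simp_all add: mult_less_0_iff)
    ultimately show False using eqs by linarith
  qed
  then have "?S = {F1, F2}" using F1 F2 by blast
  then show ?thesis using F2(3) by simp
qed

text \<open>Were \<open>F\<close> the only facet, it would contain every extreme point and hence, by
  Krein-Milman, all of \<open>P\<close>.\<close>

lemma polytope_another_facet:
  fixes P :: "'a::euclidean_space set"
  assumes P: "polytope P" "aff_dim P \<ge> 1" and F: "F facet_of P"
  obtains G where "G facet_of P" "G \<noteq> F"
proof -
  have "\<exists>G. G facet_of P \<and> G \<noteq> F"
  proof (rule ccontr)
    assume "\<not> ?thesis"
    then have all: "G = F" if "G facet_of P" for G using that by metis
    have "{x. x extreme_point_of P} \<subseteq> F"
    proof
      fix v assume "v \<in> {x. x extreme_point_of P}"
      then have v: "{v} face_of P" by (simp add: face_of_singleton)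
      moreover have "{v} \<noteq> P" using P(2) by (metis aff_dim_sing not_one_le_zero)
      ultimately obtain G where "G facet_of P" "{v} \<subseteq> G"
        using face_of_polyhedron_subset_facet[of P "{v}"] P polytope_imp_polyhedron by blast
      then show "v \<in> F" using all by auto
    qed
    then have "convex hull {x. x extreme_point_of P} \<subseteq> F"
      using F face_of_imp_convex facet_of_def hull_minimal by metis
    then have "P \<subseteq> F"
      using Krein_Milman_Minkowski[of P] P polytope_imp_compact polytope_imp_convex by blast
    then show False
      using F facet_of_imp_subset facet_of_irrefl by (metis subset_antisym)
  qed
  then show ?thesis using that by blast
qed

text \<open>If \<open>q\<close> were not strictly on the inner side of some facet \<open>F\<close>, then \<open>c F\<close> would be the only point of
  \<open>P\<close> at distance at most \<open>d\<close> from \<open>q\<close>, although the feet on the other facets are as close.\<close>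

lemma equidistant_feet_imp_rel_interior:
  fixes P :: "'a::euclidean_space set"
  assumes P: "polytope P" "aff_dim P \<ge> 1" and q: "q \<in> affine hull P"
    and c: "\<And>F. F facet_of P \<Longrightarrow> c F \<in> rel_interior F"
    and orth: "\<And>F x. F facet_of P \<Longrightarrow> x \<in> F \<Longrightarrow> (q - c F) \<bullet> (x - c F) = 0"
    and d: "\<And>F. F facet_of P \<Longrightarrow> dist q (c F) = d"
  shows "q \<in> rel_interior P"
proof (rule ccontr)
  assume nq: "q \<notin> rel_interior P"
  have poly: "polyhedron P" and conv: "convex P" and bdd: "bounded P"
    using P polytope_imp_polyhedron polytope_imp_convex polytope_imp_bounded by auto
  have "rel_interior P \<noteq> {}"
    using P conv rel_interior_eq_empty[of P] by auto
  then obtain z where z: "z \<in> rel_interior P" by blast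
  then have "z \<in> P" using rel_interior_subset by blast
  have "q - z \<noteq> 0" using nq z by auto
  \<comment> \<open>The segment from the interior point \<open>z\<close> towards \<open>q\<close>
    leaves \<open>P\<close> no later than at \<open>q\<close>; the facet \<open>F\<close> met there
    has \<open>q\<close> on or beyond its hyperplane.\<close>
  then obtain e where e: "e > 0" "z + e *\<^sub>R (q - z) \<in> rel_frontier P"
    "\<And>e'. 0 \<le> e' \<Longrightarrow> e' < e \<Longrightarrow> z + e' *\<^sub>R (q - z) \<in> rel_interior P"
    using ray_to_rel_frontier[OF bdd z, of "q - z"] q by auto
  have "e \<le> 1" using e(3)[of 1] nq by force
  obtain F where F: "F facet_of P" "z + e *\<^sub>R (q - z) \<in> F"
    using e(2) rel_frontier_of_polyhedron[OF poly] by auto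
  obtain a b where ab: "\<And>x. x \<in> P \<Longrightarrow> a \<bullet> x \<le> b" "\<And>x. x \<in> P \<Longrightarrow> a \<bullet> x = b \<longleftrightarrow> x \<in> F"
      "\<And>x. x \<in> affine hull F \<Longrightarrow> a \<bullet> x = b"
    using facet_supporting_hyperplane[OF poly F(1)] by blast
  have "z \<notin> F" using z F rel_interior_of_polyhedron[OF poly] by blast
  have az: "a \<bullet> z < b" using ab \<open>z \<in> P\<close> \<open>z \<notin> F\<close> by force
  have "a \<bullet> z + e * (a \<bullet> (q - z)) = b"
    using ab(3)[of "z + e *\<^sub>R (q - z)"] F by (simp add: hull_inc inner_simps)
  then have "e * (a \<bullet> (q - z)) = b - a \<bullet> z" by linarith
  moreover from this have "a \<bullet> (q - z) > 0"
    using az e by (metis diff_gt_0_iff_gt zero_less_mult_pos)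
  moreover from this have "e * (a \<bullet> (q - z)) \<le> 1 * (a \<bullet> (q - z))"
    using \<open>e \<le> 1\<close> by (intro mult_right_mono) auto
  ultimately have aq: "a \<bullet> q \<ge> b" by (simp add: inner_simps)
  have cF: "c F \<in> F" using c F rel_interior_subset by blast
  have hull: "affine hull (insert z F) = affine hull P"
    using facet_insert_affine_hull[OF poly F(1) \<open>z \<in> P\<close> \<open>z \<notin> F\<close>] .
  have orth': "(q - c F) \<bullet> (x - c F) = 0" if "x \<in> affine hull F" for x
  proof -
    have "affine hull F \<subseteq> {x. (q - c F) \<bullet> x = (q - c F) \<bullet> c F}"
      using orth[OF F(1)] by (intro hull_minimal affine_hyperplane) (auto simp: inner_simps)
    then show ?thesis using that by (auto simp: inner_simps)
  qed
  \<comment> \<open>Both \<open>(q - c F) \<bullet> (x - c F)\<close> and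
    \<open>a \<bullet> x - b\<close> are affine in \<open>x\<close> and vanish on
    \<open>affine hull F\<close>, so on \<open>affine hull P\<close> they are the same multiple
    \<open>l\<close> of their values at \<open>z\<close>.\<close>
  have decomp: "\<exists>l. (q - c F) \<bullet> (x - c F) = l * ((q - c F) \<bullet> (z - c F)) \<and> a \<bullet> x - b = l * (a \<bullet> z - b)"
    if "x \<in> affine hull P" for x
  proof -
    have "x \<in> affine hull (insert z F)" "c F \<in> affine hull F"
      using that hull cF by (auto simp: hull_inc)
    then obtain f l where f: "f \<in> affine hull F" "x = f + l *\<^sub>R (z - c F)"
      by (rule affine_hull_insert_decompose)
    have "a \<bullet> x - b = l * (a \<bullet> z - b)"
      using ab(3)[OF f(1)] ab(3)[of "c F"] cF by (simp add: f(2) inner_simps hull_inc)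
    moreover have "(q - c F) \<bullet> (x - c F) = (q - c F) \<bullet> (f - c F) + l * ((q - c F) \<bullet> (z - c F))"
      by (simp add: f(2) inner_simps algebra_simps)
    ultimately show ?thesis using orth'[OF f(1)] by auto
  qed
  have key: "(q - c F) \<bullet> (x - c F) \<le> 0" if "x \<in> P" for x
  proof -
    obtain m where m: "(q - c F) \<bullet> (q - c F) = m * ((q - c F) \<bullet> (z - c F))" "a \<bullet> q - b = m * (a \<bullet> z - b)"
      using decomp[OF q] by blast
    obtain l where l: "(q - c F) \<bullet> (x - c F) = l * ((q - c F) \<bullet> (z - c F))" "a \<bullet> x - b = l * (a \<bullet> z - b)"
      using decomp[of x] \<open>x \<in> P\<close> by (auto simp: hull_inc)
    have "m \<le> 0" using m(2) aq az by (smt (verit) mult_pos_neg)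
    have "l \<ge> 0" using l(2) ab(1)[OF \<open>x \<in> P\<close>] az by (smt (verit) mult_neg_neg)
    show ?thesis
    proof (cases "q = c F")
      case False
      then have "(q - c F) \<bullet> (q - c F) > 0" by simp
      then have "(q - c F) \<bullet> (z - c F) < 0"
        using m(1) \<open>m \<le> 0\<close> by (smt (verit) mult_nonpos_nonneg)
      then show ?thesis using l(1) \<open>l \<ge> 0\<close> by (simp add: mult_nonneg_nonpos)
    qed simp
  qed
  obtain G where G: "G facet_of P" "G \<noteq> F"
    using polytope_another_facet[OF P F(1)] by blast
  have cG: "c G \<in> P" using c[OF G(1)] rel_interior_subset facet_of_imp_subset[OF G(1)] by blast
  \<comment> \<open>Law of cosines: by \<open>key\<close> the point \<open>c G\<close> can be as
    close to \<open>q\<close> as \<open>c F\<close> only if the two coincide, but distinct facets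
    have disjoint relative interiors.\<close>
  have "(dist q (c G))\<^sup>2 = (dist q (c F))\<^sup>2 - 2 * ((q - c F) \<bullet> (c G - c F)) + (norm (c G - c F))\<^sup>2"
    by (simp add: dist_norm power2_norm_eq_inner inner_simps algebra_simps inner_commute)
  then have "(norm (c G - c F))\<^sup>2 \<le> 0"
    using d[OF F(1)] d[OF G(1)] key[OF cG] by simp
  then have "c G = c F" by simp
  then have "rel_interior G \<inter> rel_interior F \<noteq> {}"
    using c[OF F(1)] c[OF G(1)] by auto
  then show False
    using face_of_eq[of G P F] F G facet_of_imp_face_of by blast
qed

text \<open>The ray from \<open>z\<close> through a point of \<open>P\<close> leaves
  \<open>P\<close> in the relative frontier, which is the union of the facets.\<close>

lemma polytope_eq_Union_cones:
  fixes P :: "'a::euclidean_space set"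
  assumes P: "polytope P" "aff_dim P \<ge> 1" and z: "z \<in> rel_interior P"
  shows "P = (\<Union>F\<in>{F. F facet_of P}. convex hull (insert z F))"
proof
  show "(\<Union>F\<in>{F. F facet_of P}. convex hull (insert z F)) \<subseteq> P"
  proof (rule UN_least)
    fix F assume "F \<in> {F. F facet_of P}"
    then have "insert z F \<subseteq> P"
      using z rel_interior_subset facet_of_imp_subset by blast
    then show "convex hull (insert z F) \<subseteq> P"
      by (simp add: hull_minimal polytope_imp_convex[OF P(1)])
  qed
  show "P \<subseteq> (\<Union>F\<in>{F. F facet_of P}. convex hull (insert z F))"
  proof
    fix x assume "x \<in> P"
    have "P \<noteq> {z}" using P by auto
    then obtain y where y: "y \<in> rel_frontier P" "x \<in> closed_segment z y"
      using segment_to_rel_frontier[of P z x] P polytope_imp_convex polytope_imp_bounded z \<open>x \<in> P\<close>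
      by metis
    then obtain F where F: "F facet_of P" "y \<in> F"
      using rel_frontier_of_polyhedron[of P] P polytope_imp_polyhedron by auto
    have "closed_segment z y \<subseteq> convex hull (insert z F)"
      using F unfolding segment_convex_hull by (intro hull_mono) auto
    then show "x \<in> (\<Union>F\<in>{F. F facet_of P}. convex hull (insert z F))"
      using y F by blast
  qed
qed

section \<open>Dimension bounds that make overlaps negligible\<close>

lemma negligible_aff_dim_lt:
  fixes S :: "'a::euclidean_space set"
  assumes "aff_dim S < DIM('a)"
  shows "negligible (convex hull S)"
proof -
  have "interior (convex hull S) = {}"
    using assms aff_dim_nonempty_interior[of "convex hull S"] by (auto simp: aff_dim_convex_hull)
  then show ?thesis by (simp add: negligible_convex_interior)
qed

lemma aff_dim_insert_le: "aff_dim (insert a S) \<le> aff_dim S + 1"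
  for a :: "'a::euclidean_space"
  by (simp add: aff_dim_insert)

lemma aff_dim_Int_facets_less:
  fixes P :: "'a::euclidean_space set"
  assumes "polyhedron P" "F facet_of P" "G facet_of P" "F \<noteq> G"
  shows "aff_dim (F \<inter> G) \<le> aff_dim P - 2"
proof -
  have "F \<inter> G face_of F"
    using assms by (metis face_of_Int face_of_subset facet_of_imp_face_of facet_of_imp_subset inf_le1)
  moreover have "F \<inter> G \<noteq> F"
    using assms facet_eq_if_subset by blast
  ultimately have "aff_dim (F \<inter> G) < aff_dim F"
    using assms face_of_aff_dim_lt face_of_imp_convex facet_of_imp_face_of by metis
  then show ?thesis using assms by (simp add: facet_of_def)
qed

section \<open>Slicing of integrals of convex functions\<close>

text \<open>The change of variables as an identity of measures, so that integrals and integrability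
  of Borel functions transfer together. It is enough to compare both sides on boxes, where the
  measure of a linear image is known.\<close>

lemma lborel_linear_density:
  fixes T :: "real^'n::{finite,wellorder} \<Rightarrow> real^'n::_"
  assumes "linear T" and det: "det (matrix T) \<noteq> 0"
  shows "lborel = density (distr lborel borel (\<lambda>x. z + T x)) (\<lambda>_. ennreal \<bar>det (matrix T)\<bar>)"
proof (rule lborel_eqI)
  let ?h = "\<lambda>x. z + T x"
  have meas: "?h \<in> borel_measurable borel"
    using assms(1) by (intro borel_measurable_continuous_onI continuous_on_add continuous_on_const
        linear_continuous_on) (simp add: linear_conv_bounded_linear)
  have inj: "inj T" using assms det_nz_iff_inj by blast
  then have surj: "surj T" using assms(1) linear_injective_imp_surjective by blast
  fix l u :: "real^'n::_" assume le: "\<And>b. b \<in> Basis \<Longrightarrow> l \<bullet> b \<le> u \<bullet> b"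
  let ?V = "?h -` box l u"
  have V: "?V \<in> sets borel" using measurable_sets[OF meas, of "box l u"] by simp
  have "T ` ?V = (\<lambda>x. x - z) ` box l u"
  proof (intro set_eqI iffI)
    fix x assume "x \<in> (\<lambda>x. x - z) ` box l u"
    then obtain y where y: "y \<in> box l u" "x = y - z" by auto
    obtain w where "x = T w" using surj by blast
    moreover from this y have "z + T w = y" by (metis add.commute diff_add_cancel)
    ultimately show "x \<in> T ` ?V" using y by (intro image_eqI[of _ _ w]) auto
  qed (force simp: image_iff)
  then have im: "T ` ?V = (\<lambda>x. - z + x) ` box l u" by simp
  obtain T' where T': "linear T'" "T' \<circ> T = id"
    using linear_injective_left_inverse[OF assms(1) inj] by blast
  have "?V = T' ` (T ` ?V)"
    using T'(2) by (simp add: image_comp)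
  moreover have "(\<lambda>x. - z + x) ` box l u \<in> lmeasurable"
    using measurable_translation by blast
  ultimately have lV: "?V \<in> lmeasurable"
    using measurable_linear_image[OF T'(1)] im by metis
  have "measure lebesgue (T ` ?V) = \<bar>det (matrix T)\<bar> * measure lebesgue ?V"
    by (rule measure_linear_image[OF assms(1) lV])
  then have eq: "\<bar>det (matrix T)\<bar> * measure lebesgue ?V = measure lborel (box l u)"
    unfolding im using measure_translation[of "-z" "box l u"] by simp
  have "emeasure lborel ?V = emeasure lebesgue ?V"
    using V by simp
  also have "\<dots> = measure lebesgue ?V"
    using emeasure_eq_measure2[OF lV] .
  finally have "emeasure lborel ?V = ennreal (measure lebesgue ?V)" .
  then have "emeasure (density (distr lborel borel ?h) (\<lambda>_. ennreal \<bar>det (matrix T)\<bar>)) (box l u)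
     = ennreal (\<bar>det (matrix T)\<bar> * measure lebesgue ?V)"
    using meas by (simp add: emeasure_density_const emeasure_distr ennreal_mult' )
  also have "\<dots> = ennreal (\<Prod>b\<in>Basis. (u - l) \<bullet> b)"
    unfolding eq using le by (simp add: measure_lborel_box_eq)
  finally show "emeasure (density (distr lborel borel ?h) (\<lambda>_. ennreal \<bar>det (matrix T)\<bar>)) (box l u)
     = (\<Prod>b\<in>Basis. (u - l) \<bullet> b)" by simp
qed simp

lemma integral_lborel_affine:
  fixes T :: "real^'n::{finite,wellorder} \<Rightarrow> real^'n::_" and g :: "real^'n::_ \<Rightarrow> real"
  assumes "linear T" "det (matrix T) \<noteq> 0" "g \<in> borel_measurable borel"
  shows "(\<integral>x. g x \<partial>lborel) = \<bar>det (matrix T)\<bar> * (\<integral>x. g (z + T x) \<partial>lborel)"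
    and "integrable lborel g \<Longrightarrow> integrable lborel (\<lambda>x. g (z + T x))"
proof -
  let ?h = "\<lambda>x. z + T x"
  have meas: "?h \<in> borel_measurable borel"
    using assms(1) by (intro borel_measurable_continuous_onI continuous_on_add continuous_on_const
        linear_continuous_on) (simp add: linear_conv_bounded_linear)
  have "(\<integral>x. g x \<partial>lborel) = (\<integral>x. g x \<partial>density (distr lborel borel ?h) (\<lambda>_. ennreal \<bar>det (matrix T)\<bar>))"
    using lborel_linear_density[OF assms(1,2), of z] by simp
  also have "\<dots> = \<bar>det (matrix T)\<bar> * (\<integral>x. g (z + T x) \<partial>lborel)"
    using meas assms by (simp add: integral_density integral_distr)
  finally show "(\<integral>x. g x \<partial>lborel) = \<bar>det (matrix T)\<bar> * (\<integral>x. g (z + T x) \<partial>lborel)" .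
  assume "integrable lborel g"
  then have "integrable (density (distr lborel borel ?h) (\<lambda>_. ennreal \<bar>det (matrix T)\<bar>)) g"
    using lborel_linear_density[OF assms(1,2), of z] by simp
  then show "integrable lborel (\<lambda>x. g (z + T x))"
    using meas assms by (simp add: integrable_density integrable_distr_eq)
qed

section \<open>Lebesgue measure on the plane and in space as a product measure\<close>

lemma prod_Basis_vec: "(\<Prod>b\<in>(Basis :: (real^'n) set). f b) = (\<Prod>i\<in>UNIV. f (axis i 1))"
  by (simp add: Basis_vec_def prod.UNION_disjoint axis_eq_axis image_constant_conv UNION_singleton_eq_range
      prod.reindex inj_on_def)

lemma continuous_on_vector2:
  assumes "continuous_on S f" "continuous_on S g"
  shows "continuous_on S (\<lambda>x. vector [f x, g x] :: real^2)"
proof -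
  have "(\<lambda>x. vector [f x, g x] :: real^2) = (\<lambda>x. \<chi> i. if i = 1 then f x else g x)"
    by (simp add: fun_eq_iff vec_eq_iff forall_2)
  moreover have "continuous_on S (\<lambda>x. if i = 1 then f x else g x)" for i :: 2
    using assms by (cases "i = 1") simp_all
  ultimately show ?thesis by (simp only:) (rule continuous_on_vec_lambda)
qed

lemma continuous_on_vector3:
  assumes "continuous_on S f" "continuous_on S g" "continuous_on S h"
  shows "continuous_on S (\<lambda>x. vector [f x, g x, h x] :: real^3)"
proof -
  have "(\<lambda>x. vector [f x, g x, h x] :: real^3) = (\<lambda>x. \<chi> i. if i = 1 then f x else if i = 2 then g x else h x)"
    by (simp add: fun_eq_iff vec_eq_iff forall_3)
  moreover have "continuous_on S (\<lambda>x. if i = 1 then f x else if i = 2 then g x else h x)" for i :: 3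
    using assms by (cases "i = 1"; cases "i = 2") simp_all
  ultimately show ?thesis by (simp only:) (rule continuous_on_vec_lambda)
qed

lemma box_Pair: "box (a, b) (c, d) = box a c \<times> box b d"
  for a c :: "'a::euclidean_space" and b d :: "'b::euclidean_space"
  by (force simp: box_def Basis_prod_def)

lemma ball_Basis_vec: "(\<forall>b\<in>(Basis :: (real^'n) set). P b) \<longleftrightarrow> (\<forall>i. P (axis i 1))"
  by (auto simp: Basis_vec_def)

lemma lborel_vec2: "(lborel :: (real^2) measure) = distr lborel borel (\<lambda>(x, y). vector [x, y])"
proof (rule lborel_eqI)
  fix l u :: "real^2" assume le: "\<And>b. b \<in> Basis \<Longrightarrow> l \<bullet> b \<le> u \<bullet> b"
  have le': "l $ 1 \<le> u $ 1" "l $ 2 \<le> u $ 2"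
    using le[of "axis 1 1"] le[of "axis 2 1"] by (auto simp: inner_axis axis_in_Basis_iff)
  have eq: "(\<lambda>(x, y). vector [x, y]) -` box l u = box (l $ 1, l $ 2) (u $ 1, u $ 2)"
    by (auto simp: mem_box_cart forall_2 box_Pair)
  have meas: "(\<lambda>(x, y). vector [x, y] :: real^2) \<in> borel_measurable borel"
    by (intro borel_measurable_continuous_onI)
       (auto intro!: continuous_on_vector2 continuous_on_vector3 continuous_intros simp: split_beta)
  show "emeasure (distr lborel borel (\<lambda>(x, y). vector [x, y])) (box l u) = (\<Prod>b\<in>Basis. (u - l) \<bullet> b)"
    using meas le' by (simp add: emeasure_distr eq emeasure_lborel_box_eq prod_Basis_vec UNIV_2
       inner_axis Basis_prod_def inner_prod_def ball_Un prod.union_disjoint)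
qed simp

text \<open>The third coordinate is the first component of the pair, so that Fubini integrates over
  plane slices inside and over the slice parameter outside.\<close>

lemma lborel_vec3: "(lborel :: (real^3) measure) = distr lborel borel (\<lambda>(t, y :: real^2). vector [y $ 1, y $ 2, t])"
proof (rule lborel_eqI)
  fix l u :: "real^3" assume le: "\<And>b. b \<in> Basis \<Longrightarrow> l \<bullet> b \<le> u \<bullet> b"
  have le': "l $ 1 \<le> u $ 1" "l $ 2 \<le> u $ 2" "l $ 3 \<le> u $ 3"
    using le[of "axis 1 1"] le[of "axis 2 1"] le[of "axis 3 1"] by (auto simp: inner_axis axis_in_Basis_iff)
  have eq: "(\<lambda>(t, y :: real^2). vector [y $ 1, y $ 2, t]) -` box l u =
     box (l $ 3, vector [l $ 1, l $ 2]) (u $ 3, vector [u $ 1, u $ 2])"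
    by (auto simp: mem_box_cart forall_2 forall_3 box_Pair)
  have meas: "(\<lambda>(t, y :: real^2). vector [y $ 1, y $ 2, t] :: real^3) \<in> borel_measurable borel"
    by (intro borel_measurable_continuous_onI)
       (auto intro!: continuous_on_vector2 continuous_on_vector3 continuous_intros simp: split_beta)
  have "emeasure (lborel :: (real \<times> (real^2)) measure) (box (l $ 3, vector [l $ 1, l $ 2]) (u $ 3, vector [u $ 1, u $ 2]))
     = ennreal ((u $ 3 - l $ 3) * ((u $ 1 - l $ 1) * (u $ 2 - l $ 2)))"
    using le' by (simp add: box_Pair lborel_prod[symmetric] lborel.emeasure_pair_measure_Times
      emeasure_lborel_box_eq prod_Basis_vec UNIV_2 inner_axis ennreal_mult' ball_Basis_vec forall_2)
  moreover have prd: "(\<Prod>b\<in>Basis. (u - l) \<bullet> b) = (u $ 3 - l $ 3) * ((u $ 1 - l $ 1) * (u $ 2 - l $ 2))"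
    unfolding prod_Basis_vec UNIV_3 by (simp add: inner_axis)
  ultimately show "emeasure (distr lborel borel (\<lambda>(t, y :: real^2). vector [y $ 1, y $ 2, t])) (box l u) = (\<Prod>b\<in>Basis. (u - l) \<bullet> b)"
    using meas unfolding prd by (simp add: emeasure_distr eq)
qed simp

section \<open>Integrability of convex functions\<close>

lemma convex_on_bounded_below:
  fixes f :: "'a::euclidean_space \<Rightarrow> real"
  assumes K: "bounded K" "interior K \<noteq> {}" and f: "convex_on K f" and b: "\<And>x. x \<in> K \<Longrightarrow> f x \<le> b"
  obtains m where "\<And>x. x \<in> K \<Longrightarrow> m \<le> f x"
proof -
  obtain p where "p \<in> interior K" using K by blast
  then obtain r where r: "r > 0" "cball p r \<subseteq> K" using mem_interior_cball by blast
  have p: "p \<in> K" using r by auto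
  obtain R where R: "R > 0" "\<And>x. x \<in> K \<Longrightarrow> dist p x \<le> R"
  proof -
    obtain R where "\<And>x. x \<in> K \<Longrightarrow> dist p x \<le> R" using K(1) bounded_any_center[of K p] by blast
    then show ?thesis by (intro that[of "max R 1"]) (auto simp: le_max_iff_disj)
  qed
  \<comment> \<open>Reflecting \<open>x\<close> in \<open>p\<close> and shrinking by
    \<open>d\<close> lands in \<open>cball p r\<close>, hence in \<open>K\<close>. Then
    \<open>p\<close> lies between \<open>x\<close> and this image, and the upper bound
    \<open>b\<close> at the image keeps \<open>f x\<close> from being too small.\<close>
  define d where "d = r / R"
  have d: "d > 0" using r R by (simp add: d_def)
  have "(1 + 1/d) * f p - b / d \<le> f x" if x: "x \<in> K" for x
  proof -
    let ?y = "p + d *\<^sub>R (p - x)"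
    have "dist p ?y = d * dist p x" using d by (simp add: dist_norm norm_minus_commute)
    also have "\<dots> \<le> r" using R(2)[OF x] R(1) r by (simp add: d_def field_simps)
    finally have y: "?y \<in> K" using r by auto
    have "p = (1 / (1 + d)) *\<^sub>R ?y + (d / (1 + d)) *\<^sub>R x"
    proof -
      have "(1 + d) *\<^sub>R p = ?y + d *\<^sub>R x" by (simp add: algebra_simps)
      then have "(1 / (1 + d)) *\<^sub>R ((1 + d) *\<^sub>R p) = (1 / (1 + d)) *\<^sub>R (?y + d *\<^sub>R x)" by simp
      then show ?thesis using d by (simp add: scaleR_right_distrib)
    qed
    then have "f p \<le> (1 / (1 + d)) * f ?y + (d / (1 + d)) * f x"
      using convex_onD[OF f, of "d / (1 + d)" ?y x] x y d by (simp add: field_simps)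
    also have "\<dots> \<le> (1 / (1 + d)) * b + (d / (1 + d)) * f x"
      using b[OF y] d by (intro add_right_mono mult_left_mono) auto
    finally have "f p \<le> (b + d * f x) / (1 + d)" by (simp add: add_divide_distrib)
    then have "(1 + d) * f p \<le> b + d * f x" using d by (simp add: pos_le_divide_eq mult.commute)
    then have "((1 + d) * f p - b) / d \<le> f x" using d by (simp add: pos_divide_le_eq mult.commute)
    moreover have "((1 + d) * f p - b) / d = (1 + 1/d) * f p - b / d" using d by (simp add: field_simps)
    ultimately show ?thesis by simp
  qed
  then show ?thesis using that by blast
qed

lemma integrable_lborel_bounded:
  fixes g :: "'a::euclidean_space \<Rightarrow> real"
  assumes "g \<in> borel_measurable borel" "bounded S" "\<And>x. x \<notin> S \<Longrightarrow> g x = 0" "\<And>x. x \<in> S \<Longrightarrow> \<bar>g x\<bar> \<le> B"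
  shows "integrable lborel g"
proof -
  obtain a b where ab: "S \<subseteq> cbox a b" using assms(2) bounded_subset_cbox_symmetric by metis
  have bound: "norm (g x) \<le> norm (indicator (cbox a b) x * \<bar>B\<bar>)" for x
  proof (cases "x \<in> S")
    case True
    then have "x \<in> cbox a b" using ab by blast
    then show ?thesis using assms(4)[OF True] by simp
  qed (use assms(3) in simp)
  show ?thesis
  proof (rule Bochner_Integration.integrable_bound)
    show "integrable lborel (\<lambda>x. indicator (cbox a b) x * \<bar>B\<bar> :: real)"
      by (intro integrable_mult_left integrable_real_indicator) (auto simp: emeasure_lborel_cbox_eq)
    show "AE x in lborel. norm (g x) \<le> norm (indicator (cbox a b) x * \<bar>B\<bar>)"
      by (intro AE_I2 bound)
  qed (use assms(1) in simp)
qed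

text \<open>Convexity gives continuity only in the interior, and \<open>f\<close> may jump on the
  frontier; hence the Borel statements concern \<open>f\<close> cut off to
  \<open>interior K\<close>. The frontier of a convex set is negligible, so the integral over
  \<open>K\<close> is unaffected.\<close>

lemma convex_on_integrable:
  fixes f :: "'a::euclidean_space \<Rightarrow> real"
  assumes K: "bounded K" and f: "convex_on K f" and b: "\<And>x. x \<in> K \<Longrightarrow> f x \<le> b"
  shows convex_on_indicator_measurable: "(\<lambda>x. indicator (interior K) x * f x) \<in> borel_measurable borel"
    and "integrable lborel (\<lambda>x. indicator (interior K) x * f x)"
    and convex_on_has_integral: "(f has_integral (\<integral>x. indicator (interior K) x * f x \<partial>lborel)) K"
proof -
  have conv: "convex K" using f by (simp add: convex_on_def)
  have "continuous_on (interior K) f"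
    by (rule convex_on_continuous) (use f interior_subset convex_on_subset conv in \<open>auto intro: convex_on_subset\<close>)
  then have "(\<lambda>x. indicator (interior K) x *\<^sub>R f x) \<in> borel_measurable borel"
    by (intro borel_measurable_continuous_on_indicator) auto
  then show meas: "(\<lambda>x. indicator (interior K) x * f x) \<in> borel_measurable borel" by simp
  show int: "integrable lborel (\<lambda>x. indicator (interior K) x * f x)"
  proof (cases "interior K = {}")
    case False
    obtain m where m: "\<And>x. x \<in> K \<Longrightarrow> m \<le> f x"
      using convex_on_bounded_below[OF K False f b] by blast
    show ?thesis
    proof (rule integrable_lborel_bounded[OF meas K])
      show "\<bar>indicator (interior K) x * f x\<bar> \<le> max \<bar>b\<bar> \<bar>m\<bar>" if "x \<in> K" for x
        using m[OF that] b[OF that] by (auto simp: indicator_def)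
    qed (use interior_subset in \<open>auto simp: indicator_def\<close>)
  qed simp
  have "((\<lambda>x. indicator (interior K) x * f x) has_integral (\<integral>x. indicator (interior K) x * f x \<partial>lborel)) UNIV"
    using has_integral_integral_lborel[OF int] .
  then have "((\<lambda>x. if x \<in> K then f x else 0) has_integral (\<integral>x. indicator (interior K) x * f x \<partial>lborel)) UNIV"
  proof (rule has_integral_spike[of "frontier K", rotated 2])
    show "negligible (frontier K)" using conv negligible_convex_frontier by blast
    fix x assume "x \<in> UNIV - frontier K"
    then show "(if x \<in> K then f x else 0) = indicator (interior K) x * f x"
      using closure_subset interior_subset by (auto simp: frontier_def indicator_def)
  qed
  then show "(f has_integral (\<integral>x. indicator (interior K) x * f x \<partial>lborel)) K"
    by (simp add: has_integral_restrict_UNIV)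
qed

section \<open>Fubini over slices of a convex body\<close>

lemma convex_on_compose_affine:
  fixes f :: "'b::real_vector \<Rightarrow> real"
  assumes f: "convex_on K f" and D: "convex (D :: 'a::real_vector set)" "\<And>x. x \<in> D \<Longrightarrow> h x \<in> K"
    and h: "\<And>x y u v. u + v = 1 \<Longrightarrow> h (u *\<^sub>R x + v *\<^sub>R y) = u *\<^sub>R h x + v *\<^sub>R h y"
  shows "convex_on D (\<lambda>x. f (h x))"
  unfolding convex_on_def
proof (intro conjI ballI allI impI)
  fix x y :: 'a and u v :: real
  assume "x \<in> D" "y \<in> D" "0 \<le> u" "0 \<le> v" "u + v = 1"
  then show "f (h (u *\<^sub>R x + v *\<^sub>R y)) \<le> u * f (h x) + v * f (h y)"
    using f D(2) by (simp add: h convex_on_def)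
qed (fact D(1))

text \<open>Integrands are cut off to interiors, so the slices have to match interiors and not only
  the sets. Dividing the first two coordinates by \<open>a\<close> and \<open>b\<close> is
  continuous for \<open>0 < t < 1\<close>, which yields an open neighbourhood inside
  \<open>K\<close>.\<close>

lemma slice_interior:
  fixes T :: "real^3 \<Rightarrow> real^3" and D :: "(real^2) set"
  assumes T: "linear T" "det (matrix T) \<noteq> 0"
    and a: "continuous_on {0<..<1} a" "\<And>t. 0 < t \<Longrightarrow> t < 1 \<Longrightarrow> 0 < a t"
    and b: "continuous_on {0<..<1} b" "\<And>t. 0 < t \<Longrightarrow> t < 1 \<Longrightarrow> 0 < b t"
    and iff: "\<And>y t. 0 < t \<Longrightarrow> t < 1 \<Longrightarrow> z + T (vector [a t * y $ 1, b t * y $ 2, t]) \<in> K \<longleftrightarrow> y \<in> D"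
    and y: "y \<in> interior D" and t: "0 < t" "t < 1"
  shows "z + T (vector [a t * y $ 1, b t * y $ 2, t]) \<in> interior K"
proof -
  let ?U = "{w :: real^3. w $ 3 \<in> {0<..<1}}"
  let ?q = "\<lambda>w :: real^3. vector [w $ 1 / a (w $ 3), w $ 2 / b (w $ 3)] :: real^2"
  let ?O = "{w \<in> ?U. ?q w \<in> interior D}"
  have "open ?U"
    by (simp add: open_Collect_conj open_Collect_less continuous_intros)
  have c3: "continuous_on ?U (\<lambda>w. a (w $ 3))" "continuous_on ?U (\<lambda>w. b (w $ 3))"
    using a b by (auto intro!: continuous_on_compose2[of _ _ _ "\<lambda>w. w $ 3"] continuous_intros)
  have "continuous_on ?U ?q"
    using a(2) b(2) by (intro continuous_on_vector2 continuous_intros c3) force+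
  then have "open ?O"
  proof -
    have "open (?U \<inter> ?q -` interior D)"
      by (rule continuous_open_preimage[OF \<open>continuous_on ?U ?q\<close> \<open>open ?U\<close> open_interior])
    moreover have "?U \<inter> ?q -` interior D = ?O" by blast
    ultimately show ?thesis by simp
  qed
  have inj: "inj T" using T det_nz_iff_inj by blast
  have "open (T ` ?O)"
    using \<open>open ?O\<close> T inj linear_injective_imp_surjective open_surjective_linear_image by blast
  then have "open ((\<lambda>x. z + x) ` (T ` ?O))" by (rule open_translation)
  moreover have "(\<lambda>x. z + x) ` (T ` ?O) \<subseteq> K"
  proof clarify
    fix w :: "real^3" assume w: "?q w \<in> interior D" "w $ 3 \<in> {0<..<1}"
    have "a (w $ 3) > 0" "b (w $ 3) > 0" using w a b by auto
    then have "w = vector [a (w $ 3) * ?q w $ 1, b (w $ 3) * ?q w $ 2, w $ 3]"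
      by (simp add: vec_eq_iff forall_3)
    then show "z + T w \<in> K"
      using iff[of "w $ 3" "?q w"] w interior_subset[of D] by (metis greaterThanLessThan_iff subsetD)
  qed
  ultimately have sub: "(\<lambda>x. z + x) ` (T ` ?O) \<subseteq> interior K"
    by (simp add: interior_maximal)
  have "a t > 0" "b t > 0" using a b t by auto
  then have "?q (vector [a t * y $ 1, b t * y $ 2, t]) = y"
    by (simp add: vec_eq_iff forall_2)
  then have "vector [a t * y $ 1, b t * y $ 2, t] \<in> ?O" using y t by auto
  then show ?thesis using sub by blast
qed

text \<open>The substitution \<open>(y, t) \<mapsto> z + T (vector
  [a t * y $ 1, b t * y $ 2, t])\<close> has Jacobian
  \<open>a t * b t * \<bar>det (matrix T)\<bar>\<close> and a base \<open>D\<close> that does not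
  depend on \<open>t\<close>. Tetrahedra use \<open>a t = 1 - t\<close> and \<open>b t = t\<close>
  over the unit square, pyramids \<open>a t = b t = t\<close> over the base. The interval is open
  because \<open>a\<close> and \<open>b\<close> may vanish at its ends.\<close>

lemma integral_slices:
  fixes T :: "real^3 \<Rightarrow> real^3" and D :: "(real^2) set" and f :: "real^3 \<Rightarrow> real"
  assumes T: "linear T" "det (matrix T) \<noteq> 0"
    and a: "continuous_on {0<..<1} a" "\<And>t. 0 < t \<Longrightarrow> t < 1 \<Longrightarrow> 0 < a t"
    and b: "continuous_on {0<..<1} b" "\<And>t. 0 < t \<Longrightarrow> t < 1 \<Longrightarrow> 0 < b t"
    and iff: "\<And>y t. 0 < t \<Longrightarrow> t < 1 \<Longrightarrow> z + T (vector [a t * y $ 1, b t * y $ 2, t]) \<in> K \<longleftrightarrow> y \<in> D"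
    and third: "\<And>w. z + T w \<in> K \<Longrightarrow> 0 \<le> w $ 3 \<and> w $ 3 \<le> 1"
    and K: "bounded K" and D: "convex D" "bounded D"
    and f: "convex_on K f" "\<And>x. x \<in> K \<Longrightarrow> f x \<le> B"
  shows
      "((\<lambda>t. a t * b t * integral D (\<lambda>y. f (z + T (vector [a t * y $ 1, b t * y $ 2, t])))) has_integral
         (integral K f / \<bar>det (matrix T)\<bar>)) {0<..<1}"
    and "\<And>t. 0 < t \<Longrightarrow> t < 1 \<Longrightarrow>
        (\<lambda>y. f (z + T (vector [a t * y $ 1, b t * y $ 2, t]))) integrable_on D"
proof -
  define P where "P t y = z + T (vector [a t * y $ 1, b t * y $ 2, t])" for t and y :: "real^2"
  define g where "g x = indicator (interior K) x * f x" for x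
  have g_meas: "g \<in> borel_measurable borel" and g_int: "integrable lborel g"
    and f_int: "(f has_integral (\<integral>x. g x \<partial>lborel)) K"
    using convex_on_integrable[OF K f] by (simp_all add: g_def[abs_def])
  have vadd: "vector [a t * (u *\<^sub>R x + v *\<^sub>R y) $ 1, b t * (u *\<^sub>R x + v *\<^sub>R y) $ 2, t]
     = u *\<^sub>R vector [a t * x $ 1, b t * x $ 2, t] + v *\<^sub>R (vector [a t * y $ 1, b t * y $ 2, t] :: real^3)"
    if "u + v = 1" for t u v and x y :: "real^2"
  proof -
    have "t = u * t + v * t" using that by (metis distrib_right mult_1)
    then show ?thesis by (simp add: vec_eq_iff forall_3 algebra_simps)
  qed
  have P_aff: "P t (u *\<^sub>R x + v *\<^sub>R y) = u *\<^sub>R P t x + v *\<^sub>R P t y" if "u + v = 1" for t u v x y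
  proof -
    have "u *\<^sub>R (z + X) + v *\<^sub>R (z + Y) = (u + v) *\<^sub>R z + (u *\<^sub>R X + v *\<^sub>R Y)" for X Y
      by (simp add: algebra_simps)
    then show ?thesis
      unfolding P_def vadd[OF that] linear_add[OF T(1)] linear_cmul[OF T(1)] by (simp add: that)
  qed
  have slice_conv: "convex_on D (\<lambda>y. f (P t y))" if "0 < t" "t < 1" for t
    using that iff P_aff by (intro convex_on_compose_affine[OF f(1) D(1)]) (auto simp: P_def)
  have slice_int: "((\<lambda>y. f (P t y)) has_integral (\<integral>y. indicator (interior D) y * f (P t y) \<partial>lborel)) D"
    if "0 < t" "t < 1" for t
    using that iff f(2) by (intro convex_on_has_integral[OF D(2) slice_conv]) (auto simp: P_def)
  then show "\<And>t. 0 < t \<Longrightarrow> t < 1 \<Longrightarrow> (\<lambda>y. f (z + T (vector [a t * y $ 1, b t * y $ 2, t]))) integrable_on D"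
    unfolding P_def by blast
  have g_slice: "(\<integral>y. g (P t y) \<partial>lborel) = integral D (\<lambda>y. f (P t y))" if t: "0 < t" "t < 1" for t
  proof -
    have meas1: "(\<lambda>y. P t y) \<in> borel_measurable borel"
      unfolding P_def using T(1)
      by (intro borel_measurable_continuous_onI continuous_on_add continuous_on_const
           linear_continuous_on_compose[of _ _ T] continuous_on_vector3 continuous_intros)
    have "(\<integral>y. g (P t y) \<partial>lborel) = (\<integral>y. indicator (interior D) y * f (P t y) \<partial>lborel)"
    proof (rule integral_cong_AE)
      show "(\<lambda>y. g (P t y)) \<in> borel_measurable lborel"
        using measurable_compose[OF meas1 g_meas] by simp
      show "(\<lambda>y. indicator (interior D) y * f (P t y)) \<in> borel_measurable lborel"
        using convex_on_indicator_measurable[OF D(2) slice_conv[OF t], of B] iff[OF t] f(2) by (simp add: P_def)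
      \<comment> \<open>Off this null set a point \<open>y\<close> is in \<open>interior D\<close>
        or outside \<open>D\<close>, and in either case the two cut-offs agree.\<close>
      have "negligible (frontier D)" using D negligible_convex_frontier by blast
      then have "AE y in lborel. y \<notin> frontier D"
        by (intro AE_not_in) (simp add: negligible_iff_null_sets null_sets_completion_iff)
      then show "AE y in lborel. g (P t y) = indicator (interior D) y * f (P t y)"
      proof (rule AE_mp, intro AE_I2 impI)
        fix y assume y: "y \<notin> frontier D"
        show "g (P t y) = indicator (interior D) y * f (P t y)"
        proof (cases "y \<in> interior D")
          case True
          then show ?thesis
            using slice_interior[OF T a b iff True t] by (simp add: g_def P_def)
        next
          case False
          then have "y \<notin> D" using y closure_subset by (auto simp: frontier_def)
          then have "P t y \<notin> interior K" using iff[OF t] interior_subset by (auto simp: P_def)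
          then show ?thesis using False by (simp add: g_def)
        qed
      qed
    qed
    then show ?thesis using integral_unique[OF slice_int[OF t]] by simp
  qed
  let ?v3 = "\<lambda>(t, y :: real^2). vector [y $ 1, y $ 2, t] :: real^3"
  have v3_meas: "?v3 \<in> borel_measurable borel"
    by (intro borel_measurable_continuous_onI)
       (auto intro!: continuous_on_vector3 continuous_intros simp: split_beta)
  have h_int: "integrable lborel (\<lambda>x. g (z + T x))" and
    h_eq: "(\<integral>x. g x \<partial>lborel) = \<bar>det (matrix T)\<bar> * (\<integral>x. g (z + T x) \<partial>lborel)"
    using integral_lborel_affine[OF T g_meas] g_int by blast+
  have h_meas: "(\<lambda>x. g (z + T x)) \<in> borel_measurable borel"
    using borel_measurable_integrable[OF h_int] by simp
  have uncurry: "case_prod (\<lambda>t y. g (z + T (?v3 (t, y)))) = (\<lambda>p. g (z + T (?v3 p)))"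
    by (simp add: fun_eq_iff)
  have "integrable (distr lborel borel ?v3) (\<lambda>x. g (z + T x))"
    using h_int by (simp only: lborel_vec3[symmetric])
  then have p_int: "integrable (lborel \<Otimes>\<^sub>M lborel) (case_prod (\<lambda>t y. g (z + T (?v3 (t, y)))))"
    unfolding uncurry lborel_prod using v3_meas h_meas by (subst (asm) integrable_distr_eq) auto
  have "(\<integral>x. g (z + T x) \<partial>lborel) = (\<integral>x. g (z + T x) \<partial>distr lborel borel ?v3)"
    by (simp only: lborel_vec3[symmetric])
  also have "\<dots> = (\<integral>p. g (z + T (?v3 p)) \<partial>lborel)"
    using v3_meas h_meas by (intro integral_distr) auto
  finally have p_eq: "(\<integral>x. g (z + T x) \<partial>lborel) = (\<integral>p. case_prod (\<lambda>t y. g (z + T (?v3 (t, y)))) p \<partial>(lborel \<Otimes>\<^sub>M lborel))"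
    unfolding uncurry lborel_prod .
  define H where "H t = (\<integral>y. g (z + T (?v3 (t, y))) \<partial>lborel)" for t
  have H_int: "integrable lborel H"
    unfolding H_def using lborel_pair.integrable_fst[OF p_int] .
  have H_eq: "(\<integral>t. H t \<partial>lborel) = (\<integral>x. g (z + T x) \<partial>lborel)"
    unfolding H_def p_eq using lborel_pair.integral_fst[OF p_int] .
  have H_out: "H t = 0" if "t < 0 \<or> t > 1" for t
  proof -
    have "g (z + T (?v3 (t, y))) = 0" for y
    proof -
      have "z + T (?v3 (t, y)) \<notin> K" using third[of "?v3 (t, y)"] that by auto
      then have "z + T (?v3 (t, y)) \<notin> interior K" using interior_subset by blast
      then show ?thesis by (simp add: g_def)
    qed
    then show ?thesis by (simp add: H_def)
  qed
  have H_in: "H t = a t * b t * integral D (\<lambda>y. f (P t y))" if t: "0 < t" "t < 1" for t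
  proof -
    \<comment> \<open>At fixed \<open>t\<close> the slice is \<open>D\<close> rescaled by
      \<open>a t\<close> and \<open>b t\<close>; this is where the weight \<open>a t * b t\<close>
      arises.\<close>
    let ?S = "\<lambda>y :: real^2. vector [a t * y $ 1, b t * y $ 2] :: real^2"
    have linS: "linear ?S" by (intro linearI) (auto simp: vec_eq_iff forall_2 algebra_simps)
    have detS: "det (matrix ?S) = a t * b t"
      by (simp add: det_2 matrix_def axis_def)
    have pos: "a t > 0" "b t > 0" using a b t by auto
    have meas: "(\<lambda>y. g (z + T (?v3 (t, y)))) \<in> borel_measurable borel"
      using h_meas v3_meas by (intro measurable_compose[OF _ h_meas] borel_measurable_continuous_onI)
        (auto intro!: continuous_on_vector3 continuous_intros simp: split_beta)
    have "H t = \<bar>det (matrix ?S)\<bar> * (\<integral>y. g (z + T (?v3 (t, 0 + ?S y))) \<partial>lborel)"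
      unfolding H_def using detS pos by (intro integral_lborel_affine(1)[OF linS _ meas]) auto
    also have "\<dots> = a t * b t * (\<integral>y. g (P t y) \<partial>lborel)"
      using pos by (simp add: detS P_def)
    finally show ?thesis using g_slice[OF t] by simp
  qed
  have "(H has_integral (\<integral>t. H t \<partial>lborel)) UNIV"
    using has_integral_integral_lborel[OF H_int] .
  \<comment> \<open>\<open>H\<close> vanishes off \<open>[0, 1]\<close>; its values at the two end
    points are not determined, and they form a null set.\<close>
  then have "((\<lambda>t. if t \<in> {0<..<1} then a t * b t * integral D (\<lambda>y. f (P t y)) else 0) has_integral (\<integral>t. H t \<partial>lborel)) UNIV"
    by (rule has_integral_spike[of "{0, 1}", rotated 2]) (auto simp: H_in H_out not_less not_le less_le)
  then have "((\<lambda>t. a t * b t * integral D (\<lambda>y. f (P t y))) has_integral (\<integral>t. H t \<partial>lborel)) {0<..<1}"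
    by (simp only: has_integral_restrict_UNIV)
  moreover have "(\<integral>t. H t \<partial>lborel) = integral K f / \<bar>det (matrix T)\<bar>"
    using T(2) integral_unique[OF f_int] by (simp add: H_eq h_eq)
  ultimately show "((\<lambda>t. a t * b t * integral D (\<lambda>y. f (z + T (vector [a t * y $ 1, b t * y $ 2, t])))) has_integral
         (integral K f / \<bar>det (matrix T)\<bar>)) {0<..<1}"
    by (simp add: P_def)
qed

section \<open>Tetrahedra and pyramids\<close>

definition columns3 :: "pt \<Rightarrow> pt \<Rightarrow> pt \<Rightarrow> pt \<Rightarrow> pt" where
  "columns3 A B C w = (w $ 1) *\<^sub>R A + (w $ 2) *\<^sub>R B + (w $ 3) *\<^sub>R C"

lemma linear_columns3: "linear (columns3 A B C)"
  by (rule linearI) (auto simp: columns3_def algebra_simps)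

lemma columns3_vector: "columns3 A B C (vector [x, y, t]) = x *\<^sub>R A + y *\<^sub>R B + t *\<^sub>R C"
  by (simp add: columns3_def)

text \<open>The Gram determinant: volumes become expressions in inner products, which the side, the
  circumradius and the height determine.\<close>

lemma det_columns3_sq:
  "(det (matrix (columns3 A B C)))\<^sup>2 =
     (A \<bullet> A) * (B \<bullet> B) * (C \<bullet> C) + 2 * (A \<bullet> B) * (B \<bullet> C) * (A \<bullet> C)
     - (A \<bullet> A) * (B \<bullet> C)\<^sup>2 - (B \<bullet> B) * (A \<bullet> C)\<^sup>2 - (C \<bullet> C) * (A \<bullet> B)\<^sup>2"
proof -
  let ?M = "matrix (columns3 A B C)"
  have M: "?M $ i $ 1 = A $ i" "?M $ i $ 2 = B $ i" "?M $ i $ 3 = C $ i" for i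
    by (simp_all add: matrix_def columns3_def axis_def)
  have "(det ?M)\<^sup>2 = det (transpose ?M ** ?M)"
    by (simp add: det_mul det_transpose power2_eq_square)
  also have "\<dots> = (A \<bullet> A) * (B \<bullet> B) * (C \<bullet> C) + 2 * (A \<bullet> B) * (B \<bullet> C) * (A \<bullet> C)
     - (A \<bullet> A) * (B \<bullet> C)\<^sup>2 - (B \<bullet> B) * (A \<bullet> C)\<^sup>2 - (C \<bullet> C) * (A \<bullet> B)\<^sup>2"
  proof -
    have G: "(transpose ?M ** ?M) $ i $ j = column i ?M \<bullet> column j ?M" for i j
      by (simp add: matrix_matrix_mult_def transpose_def column_def inner_vec_def)
    have c: "column 1 ?M = A" "column 2 ?M = B" "column 3 ?M = C"
      by (simp_all add: column_def M vec_eq_iff)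
    show ?thesis
      unfolding det_3 G c by (simp add: power2_eq_square inner_commute algebra_simps)
  qed
  finally show ?thesis .
qed

lemma columns3_inj:
  assumes "det (matrix (columns3 A B C)) \<noteq> 0" "columns3 A B C v = columns3 A B C w"
  shows "v = w"
  using assms linear_columns3 det_nz_iff_inj by (metis injD)

lemma polytope_convex_on_bounded_above:
  assumes "polytope K" "convex_on K f"
  obtains b where "\<And>x. x \<in> K \<Longrightarrow> f x \<le> b"
proof -
  obtain V where V: "finite V" "K = convex hull V" using assms by (auto simp: polytope_def)
  have "\<forall>x\<in>V. f x \<le> Max (f ` V)" using V by simp
  then have "\<forall>x\<in>convex hull V. f x \<le> Max (f ` V)"
    using assms V by (intro convex_on_convex_hull_bound) auto
  then show ?thesis using V that by blast
qed

text \<open>The convexity bound on a slice of a tetrahedron is a sum of a function of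
  \<open>y $ 1\<close> and one of \<open>y $ 2\<close>; each reduces to a one-dimensional integral
  because the other coordinate has unit range.\<close>

lemma integral_unit_square:
  fixes h :: "real \<Rightarrow> real"
  assumes h: "convex_on {0..1} h" and b: "\<And>x. x \<in> {0..1} \<Longrightarrow> h x \<le> b"
  shows integral_unit_square_fst: "((\<lambda>y::real^2. h (y $ 1)) has_integral (integral {0..1} h)) (cbox 0 1)"
    and integral_unit_square_snd: "((\<lambda>y::real^2. h (y $ 2)) has_integral (integral {0..1} h)) (cbox 0 1)"
proof -
  let ?I = "indicator {0<..<1::real} :: real \<Rightarrow> real"
  let ?v2 = "\<lambda>(x, y). vector [x, y] :: real^2"
  have v2: "?v2 \<in> borel_measurable borel"
    by (intro borel_measurable_continuous_onI)
       (auto intro!: continuous_on_vector2 continuous_intros simp: split_beta)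
  have one: "(\<integral>y. ?I y \<partial>lborel) = 1" by simp
  have int1: "integral {0..1} h = (\<integral>x. ?I x * h x \<partial>lborel)"
    using convex_on_has_integral[OF _ h b] by (simp add: integral_unique interior_atLeastAtMost_real)
  have box: "indicator (interior (cbox 0 1)) y = ?I (y $ 1) * ?I (y $ 2)" for y :: "real^2"
    by (auto simp: indicator_def interior_cbox mem_box_cart forall_2)
  have conv: "convex_on (cbox 0 1) (\<lambda>y::real^2. h (y $ i))" for i
    by (rule convex_on_compose_affine[OF h]) (auto simp: mem_box_cart)
  have bdd: "h (y $ i) \<le> b" if "y \<in> cbox 0 1" for y :: "real^2" and i
    using that by (intro b) (auto simp: mem_box_cart)
  note conv_int = convex_on_integrable[OF bounded_cbox conv bdd, unfolded box]
  have pair: "integrable (lborel \<Otimes>\<^sub>M lborel) (\<lambda>(x, y). ?I x * ?I y * h (?v2 (x, y) $ i)) \<and>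
     (\<integral>y. ?I (y $ 1) * ?I (y $ 2) * h (y $ i) \<partial>lborel)
       = (\<integral>p. (case p of (x, y) \<Rightarrow> ?I x * ?I y * h (?v2 (x, y) $ i)) \<partial>(lborel \<Otimes>\<^sub>M lborel))" for i
  proof -
    let ?g = "\<lambda>y::real^2. ?I (y $ 1) * ?I (y $ 2) * h (y $ i)"
    have unc: "(\<lambda>(x, y). ?I x * ?I y * h (?v2 (x, y) $ i)) = (\<lambda>p. ?g (?v2 p))"
      by (simp add: fun_eq_iff)
    have gm: "?g \<in> borel_measurable borel" using conv_int(1) by simp
    have "integrable (distr lborel borel ?v2) ?g"
      using conv_int(2) by (simp only: lborel_vec2[symmetric])
    then have 1: "integrable lborel (\<lambda>p. ?g (?v2 p))"
      using v2 gm by (subst (asm) integrable_distr_eq) auto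
    have "(\<integral>y. ?g y \<partial>lborel) = (\<integral>y. ?g y \<partial>distr lborel borel ?v2)"
      by (simp only: lborel_vec2[symmetric])
    also have "\<dots> = (\<integral>p. ?g (?v2 p) \<partial>lborel)"
      using v2 gm by (intro integral_distr) auto
    finally show ?thesis unfolding unc lborel_prod using 1 by blast
  qed
  have "(\<integral>y. ?I (y $ 1) * ?I (y $ 2) * h ((y :: real^2) $ 1) \<partial>lborel) = (\<integral>x. (\<integral>y. ?I x * ?I y * h x \<partial>lborel) \<partial>lborel)"
    using pair[of 1] lborel_pair.integral_fst[of "\<lambda>x y. ?I x * ?I y * h x"] by simp
  also have "\<dots> = (\<integral>x. ?I x * h x \<partial>lborel)"
    by (simp add: one mult.assoc mult.commute[of _ "h _"])
  finally show "((\<lambda>y::real^2. h (y $ 1)) has_integral (integral {0..1} h)) (cbox 0 1)"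
    using conv_int(3)[of 1] int1 by simp
  have "(\<integral>y. ?I (y $ 1) * ?I (y $ 2) * h ((y :: real^2) $ 2) \<partial>lborel) = (\<integral>y. (\<integral>x. ?I x * ?I y * h y \<partial>lborel) \<partial>lborel)"
    using pair[of 2] lborel_pair.integral_snd[of "\<lambda>x y. ?I x * ?I y * h y"] by simp
  also have "\<dots> = (\<integral>x. ?I x * h x \<partial>lborel)"
    by (simp add: one mult.assoc)
  finally show "((\<lambda>y::real^2. h (y $ 2)) has_integral (integral {0..1} h)) (cbox 0 1)"
    using conv_int(3)[of 2] int1 by simp
qed

text \<open>\<open>[x0, x1]\<close> and \<open>[x2, x3]\<close> are opposite edges, and
  \<open>T\<close> has their directions and a connecting vector as columns. The points dividing the
  joining segments in the ratio given by \<open>s\<close> form a parallelogram with sides scaled by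
  \<open>1 - s\<close> and \<open>s\<close>; hence the weight \<open>(1 - s) * s\<close>.\<close>

lemma tetrahedron_slices:
  fixes f :: "pt \<Rightarrow> real" and x0 x1 x2 x3 :: pt
  defines "K \<equiv> convex hull {x0, x1, x2, x3}" and "T \<equiv> columns3 (x1 - x0) (x3 - x2) (x2 - x0)"
  assumes det: "det (matrix T) \<noteq> 0" and f: "convex_on K f"
  shows
      "((\<lambda>s. (1 - s) * s * integral (cbox 0 1) (\<lambda>y::real^2. f ((1 - s) *\<^sub>R ((1 - y $ 1) *\<^sub>R x0 + y $ 1 *\<^sub>R x1)
           + s *\<^sub>R ((1 - y $ 2) *\<^sub>R x2 + y $ 2 *\<^sub>R x3)))) has_integral (integral K f / \<bar>det (matrix T)\<bar>)) {0<..<1}"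
    and "\<And>s. 0 < s \<Longrightarrow> s < 1 \<Longrightarrow>
        (\<lambda>y::real^2. f ((1 - s) *\<^sub>R ((1 - y $ 1) *\<^sub>R x0 + y $ 1 *\<^sub>R x1)
           + s *\<^sub>R ((1 - y $ 2) *\<^sub>R x2 + y $ 2 *\<^sub>R x3))) integrable_on cbox 0 1"
proof -
  have K: "polytope K" by (simp add: K_def polytope_convex_hull)
  obtain b where b: "\<And>x. x \<in> K \<Longrightarrow> f x \<le> b"
    using polytope_convex_on_bounded_above[OF K f] by blast
  have P: "x0 + T (vector [(1 - s) * y $ 1, s * y $ 2, s]) = (1 - s) *\<^sub>R ((1 - y $ 1) *\<^sub>R x0 + y $ 1 *\<^sub>R x1)
           + s *\<^sub>R ((1 - y $ 2) *\<^sub>R x2 + y $ 2 *\<^sub>R x3)" for s and y :: "real^2"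
    by (simp add: T_def columns3_vector algebra_simps)
  \<comment> \<open>The tetrahedron in the coordinates of \<open>T\<close>, with vertices
    \<open>0\<close>, \<open>(1, 0, 0)\<close>, \<open>(0, 0, 1)\<close>, \<open>(0, 1, 1)\<close>.
    At \<open>w = vector [(1 - s) * y $ 1, s * y $ 2, s]\<close> with \<open>0 < s < 1\<close> these
    inequalities say that \<open>y\<close> is in the unit square.\<close>
  let ?C = "{w :: real^3. 0 \<le> w $ 1 \<and> 0 \<le> w $ 2 \<and> w $ 2 \<le> w $ 3 \<and> w $ 1 + w $ 3 \<le> 1}"
  have convC: "convex ?C"
    unfolding convex_alt
  proof (intro ballI allI impI)
    fix v w :: "real^3" and u :: real assume v: "v \<in> ?C" and w: "w \<in> ?C" and u: "0 \<le> u \<and> u \<le> 1"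
    have "(1 - u) * v $ 2 \<le> (1 - u) * v $ 3" "u * w $ 2 \<le> u * w $ 3"
      "(1 - u) * (v $ 1 + v $ 3) \<le> (1 - u) * 1" "u * (w $ 1 + w $ 3) \<le> u * 1"
      using u v w by (intro mult_left_mono; simp)+
    moreover have "0 \<le> (1 - u) * v $ 1" "0 \<le> (1 - u) * v $ 2" "0 \<le> u * w $ 1" "0 \<le> u * w $ 2"
      using u v w by auto
    ultimately show "(1 - u) *\<^sub>R v + u *\<^sub>R w \<in> ?C"
      by (simp add: algebra_simps)
  qed
  have linT: "linear T" unfolding T_def by (rule linear_columns3)
  have "{x0, x1, x2, x3} \<subseteq> (\<lambda>x. x0 + x) ` (T ` ?C)"
  proof -
    have "x0 = x0 + T 0" by (simp add: linear_0[OF linT])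
    moreover have "x1 = x0 + T (vector [1, 0, 0])" "x2 = x0 + T (vector [0, 0, 1])" "x3 = x0 + T (vector [0, 1, 1])"
      by (simp_all add: T_def columns3_vector)
    moreover have "(0::real^3) \<in> ?C" "(vector [1, 0, 0]::real^3) \<in> ?C" "(vector [0, 0, 1]::real^3) \<in> ?C" "(vector [0, 1, 1]::real^3) \<in> ?C"
      by simp_all
    ultimately show ?thesis by (metis (no_types, lifting) empty_subsetI image_eqI insert_subset)
  qed
  moreover have "convex ((\<lambda>x. x0 + x) ` (T ` ?C))"
    using convC linT by (intro convex_translation convex_linear_image)
  ultimately have Ksub: "K \<subseteq> (\<lambda>x. x0 + x) ` (T ` ?C)"
    unfolding K_def by (rule hull_minimal)
  have KC: "w \<in> ?C" if w: "x0 + T w \<in> K" for w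
  proof -
    obtain w' where "w' \<in> ?C" "x0 + T w = x0 + T w'" using w Ksub by blast
    moreover from this have "w = w'"
      using columns3_inj[of "x1 - x0" "x3 - x2" "x2 - x0" w w'] det by (simp add: T_def)
    ultimately show ?thesis by simp
  qed
  have iff: "x0 + T (vector [(1 - s) * y $ 1, s * y $ 2, s]) \<in> K \<longleftrightarrow> y \<in> cbox 0 1" if s: "0 < s" "s < 1" for s and y :: "real^2"
  proof
    assume "x0 + T (vector [(1 - s) * y $ 1, s * y $ 2, s]) \<in> K"
    from KC[OF this] have "0 \<le> (1 - s) * y $ 1" "0 \<le> s * y $ 2" "s * y $ 2 \<le> s * 1" "(1 - s) * y $ 1 \<le> (1 - s) * 1"
      by simp_all
    then show "y \<in> cbox 0 1" using s by (simp add: mem_box_cart forall_2 zero_le_mult_iff mult_le_cancel_left)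
  next
    assume "y \<in> cbox 0 1"
    then have y: "0 \<le> y $ 1" "y $ 1 \<le> 1" "0 \<le> y $ 2" "y $ 2 \<le> 1" by (auto simp: mem_box_cart)
    have cK: "convex K" using K polytope_imp_convex by blast
    have x: "x0 \<in> K" "x1 \<in> K" "x2 \<in> K" "x3 \<in> K" unfolding K_def by (auto intro: hull_inc)
    show "x0 + T (vector [(1 - s) * y $ 1, s * y $ 2, s]) \<in> K"
      unfolding P using s y x by (intro convexD_alt[OF cK]) auto
  qed
  have third: "0 \<le> w $ 3 \<and> w $ 3 \<le> 1" if "x0 + T w \<in> K" for w
    using KC[OF that] by auto
  note sl = integral_slices[OF linT det, of "\<lambda>s. 1 - s" "\<lambda>s. s" x0 K "cbox 0 1" f b, OF _ _ _ _ iff third]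
  show "((\<lambda>s. (1 - s) * s * integral (cbox 0 1) (\<lambda>y::real^2. f ((1 - s) *\<^sub>R ((1 - y $ 1) *\<^sub>R x0 + y $ 1 *\<^sub>R x1)
           + s *\<^sub>R ((1 - y $ 2) *\<^sub>R x2 + y $ 2 *\<^sub>R x3)))) has_integral (integral K f / \<bar>det (matrix T)\<bar>)) {0<..<1}"
    using sl(1) f b K by (simp add: P polytope_imp_bounded continuous_intros bounded_cbox)
  show "(\<lambda>y::real^2. f ((1 - s) *\<^sub>R ((1 - y $ 1) *\<^sub>R x0 + y $ 1 *\<^sub>R x1)
           + s *\<^sub>R ((1 - y $ 2) *\<^sub>R x2 + y $ 2 *\<^sub>R x3))) integrable_on cbox 0 1" if "0 < s" "s < 1" for s
    using sl(2)[of s] that f b K by (simp add: P polytope_imp_bounded continuous_intros bounded_cbox)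
qed

lemma has_integral_polynomial_Ioo:
  fixes P p :: "real \<Rightarrow> real"
  assumes "\<And>x. (P has_real_derivative p x) (at x)"
  shows "(p has_integral (P 1 - P 0)) {0<..<1}"
proof -
  have "(p has_integral (P 1 - P 0)) {0..1}"
    using assms by (intro fundamental_theorem_of_calculus)
      (auto simp: has_real_derivative_iff_has_vector_derivative[symmetric] intro: DERIV_subset)
  then show ?thesis by (simp add: has_integral_Icc_iff_Ioo)
qed

lemma segment_convex_on:
  fixes f :: "'a::euclidean_space \<Rightarrow> real"
  assumes f: "convex_on K f" and ab: "a \<in> K" "b \<in> K"
  shows "convex_on {0..1} (\<lambda>u::real. f ((1 - u) *\<^sub>R a + u *\<^sub>R b))"
proof (rule convex_on_compose_affine[OF f, of "{0..1}" "\<lambda>u. (1 - u) *\<^sub>R a + u *\<^sub>R b"])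
  have "convex K" using f by (simp add: convex_on_def)
  then show "(1 - u) *\<^sub>R a + u *\<^sub>R b \<in> K" if "u \<in> {0..1}" for u :: real
    using that ab by (intro convexD_alt) auto
  fix x y u v :: real assume "u + v = 1"
  then have v: "v = 1 - u" by simp
  show "(1 - (u *\<^sub>R x + v *\<^sub>R y)) *\<^sub>R a + (u *\<^sub>R x + v *\<^sub>R y) *\<^sub>R b =
    u *\<^sub>R ((1 - x) *\<^sub>R a + x *\<^sub>R b) + v *\<^sub>R ((1 - y) *\<^sub>R a + y *\<^sub>R b)"
    unfolding v by (simp add: algebra_simps)
qed simp

text \<open>Convexity between the two edges bounds the slice at \<open>s\<close> by
  \<open>1 - s\<close> times one edge mean plus \<open>s\<close> times the other. The weights
  \<open>(1 - s)\<^sup>2 * s\<close> and \<open>(1 - s) * s\<^sup>2\<close> both integrate to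
  \<open>1/12\<close>; against the volume \<open>d / 6\<close> each edge gets the factor
  \<open>1/2\<close>.\<close>

lemma tetrahedron_integral_le:
  fixes f :: "pt \<Rightarrow> real" and x0 x1 x2 x3 :: pt
  defines "K \<equiv> convex hull {x0, x1, x2, x3}" and "d \<equiv> \<bar>det (matrix (columns3 (x1 - x0) (x3 - x2) (x2 - x0)))\<bar>"
  assumes det: "d \<noteq> 0" and f: "convex_on K f"
  shows "integral K f \<le> d / 12 * (integral {0..1} (\<lambda>u. f ((1 - u) *\<^sub>R x0 + u *\<^sub>R x1))
           + integral {0..1} (\<lambda>u. f ((1 - u) *\<^sub>R x2 + u *\<^sub>R x3)))"
proof -
  let ?A = "integral {0..1} (\<lambda>u. f ((1 - u) *\<^sub>R x0 + u *\<^sub>R x1))"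
  let ?E = "integral {0..1} (\<lambda>u. f ((1 - u) *\<^sub>R x2 + u *\<^sub>R x3))"
  let ?P = "\<lambda>s (y::real^2). (1 - s) *\<^sub>R ((1 - y $ 1) *\<^sub>R x0 + y $ 1 *\<^sub>R x1) + s *\<^sub>R ((1 - y $ 2) *\<^sub>R x2 + y $ 2 *\<^sub>R x3)"
  have K: "polytope K" and cK: "convex K" by (simp_all add: K_def polytope_convex_hull)
  obtain b where b: "\<And>x. x \<in> K \<Longrightarrow> f x \<le> b"
    using polytope_convex_on_bounded_above[OF K f] by blast
  have x: "x0 \<in> K" "x1 \<in> K" "x2 \<in> K" "x3 \<in> K" unfolding K_def by (auto intro: hull_inc)
  have det': "det (matrix (columns3 (x1 - x0) (x3 - x2) (x2 - x0))) \<noteq> 0" using det by (simp add: d_def)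
  note sl = tetrahedron_slices[OF det' f[unfolded K_def], folded K_def d_def]
  have slice_le: "integral (cbox 0 1) (\<lambda>y. f (?P s y)) \<le> (1 - s) * ?A + s * ?E" if s: "0 < s" "s < 1" for s
  proof (rule has_integral_le[OF integrable_integral[OF sl(2)[OF s]]])
    have "((\<lambda>y::real^2. f ((1 - y $ 1) *\<^sub>R x0 + y $ 1 *\<^sub>R x1)) has_integral ?A) (cbox 0 1)"
      using x convexD_alt[OF cK] b by (intro integral_unit_square_fst segment_convex_on[OF f]) auto
    moreover have "((\<lambda>y::real^2. f ((1 - y $ 2) *\<^sub>R x2 + y $ 2 *\<^sub>R x3)) has_integral ?E) (cbox 0 1)"
      using x convexD_alt[OF cK] b by (intro integral_unit_square_snd segment_convex_on[OF f]) auto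
    ultimately show "((\<lambda>y::real^2. (1 - s) * f ((1 - y $ 1) *\<^sub>R x0 + y $ 1 *\<^sub>R x1)
       + s * f ((1 - y $ 2) *\<^sub>R x2 + y $ 2 *\<^sub>R x3)) has_integral ((1 - s) * ?A + s * ?E)) (cbox 0 1)"
      by (intro has_integral_add has_integral_mult_right)
    fix y :: "real^2" assume "y \<in> cbox 0 1"
    then have y: "0 \<le> y $ 1" "y $ 1 \<le> 1" "0 \<le> y $ 2" "y $ 2 \<le> 1" by (auto simp: mem_box_cart)
    show "f (?P s y) \<le> (1 - s) * f ((1 - y $ 1) *\<^sub>R x0 + y $ 1 *\<^sub>R x1) + s * f ((1 - y $ 2) *\<^sub>R x2 + y $ 2 *\<^sub>R x3)"
      using s y x by (intro convex_onD[OF f] convexD_alt[OF cK]) auto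
  qed
  have "((\<lambda>s. (1 - s) * s * ((1 - s) * ?A + s * ?E)) has_integral
      ((\<lambda>s. (s^2/2 - 2 * s^3/3 + s^4/4) * ?A + (s^3/3 - s^4/4) * ?E) 1 - (\<lambda>s. (s^2/2 - 2 * s^3/3 + s^4/4) * ?A + (s^3/3 - s^4/4) * ?E) 0)) {0<..<1}"
    by (rule has_integral_polynomial_Ioo)
       (auto intro!: derivative_eq_intros simp: field_simps power2_eq_square power3_eq_cube)
  then have "((\<lambda>s. (1 - s) * s * ((1 - s) * ?A + s * ?E)) has_integral (?A + ?E) / 12) {0<..<1}"
    by (simp add: field_simps)
  then have "integral K f / d \<le> (?A + ?E) / 12"
    by (rule has_integral_le[OF sl(1)]) (auto intro!: mult_left_mono slice_le)
  moreover have "d > 0" using det by (simp add: d_def)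
  ultimately show ?thesis by (simp add: field_simps)
qed

lemma measure_tetrahedron:
  fixes x0 x1 x2 x3 :: pt
  defines "d \<equiv> \<bar>det (matrix (columns3 (x1 - x0) (x3 - x2) (x2 - x0)))\<bar>"
  assumes det: "d \<noteq> 0"
  shows "measure lebesgue (convex hull {x0, x1, x2, x3}) = d / 6"
proof -
  let ?K = "convex hull {x0, x1, x2, x3}"
  have det': "det (matrix (columns3 (x1 - x0) (x3 - x2) (x2 - x0))) \<noteq> 0" using det by (simp add: d_def)
  have "convex_on ?K (\<lambda>_. 1)" by (simp add: convex_on_def flip: distrib_right)
  from tetrahedron_slices(1)[OF det' this, folded d_def]
  have "((\<lambda>s. (1 - s) * s * integral (cbox 0 1) (\<lambda>_::real^2. 1)) has_integral (integral ?K (\<lambda>_. 1) / d)) {0<..<1}" .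
  moreover have "integral (cbox 0 1) (\<lambda>_::real^2. 1::real) = 1"
    by (rule integral_unique, rule has_integral_eq_rhs[OF integral_unit_square_fst[of "\<lambda>_. 1" 1]])
       (simp_all add: convex_on_def flip: distrib_right)
  ultimately have "((\<lambda>s. (1 - s) * s) has_integral (integral ?K (\<lambda>_. 1) / d)) {0<..<1}"
    by (simp only: mult_1_right)
  moreover have "((\<lambda>s. (1 - s) * s) has_integral (\<lambda>s::real. s^2/2 - s^3/3) 1 - (\<lambda>s::real. s^2/2 - s^3/3) 0) {0<..<1}"
    by (rule has_integral_polynomial_Ioo)
       (auto intro!: derivative_eq_intros simp: field_simps power2_eq_square power3_eq_cube)
  ultimately have "integral ?K (\<lambda>_. 1) / d = (\<lambda>s::real. s^2/2 - s^3/3) 1 - (\<lambda>s::real. s^2/2 - s^3/3) 0"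
    by (rule has_integral_unique)
  then have "integral ?K (\<lambda>_. 1) = d / 6" using det by (simp add: field_simps)
  moreover have "?K \<in> lmeasurable"
    by (intro lmeasurable_compact compact_convex_hull) (simp add: finite_imp_compact)
  ultimately show ?thesis by (simp add: lmeasure_integral)
qed

section \<open>Isometries are affine; subgradients in one variable\<close>

lemma isometry_inner:
  fixes \<phi> :: "'a::real_inner \<Rightarrow> 'b::real_inner"
  assumes "isometry \<phi>"
  shows "(\<phi> x - \<phi> 0) \<bullet> (\<phi> y - \<phi> 0) = x \<bullet> y"
proof -
  have d: "norm (\<phi> x - \<phi> y) = norm (x - y)" for x y
    using assms by (simp add: isometry_def dist_norm)
  have "(norm ((\<phi> x - \<phi> 0) - (\<phi> y - \<phi> 0)))\<^sup>2 = (norm (x - y))\<^sup>2" "(norm (\<phi> x - \<phi> 0))\<^sup>2 = (norm x)\<^sup>2" "(norm (\<phi> y - \<phi> 0))\<^sup>2 = (norm y)\<^sup>2"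
    using d[of x y] d[of x 0] d[of y 0] by simp_all
  then show ?thesis
    unfolding power2_norm_eq_inner by (simp add: inner_simps inner_commute)
qed

text \<open>By \<open>isometry_inner\<close> inner products are preserved, so the defects of
  additivity and homogeneity have norm zero.\<close>

lemma isometry_imp_linear:
  fixes \<phi> :: "'a::real_inner \<Rightarrow> 'b::real_inner"
  assumes "isometry \<phi>"
  shows "linear (\<lambda>x. \<phi> x - \<phi> 0)"
proof -
  define L where "L x = \<phi> x - \<phi> 0" for x
  have L: "L x \<bullet> L y = x \<bullet> y" for x y using isometry_inner[OF assms] by (simp add: L_def)
  have "(L (x + y) - (L x + L y)) \<bullet> (L (x + y) - (L x + L y)) = 0" for x y
    by (simp add: inner_diff_left inner_diff_right inner_add_left inner_add_right L)
  moreover have "(L (c *\<^sub>R x) - c *\<^sub>R L x) \<bullet> (L (c *\<^sub>R x) - c *\<^sub>R L x) = 0" for c x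
    by (simp add: inner_diff_left inner_diff_right L)
  ultimately have "linear L"
    by (intro linearI) (simp_all only: inner_eq_zero_iff right_minus_eq)
  then show ?thesis by (simp add: L_def[abs_def])
qed

lemma isometry_affine:
  fixes \<phi> :: "'a::real_inner \<Rightarrow> 'b::real_inner"
  assumes "isometry \<phi>" "u + v = 1"
  shows "\<phi> (u *\<^sub>R x + v *\<^sub>R y) = u *\<^sub>R \<phi> x + v *\<^sub>R \<phi> y"
proof -
  note lin = isometry_imp_linear[OF assms(1)]
  have "\<phi> (u *\<^sub>R x + v *\<^sub>R y) - \<phi> 0 = u *\<^sub>R (\<phi> x - \<phi> 0) + v *\<^sub>R (\<phi> y - \<phi> 0)"
    using linear_add[OF lin] linear_cmul[OF lin] by simp
  also have "\<dots> = u *\<^sub>R \<phi> x + v *\<^sub>R \<phi> y - (u + v) *\<^sub>R \<phi> 0" by (simp add: algebra_simps)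
  finally show ?thesis using assms(2) by simp
qed

lemma isometry_inj: "isometry \<phi> \<Longrightarrow> \<phi> x = \<phi> y \<Longrightarrow> x = y"
  by (metis dist_eq_0_iff isometry_def)

text \<open>The slope is the supremum of the difference quotients from the left, for which every
  quotient from the right is an upper bound.\<close>

lemma convex_on_subgradient:
  fixes G :: "real \<Rightarrow> real"
  assumes G: "convex_on {a<..<b} G" and x: "x \<in> {a<..<b}"
  obtains m where "\<And>t. t \<in> {a<..<b} \<Longrightarrow> G x + m * (t - x) \<le> G t"
proof -
  let ?S = "(\<lambda>t. (G t - G x) / (t - x)) ` {a<..<x}"
  have le: "(G t - G x) / (t - x) \<le> (G x - G s) / (x - s)" if "t \<in> {a<..<x}" "s \<in> {x<..<b}" for t s
    using convex_on_slope_le[OF G, of t s x] that x by auto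
  have "\<exists>s. s \<in> {x<..<b}" using x dense[of x b] by auto
  then have bdd: "bdd_above ?S" using le by (fastforce simp: bdd_above_def)
  have ne: "?S \<noteq> {}" using x dense[of a x] by auto
  show ?thesis
  proof (rule that[of "Sup ?S"])
    fix t assume t: "t \<in> {a<..<b}"
    consider "t < x" | "t = x" | "x < t" by linarith
    then show "G x + Sup ?S * (t - x) \<le> G t"
    proof cases
      case 1
      then have "(G t - G x) / (t - x) \<le> Sup ?S" using t by (intro cSup_upper bdd) auto
      then show ?thesis using 1 by (simp add: neg_divide_le_eq)
    next
      case 3
      then have "Sup ?S \<le> (G x - G t) / (x - t)" using t le ne by (intro cSup_least) auto
      then show ?thesis using 3 by (simp add: neg_le_divide_eq algebra_simps)
    qed simp
  qed
qed

section \<open>Pyramids over a plane polygon given by an isometric chart\<close>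

lemma plane_chart_preimage:
  fixes \<phi> :: "real^2 \<Rightarrow> pt"
  assumes iso: "isometry \<phi>" and F: "polytope F"
  shows "convex (\<phi> -` F)" "bounded (\<phi> -` F)" "\<phi> -` F \<in> lmeasurable"
proof -
  have conv: "convex F" and bdd: "bounded F" using F polytope_imp_convex polytope_imp_bounded by auto
  show *: "convex (\<phi> -` F)"
    unfolding convex_def using isometry_affine[OF iso] conv by (auto simp: convex_def)
  obtain R where R: "\<And>x. x \<in> F \<Longrightarrow> dist (\<phi> 0) x \<le> R" using bdd bounded_any_center[of F "\<phi> 0"] by blast
  have "dist 0 y \<le> R" if "y \<in> \<phi> -` F" for y
    using R[of "\<phi> y"] that iso by (auto simp: isometry_def)
  then show "bounded (\<phi> -` F)" by (meson bounded_def)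
  then show "\<phi> -` F \<in> lmeasurable" using * measurable_convex by blast
qed

text \<open>The Jacobian of the cone with apex \<open>Z\<close> over the chart: the volume of the
  parallelepiped on the two chart directions and a vector from \<open>Z\<close> to the plane. It is
  the distance of \<open>Z\<close> from the plane, see \<open>cone_factor_eq_dist\<close>.\<close>

definition cone_factor :: "pt \<Rightarrow> (real^2 \<Rightarrow> pt) \<Rightarrow> real" where
  "cone_factor Z \<phi> = \<bar>det (matrix (columns3 (\<phi> (axis 1 1) - \<phi> 0) (\<phi> (axis 2 1) - \<phi> 0) (\<phi> 0 - Z)))\<bar>"

lemma plane_chart_expansion:
  fixes \<phi> :: "real^2 \<Rightarrow> pt"
  assumes "isometry \<phi>"
  shows "\<phi> y = \<phi> 0 + y $ 1 *\<^sub>R (\<phi> (axis 1 1) - \<phi> 0) + y $ 2 *\<^sub>R (\<phi> (axis 2 1) - \<phi> 0)"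
proof -
  note lin = isometry_imp_linear[OF assms]
  have "y = y $ 1 *\<^sub>R axis 1 1 + y $ 2 *\<^sub>R axis 2 1"
    by (simp add: vec_eq_iff forall_2 axis_def)
  then have "\<phi> y - \<phi> 0 = \<phi> (y $ 1 *\<^sub>R axis 1 1 + y $ 2 *\<^sub>R axis 2 1) - \<phi> 0" by simp
  also have "\<dots> = y $ 1 *\<^sub>R (\<phi> (axis 1 1) - \<phi> 0) + y $ 2 *\<^sub>R (\<phi> (axis 2 1) - \<phi> 0)"
    using linear_add[OF lin, of "y $ 1 *\<^sub>R axis 1 1" "y $ 2 *\<^sub>R axis 2 1"]
      linear_cmul[OF lin, of "y $ 1" "axis 1 1"] linear_cmul[OF lin, of "y $ 2" "axis 2 1"] by simp
  finally show ?thesis by (simp add: algebra_simps)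
qed

text \<open>The chart directions are orthonormal, so the Gram determinant keeps only the component
  of \<open>\<phi> 0 - Z\<close> perpendicular to the plane, which is \<open>c - Z\<close>.\<close>

lemma cone_factor_eq_dist:
  fixes \<phi> :: "real^2 \<Rightarrow> pt"
  assumes iso: "isometry \<phi>" and c: "c \<in> range \<phi>" and orth: "\<And>y. (c - Z) \<bullet> (\<phi> y - c) = 0"
  shows "cone_factor Z \<phi> = dist Z c"
proof -
  define A B where "A = \<phi> (axis 1 1) - \<phi> 0" and "B = \<phi> (axis 2 1) - \<phi> 0"
  obtain y where y: "c = \<phi> y" using c by blast
  have exp: "c = \<phi> 0 + y $ 1 *\<^sub>R A + y $ 2 *\<^sub>R B"
    using plane_chart_expansion[OF iso, of y] y by (simp add: A_def B_def)
  have inn: "A \<bullet> A = 1" "B \<bullet> B = 1" "A \<bullet> B = 0"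
    unfolding A_def B_def isometry_inner[OF iso] by (simp_all add: inner_axis_axis)
  have o: "(c - Z) \<bullet> A = 0" "(c - Z) \<bullet> B = 0"
    using orth[of "axis 1 1"] orth[of "axis 2 1"] orth[of 0] unfolding A_def B_def by (simp_all add: inner_simps)
  have u: "\<phi> 0 - Z = (c - Z) - y $ 1 *\<^sub>R A - y $ 2 *\<^sub>R B" by (subst exp) simp
  have "(cone_factor Z \<phi>)\<^sup>2 = (det (matrix (columns3 A B (\<phi> 0 - Z))))\<^sup>2"
    by (simp add: cone_factor_def A_def B_def)
  also have "\<dots> = (c - Z) \<bullet> (c - Z)"
  proof -
    have "A \<bullet> (\<phi> 0 - Z) = - y $ 1" "B \<bullet> (\<phi> 0 - Z) = - y $ 2"
      unfolding u using inn o by (simp_all add: inner_diff_right inner_commute)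
    moreover have "(\<phi> 0 - Z) \<bullet> (\<phi> 0 - Z) = (c - Z) \<bullet> (c - Z) + (y $ 1)\<^sup>2 + (y $ 2)\<^sup>2"
      unfolding u using inn o by (simp add: inner_diff_right inner_diff_left inner_commute power2_eq_square)
    ultimately show ?thesis unfolding det_columns3_sq using inn by simp
  qed
  also have "\<dots> = (dist Z c)\<^sup>2" by (simp add: dist_norm norm_minus_commute power2_norm_eq_inner[symmetric])
  finally show ?thesis
    using power2_eq_iff_nonneg[of "cone_factor Z \<phi>" "dist Z c"] by (simp add: cone_factor_def)
qed

lemma cone_slices:
  fixes \<phi> :: "real^2 \<Rightarrow> pt" and f :: "pt \<Rightarrow> real" and Z :: pt and F :: "pt set"
  defines "d \<equiv> cone_factor Z \<phi>" and "K \<equiv> convex hull (insert Z F)" and "D \<equiv> \<phi> -` F"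
  assumes iso: "isometry \<phi>" and F: "polytope F" "F \<noteq> {}" "F \<subseteq> range \<phi>" and d: "d \<noteq> 0"
    and f: "convex_on K f"
  shows cone_slices_has_integral:
     "((\<lambda>t. t * t * integral D (\<lambda>y. f (Z + t *\<^sub>R (\<phi> y - Z)))) has_integral (integral K f / d)) {0<..<1}"
    and "\<And>t. 0 < t \<Longrightarrow> t < 1 \<Longrightarrow> (\<lambda>y. f (Z + t *\<^sub>R (\<phi> y - Z))) integrable_on D"
proof -
  define T where "T = columns3 (\<phi> (axis 1 1) - \<phi> 0) (\<phi> (axis 2 1) - \<phi> 0) (\<phi> 0 - Z)"
  have dT: "d = \<bar>det (matrix T)\<bar>" by (simp add: d_def T_def cone_factor_def)
  have det: "det (matrix T) \<noteq> 0" using d by (simp add: dT)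
  have linT: "linear T" unfolding T_def by (rule linear_columns3)
  obtain V where V: "finite V" "F = convex hull V" using F by (auto simp: polytope_def)
  have "K = convex hull (insert Z V)" unfolding K_def V(2) by (metis hull_insert hull_hull)
  then have K: "polytope K" using V by (simp add: polytope_convex_hull)
  obtain b where b: "\<And>x. x \<in> K \<Longrightarrow> f x \<le> b"
    using polytope_convex_on_bounded_above[OF K f] by blast
  have P: "Z + T (vector [t * y $ 1, t * y $ 2, t]) = Z + t *\<^sub>R (\<phi> y - Z)" for t y
    unfolding plane_chart_expansion[OF iso, of y] by (simp add: T_def columns3_vector algebra_simps)
  have inK: "\<exists>v y. 0 \<le> v \<and> v \<le> 1 \<and> y \<in> D \<and> w = vector [v * y $ 1, v * y $ 2, v]" if w: "Z + T w \<in> K" for w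
  proof -
    \<comment> \<open>A point of the cone lies on a segment from \<open>Z\<close> to some
      \<open>\<phi> y\<close>; injectivity of \<open>T\<close> turns this into an equation of
      coordinates, so the level and, above level 0, the base point are unique.\<close>
    have "convex hull F = F" using F polytope_imp_convex convex_hull_eq by blast
    then obtain u v p where uv: "u \<ge> 0" "v \<ge> 0" "u + v = 1" "p \<in> F" "Z + T w = u *\<^sub>R Z + v *\<^sub>R p"
      using w convex_hull_insert[OF F(2), of Z] unfolding K_def by auto
    obtain y where y: "p = \<phi> y" using uv F by blast
    have "u = 1 - v" using uv by simp
    then have "Z + T w = (1 - v) *\<^sub>R Z + v *\<^sub>R \<phi> y" using uv(5) y by (simp only:)
    also have "\<dots> = Z + v *\<^sub>R (\<phi> y - Z)" by (simp add: algebra_simps)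
    finally have "Z + T w = Z + v *\<^sub>R (\<phi> y - Z)" .
    then have "T w = T (vector [v * y $ 1, v * y $ 2, v])" unfolding P[symmetric] by simp
    then have "w = vector [v * y $ 1, v * y $ 2, v]"
      using columns3_inj det unfolding T_def by blast
    then show ?thesis using uv y by (intro exI[of _ v] exI[of _ y]) (auto simp: D_def)
  qed
  have iff: "Z + T (vector [t * y $ 1, t * y $ 2, t]) \<in> K \<longleftrightarrow> y \<in> D" if t: "0 < t" "t < 1" for t and y :: "real^2"
  proof
    assume "Z + T (vector [t * y $ 1, t * y $ 2, t]) \<in> K"
    then obtain v y' where v: "y' \<in> D" and eq: "(vector [t * y $ 1, t * y $ 2, t] :: real^3) = vector [v * y' $ 1, v * y' $ 2, v]"
      using inK by blast
    from eq have "t * y $ 1 = v * y' $ 1" "t * y $ 2 = v * y' $ 2" "t = v"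
      by (auto simp: vec_eq_iff forall_3)
    then have "y = y'" using t by (simp add: vec_eq_iff forall_2)
    then show "y \<in> D" using v by simp
  next
    assume "y \<in> D"
    then have "\<phi> y \<in> K" unfolding K_def D_def by (auto intro: hull_inc)
    moreover have "Z \<in> K" unfolding K_def by (auto intro: hull_inc)
    ultimately have "(1 - t) *\<^sub>R Z + t *\<^sub>R \<phi> y \<in> K"
      using t polytope_imp_convex[OF K] by (intro convexD_alt) auto
    then show "Z + T (vector [t * y $ 1, t * y $ 2, t]) \<in> K" unfolding P by (simp add: algebra_simps)
  qed
  have third: "0 \<le> w $ 3 \<and> w $ 3 \<le> 1" if "Z + T w \<in> K" for w
    using inK[OF that] by auto
  note D = plane_chart_preimage(1,2)[OF iso F(1), folded D_def]
  note sl = integral_slices[OF linT det, of "\<lambda>s. s" "\<lambda>s. s" Z K D f b, OF _ _ _ _ iff third _ D]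
  show "((\<lambda>t. t * t * integral D (\<lambda>y. f (Z + t *\<^sub>R (\<phi> y - Z)))) has_integral (integral K f / d)) {0<..<1}"
    using sl(1) f b K by (simp add: P polytope_imp_bounded continuous_intros dT)
  show "(\<lambda>y. f (Z + t *\<^sub>R (\<phi> y - Z))) integrable_on D" if "0 < t" "t < 1" for t
    using sl(2)[of t] that f b K by (simp add: P polytope_imp_bounded continuous_intros)
qed

lemma measure_cone:
  fixes \<phi> :: "real^2 \<Rightarrow> pt"
  assumes iso: "isometry \<phi>" and F: "polytope F" "F \<noteq> {}" "F \<subseteq> range \<phi>" and d: "cone_factor Z \<phi> \<noteq> 0"
  shows "measure lebesgue (convex hull (insert Z F)) = cone_factor Z \<phi> * measure lebesgue (\<phi> -` F) / 3"
proof -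
  let ?K = "convex hull (insert Z F)" and ?A = "measure lebesgue (\<phi> -` F)"
  have "convex_on ?K (\<lambda>_. 1)" by (simp add: convex_on_def flip: distrib_right)
  note sl = cone_slices_has_integral[OF iso F d this]
  have "integral (\<phi> -` F) (\<lambda>_. 1) = ?A"
    using lmeasure_integral[OF plane_chart_preimage(3)[OF iso F(1)]] by simp
  then have "((\<lambda>t. t * t * ?A) has_integral (integral ?K (\<lambda>_. 1) / cone_factor Z \<phi>)) {0<..<1}"
    using sl by simp
  moreover have "((\<lambda>t. t * t * ?A) has_integral (\<lambda>t. t^3/3 * ?A) 1 - (\<lambda>t. t^3/3 * ?A) 0) {0<..<1}"
    by (rule has_integral_polynomial_Ioo)
       (auto intro!: derivative_eq_intros simp: field_simps power2_eq_square)
  ultimately have "integral ?K (\<lambda>_. 1) / cone_factor Z \<phi> = (\<lambda>t. t^3/3 * ?A) 1 - (\<lambda>t. t^3/3 * ?A) 0"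
    by (rule has_integral_unique)
  then have "integral ?K (\<lambda>_. 1) = cone_factor Z \<phi> * ?A / 3" using d by (simp add: field_simps)
  moreover have "?K \<in> lmeasurable"
    using F by (intro lmeasurable_compact compact_convex_hull compact_insert polytope_imp_compact)
  ultimately show ?thesis by (simp add: lmeasure_integral)
qed

text \<open>Convexity on the segments from \<open>Z\<close> to the base bounds the slice at height
  \<open>t\<close>; the weights \<open>t\<^sup>2 * (1 - t)\<close> and \<open>t\<^sup>3\<close>
  integrate to \<open>1/12\<close> and \<open>1/4\<close>. Against the volume, one third of
  \<open>cone_factor\<close> times the area, these become the factors \<open>1/4\<close> and
  \<open>3/4\<close>.\<close>

lemma cone_integral_le:
  fixes \<phi> :: "real^2 \<Rightarrow> pt" and f :: "pt \<Rightarrow> real"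
  assumes iso: "isometry \<phi>" and F: "polytope F" "F \<noteq> {}" "F \<subseteq> range \<phi>" and d: "cone_factor Z \<phi> \<noteq> 0"
    and f: "convex_on (convex hull (insert Z F)) f"
  shows "integral (convex hull (insert Z F)) f \<le>
    cone_factor Z \<phi> * (f Z * measure lebesgue (\<phi> -` F) / 12 + integral (\<phi> -` F) (f \<circ> \<phi>) / 4)"
proof -
  let ?K = "convex hull (insert Z F)" and ?A = "measure lebesgue (\<phi> -` F)" and ?I = "integral (\<phi> -` F) (\<lambda>y. f (\<phi> y))"
  note sl = cone_slices[OF iso F d f]
  note D = plane_chart_preimage[OF iso F(1)]
  have Z: "Z \<in> ?K" by (simp add: hull_inc)
  have FK: "\<phi> y \<in> ?K" if "y \<in> \<phi> -` F" for y using that by (simp add: hull_inc)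
  obtain b where b: "\<And>x. x \<in> F \<Longrightarrow> f x \<le> b"
    using polytope_convex_on_bounded_above[OF F(1), of f] convex_on_subset[OF f, of F] polytope_imp_convex[OF F(1)]
    by (metis hull_subset insert_subset)
  have "convex_on (\<phi> -` F) (\<lambda>y. f (\<phi> y))"
    using FK isometry_affine[OF iso] by (intro convex_on_compose_affine[OF f D(1)]) auto
  then have "(\<lambda>y. f (\<phi> y)) integrable_on (\<phi> -` F)"
    using convex_on_has_integral[OF D(2), of "\<lambda>y. f (\<phi> y)" b] b by (auto simp: integrable_on_def)
  then have "((\<lambda>y. f (\<phi> y)) has_integral ?I) (\<phi> -` F)"
    by (rule integrable_integral)
  moreover have "((\<lambda>_. f Z) has_integral f Z * ?A) (\<phi> -` F)"
  proof -
    have "((\<lambda>_. 1) has_integral ?A) (\<phi> -` F)"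
      unfolding lmeasure_integral[OF D(3)] by (rule integrable_integral[OF integrable_on_const[OF D(3)]])
    from has_integral_mult_right[OF this, of "f Z"] show ?thesis by simp
  qed
  ultimately have int: "((\<lambda>y. (1 - t) * f Z + t * f (\<phi> y)) has_integral ((1 - t) * (f Z * ?A) + t * ?I)) (\<phi> -` F)" for t
    by (intro has_integral_add has_integral_mult_right)
  have slice_le: "integral (\<phi> -` F) (\<lambda>y. f (Z + t *\<^sub>R (\<phi> y - Z))) \<le> (1 - t) * (f Z * ?A) + t * ?I" if t: "0 < t" "t < 1" for t
  proof (rule has_integral_le[OF integrable_integral[OF sl(2)[OF t]] int])
    fix y assume "y \<in> \<phi> -` F"
    then have "f ((1 - t) *\<^sub>R Z + t *\<^sub>R \<phi> y) \<le> (1 - t) * f Z + t * f (\<phi> y)"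
      using t Z FK by (intro convex_onD[OF f]) auto
    then show "f (Z + t *\<^sub>R (\<phi> y - Z)) \<le> (1 - t) * f Z + t * f (\<phi> y)" by (simp add: algebra_simps)
  qed
  have "((\<lambda>t. t * t * ((1 - t) * (f Z * ?A) + t * ?I)) has_integral
     (\<lambda>t. (t^3/3 - t^4/4) * (f Z * ?A) + t^4/4 * ?I) 1 - (\<lambda>t. (t^3/3 - t^4/4) * (f Z * ?A) + t^4/4 * ?I) 0) {0<..<1}"
    by (rule has_integral_polynomial_Ioo)
       (auto intro!: derivative_eq_intros simp: field_simps power2_eq_square power3_eq_cube)
  then have "integral ?K f / cone_factor Z \<phi> \<le>
     (\<lambda>t. (t^3/3 - t^4/4) * (f Z * ?A) + t^4/4 * ?I) 1 - (\<lambda>t. (t^3/3 - t^4/4) * (f Z * ?A) + t^4/4 * ?I) 0"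
    by (rule has_integral_le[OF sl(1)]) (auto intro!: mult_left_mono slice_le)
  then have "integral ?K f / cone_factor Z \<phi> \<le> f Z * ?A / 12 + ?I / 4" by simp
  moreover have "cone_factor Z \<phi> > 0" using d by (simp add: cone_factor_def)
  ultimately show ?thesis by (simp add: pos_divide_le_eq mult.commute o_def)
qed

text \<open>Jensen's inequality for the weight \<open>3 t\<^sup>2\<close> on \<open>[0, 1]\<close>, whose barycentre is \<open>3/4\<close>.\<close>

lemma cone_integral_ge:
  fixes \<phi> :: "real^2 \<Rightarrow> pt" and f :: "pt \<Rightarrow> real"
  assumes iso: "isometry \<phi>" and F: "polytope F" "F \<noteq> {}" "F \<subseteq> range \<phi>" and d: "cone_factor Z \<phi> \<noteq> 0"
    and f: "convex_on (convex hull (insert Z F)) f"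
  shows "cone_factor Z \<phi> / 3 * integral (\<phi> -` F) (\<lambda>y. f (Z + (3/4) *\<^sub>R (\<phi> y - Z)))
    \<le> integral (convex hull (insert Z F)) f"
proof -
  let ?K = "convex hull (insert Z F)"
  define G where "G t = integral (\<phi> -` F) (\<lambda>y. f (Z + t *\<^sub>R (\<phi> y - Z)))" for t
  note sl = cone_slices[OF iso F d f]
  have Z: "Z \<in> ?K" by (simp add: hull_inc)
  have inK: "Z + t *\<^sub>R (\<phi> y - Z) \<in> ?K" if "y \<in> \<phi> -` F" "0 < t" "t < 1" for y t
  proof -
    have "(1 - t) *\<^sub>R Z + t *\<^sub>R \<phi> y \<in> ?K"
      using that Z by (intro convexD_alt[OF convex_convex_hull]) (auto simp: hull_inc)
    then show ?thesis by (simp add: algebra_simps)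
  qed
  \<comment> \<open>For each base point, \<open>t \<mapsto> Z + t *\<^sub>R (\<phi> y - Z)\<close>
    is affine, so convexity of \<open>f\<close> along the rays survives integration over the
    base.\<close>
  have "convex_on {0<..<1} G"
    unfolding convex_on_def
  proof (intro conjI ballI allI impI)
    fix s t u v :: real assume st: "s \<in> {0<..<1}" "t \<in> {0<..<1}" and uv: "0 \<le> u" "0 \<le> v" "u + v = 1"
    have m: "u *\<^sub>R s + v *\<^sub>R t \<in> {0<..<1}"
      using convexD[OF convex_real_interval(8) st(1) st(2) uv] .
    have "((\<lambda>y. u * f (Z + s *\<^sub>R (\<phi> y - Z)) + v * f (Z + t *\<^sub>R (\<phi> y - Z))) has_integral u * G s + v * G t) (\<phi> -` F)"
      unfolding G_def using sl(2) st by (intro has_integral_add has_integral_mult_right integrable_integral) auto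
    then show "G (u *\<^sub>R s + v *\<^sub>R t) \<le> u * G s + v * G t"
      unfolding G_def[of "u *\<^sub>R s + v *\<^sub>R t"]
    proof (rule has_integral_le[OF integrable_integral[OF sl(2)], rotated 2])
      fix y assume y: "y \<in> \<phi> -` F"
      have "Z + (u *\<^sub>R s + v *\<^sub>R t) *\<^sub>R (\<phi> y - Z) = (u + v) *\<^sub>R Z + (u *\<^sub>R s + v *\<^sub>R t) *\<^sub>R (\<phi> y - Z)" using uv by simp
      also have "\<dots> = u *\<^sub>R (Z + s *\<^sub>R (\<phi> y - Z)) + v *\<^sub>R (Z + t *\<^sub>R (\<phi> y - Z))" by (simp add: algebra_simps)
      finally show "f (Z + (u *\<^sub>R s + v *\<^sub>R t) *\<^sub>R (\<phi> y - Z)) \<le> u * f (Z + s *\<^sub>R (\<phi> y - Z)) + v * f (Z + t *\<^sub>R (\<phi> y - Z))"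
        using f inK[OF y] st uv unfolding convex_on_def by auto
    qed (use m in auto)
  qed simp
  then obtain m where m: "\<And>t. t \<in> {0<..<1} \<Longrightarrow> G (3/4) + m * (t - 3/4) \<le> G t"
    using convex_on_subgradient[of 0 1 G "3/4"] by auto
  \<comment> \<open>The slope \<open>m\<close> drops out, because
    \<open>t\<^sup>2 * (t - 3/4)\<close> has integral zero over the unit interval.\<close>
  have "((\<lambda>t. t * t * (G (3/4) + m * (t - 3/4))) has_integral
     (\<lambda>t. t^3/3 * G (3/4) + m * (t^4/4 - t^3/4)) 1 - (\<lambda>t. t^3/3 * G (3/4) + m * (t^4/4 - t^3/4)) 0) {0<..<1}"
    by (rule has_integral_polynomial_Ioo)
       (auto intro!: derivative_eq_intros simp: field_simps power2_eq_square power3_eq_cube)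
  then have "(\<lambda>t. t^3/3 * G (3/4) + m * (t^4/4 - t^3/4)) 1 - (\<lambda>t. t^3/3 * G (3/4) + m * (t^4/4 - t^3/4)) 0
     \<le> integral ?K f / cone_factor Z \<phi>"
    by (rule has_integral_le[OF _ sl(1)[folded G_def]]) (auto intro!: mult_left_mono m)
  then have "G (3/4) / 3 \<le> integral ?K f / cone_factor Z \<phi>" by simp
  moreover have "cone_factor Z \<phi> > 0" using d by (simp add: cone_factor_def)
  ultimately show ?thesis by (simp add: pos_le_divide_eq mult.commute G_def)
qed

section \<open>Length and area integrals\<close>

text \<open>The parametrisation has constant speed, so for \<open>a \<noteq> b\<close> this is the
  average with respect to length.\<close>

definition segment_mean :: "('a::real_vector \<Rightarrow> real) \<Rightarrow> 'a \<Rightarrow> 'a \<Rightarrow> real" where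
  "segment_mean f a b = integral {0..1} (\<lambda>u. f ((1 - u) *\<^sub>R a + u *\<^sub>R b))"

text \<open>\<open>line_param\<close> is a choice, so nothing is known about it until some isometric
  parametrisation has been exhibited.\<close>

lemma line_param_segment:
  fixes a b :: pt
  assumes "a \<noteq> b"
  shows "isometry (line_param (closed_segment a b)) \<and> closed_segment a b \<subseteq> range (line_param (closed_segment a b))"
proof -
  let ?n = "norm (b - a)"
  let ?\<phi> = "\<lambda>t::real. a + (t / ?n) *\<^sub>R (b - a)"
  have n: "?n > 0" using assms by simp
  have "isometry ?\<phi>"
    unfolding isometry_def
  proof (intro allI)
    fix x y :: real
    have "?\<phi> x - ?\<phi> y = ((x - y) / ?n) *\<^sub>R (b - a)" by (simp add: algebra_simps diff_divide_distrib)
    then show "dist (?\<phi> x) (?\<phi> y) = dist x y" using n by (simp add: dist_norm)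
  qed
  moreover have "closed_segment a b \<subseteq> range ?\<phi>"
  proof
    fix x assume "x \<in> closed_segment a b"
    then obtain u where "x = (1 - u) *\<^sub>R a + u *\<^sub>R b" by (auto simp: closed_segment_def)
    then have "x = ?\<phi> (u * ?n)" using n by (simp add: algebra_simps)
    then show "x \<in> range ?\<phi>" by blast
  qed
  ultimately show ?thesis
    unfolding line_param_def by (intro someI_ex[of "\<lambda>\<phi>. isometry \<phi> \<and> closed_segment a b \<subseteq> range \<phi>"]) blast
qed

text \<open>Whichever isometry was chosen, it is affine, so the preimage of the segment is an
  interval of the right length. The orientation remains open; hence
  \<open>closed_segment s r\<close> and the absolute value.\<close>

lemma line_param_segment_vimage:
  fixes a b :: pt
  assumes ab: "a \<noteq> b"
  obtains s r where "s \<noteq> r" "\<bar>r - s\<bar> = dist a b" "line_param (closed_segment a b) -` closed_segment a b = closed_segment s r"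
    "\<And>u. line_param (closed_segment a b) ((1 - u) * s + u * r) = (1 - u) *\<^sub>R a + u *\<^sub>R b"
proof -
  define \<phi> where "\<phi> = line_param (closed_segment a b)"
  have iso: "isometry \<phi>" and sub: "closed_segment a b \<subseteq> range \<phi>"
    using line_param_segment[OF ab] by (auto simp: \<phi>_def)
  obtain s r where sr: "a = \<phi> s" "b = \<phi> r" using sub by (metis ends_in_segment imageE in_mono)
  have aff: "\<phi> ((1 - u) * s + u * r) = (1 - u) *\<^sub>R a + u *\<^sub>R b" for u
    using isometry_affine[OF iso, of "1 - u" u s r] sr by simp
  have "\<phi> -` closed_segment a b = closed_segment s r"
  proof (intro set_eqI iffI)
    fix x assume "x \<in> \<phi> -` closed_segment a b"
    then obtain u where u: "0 \<le> u" "u \<le> 1" "\<phi> x = (1 - u) *\<^sub>R a + u *\<^sub>R b" by (auto simp: closed_segment_def)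
    then have "x = (1 - u) * s + u * r" using aff isometry_inj[OF iso] by metis
    then show "x \<in> closed_segment s r" using u by (auto simp: closed_segment_def)
  next
    fix x assume "x \<in> closed_segment s r"
    then obtain u where u: "0 \<le> u" "u \<le> 1" "x = (1 - u) * s + u * r" by (auto simp: closed_segment_def)
    then show "x \<in> \<phi> -` closed_segment a b" using aff[of u] by (auto simp: closed_segment_def)
  qed
  moreover have "s \<noteq> r" using sr ab by auto
  moreover have "\<bar>r - s\<bar> = dist a b" using iso sr by (simp add: isometry_def dist_real_def abs_minus_commute)
  ultimately show ?thesis using that[of s r] aff by (simp add: \<phi>_def)
qed

lemma line_integral_segment:
  fixes a b :: pt
  assumes ab: "a \<noteq> b" and int: "(\<lambda>u. f ((1 - u) *\<^sub>R a + u *\<^sub>R b)) integrable_on {0..1}"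
  shows "line_integral (closed_segment a b) f = dist a b * segment_mean f a b"
proof -
  define \<phi> where "\<phi> = line_param (closed_segment a b)"
  obtain s r where sr: "s \<noteq> r" "\<bar>r - s\<bar> = dist a b" "\<phi> -` closed_segment a b = closed_segment s r"
    "\<And>u. \<phi> ((1 - u) * s + u * r) = (1 - u) *\<^sub>R a + u *\<^sub>R b"
    using line_param_segment_vimage[OF ab] unfolding \<phi>_def by blast
  let ?h = "\<lambda>u. f ((1 - u) *\<^sub>R a + u *\<^sub>R b)"
  have h: "(?h has_integral segment_mean f a b) (cbox 0 1)"
    using integrable_integral[OF int] by (simp add: segment_mean_def)
  \<comment> \<open>\<open>x \<mapsto> ?m * x + ?c\<close> inverts the parametrisation
    \<open>u \<mapsto> (1 - u) * s + u * r\<close>.\<close>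
  let ?m = "1 / (r - s)" and ?c = "- s / (r - s)"
  have m: "?m \<noteq> 0" using sr by simp
  have "((\<lambda>x. ?h (?m *\<^sub>R x + ?c)) has_integral (1 / \<bar>?m\<bar> ^ DIM(real)) *\<^sub>R segment_mean f a b)
     ((\<lambda>x. (1 / ?m) *\<^sub>R x + - ((1 / ?m) *\<^sub>R ?c)) ` cbox 0 1)"
    by (rule has_integral_affinity[OF h m])
  moreover have "(\<lambda>x. (1 / ?m) *\<^sub>R x + - ((1 / ?m) *\<^sub>R ?c)) ` cbox 0 1 = closed_segment s r"
  proof -
    have "(\<lambda>x. (1 / ?m) *\<^sub>R x + - ((1 / ?m) *\<^sub>R ?c)) = (\<lambda>u. (1 - u) *\<^sub>R s + u *\<^sub>R r)"
      using sr(1) by (auto simp: fun_eq_iff field_simps)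
    then show ?thesis unfolding closed_segment_image_interval by (simp only: cbox_interval)
  qed
  moreover have "(\<lambda>x. ?h (?m *\<^sub>R x + ?c)) = f \<circ> \<phi>"
  proof
    fix x
    define u where "u = (x - s) / (r - s)"
    have u: "?m *\<^sub>R x + ?c = u" by (simp add: u_def diff_divide_distrib)
    have "(1 - u) * s + u * r = s + u * (r - s)" by (simp add: algebra_simps)
    also have "u * (r - s) = x - s" using sr(1) by (simp add: u_def)
    finally have "(1 - u) * s + u * r = x" by simp
    then show "?h (?m *\<^sub>R x + ?c) = (f \<circ> \<phi>) x" unfolding u using sr(4)[of u] by simp
  qed
  ultimately have "((f \<circ> \<phi>) has_integral (\<bar>r - s\<bar> * segment_mean f a b)) (closed_segment s r)"
    by simp
  then show ?thesis
    unfolding line_integral_def \<phi>_def[symmetric] sr(3) sr(2) by (rule integral_unique)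
qed

lemma line_length_segment:
  fixes a b :: pt
  assumes ab: "a \<noteq> b"
  shows "line_length (closed_segment a b) = dist a b"
proof -
  obtain s r where sr: "\<bar>r - s\<bar> = dist a b"
    "line_param (closed_segment a b) -` closed_segment a b = closed_segment s r"
    by (rule line_param_segment_vimage[OF ab])
  show ?thesis
    unfolding line_length_def sr(2) using sr(1) by (auto simp: closed_segment_eq_real_ivl)
qed

text \<open>The direction space of \<open>F\<close> has dimension 2 and is therefore isometric to
  \<open>real^2\<close>; this supplies the witness for the choice in
  \<open>plane_param\<close>.\<close>

lemma plane_param_isometry:
  fixes F :: "pt set"
  assumes "aff_dim F = 2"
  shows "isometry (plane_param F) \<and> F \<subseteq> range (plane_param F)"
proof -
  have "F \<noteq> {}" using assms by auto
  then obtain a where a: "a \<in> F" by blast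
  let ?S = "(\<lambda>x. - a + x) ` (affine hull F)"
  have sub: "subspace ?S"
    using affine_diffs_subspace[OF affine_affine_hull, of a F] a by (simp add: hull_inc)
  have "aff_dim ?S = 2" using assms aff_dim_translation_eq[of "-a" "affine hull F"] by simp
  then have dim: "dim ?S = 2" using sub aff_dim_subspace[of ?S] by simp
  have "dim (UNIV :: (real^2) set) = dim ?S" using dim by simp
  then obtain h where h: "linear h" "range h = ?S" "\<And>y :: real^2. norm (h y) = norm y"
    using isometries_subspaces[OF subspace_UNIV sub] by (metis UNIV_I)
  let ?\<phi> = "\<lambda>y. a + h y"
  have "isometry ?\<phi>"
    by (simp add: isometry_def dist_norm h(3) flip: linear_diff[OF h(1)])
  moreover have "F \<subseteq> range ?\<phi>"
  proof
    fix x assume "x \<in> F"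
    then have "- a + x \<in> range h" unfolding h(2) by (intro imageI hull_inc)
    then obtain y where "- a + x = h y" by blast
    then have "x = a + h y" by (simp add: algebra_simps)
    then show "x \<in> range ?\<phi>" by blast
  qed
  ultimately show ?thesis
    unfolding plane_param_def by (intro someI_ex[of "\<lambda>\<phi>. isometry \<phi> \<and> F \<subseteq> range \<phi>"]) blast
qed

text \<open>For the homothety of ratio \<open>3/4\<close>: plane integrals pick up the square of the
  ratio, \<open>9/16\<close>.\<close>

lemma convex_integral_scale:
  fixes h :: "real^2 \<Rightarrow> real"
  assumes D: "bounded D" and h: "convex_on D h" "\<And>x. x \<in> D \<Longrightarrow> h x \<le> b" and c: "c > 0"
  shows "integral D h = c\<^sup>2 * integral ((\<lambda>y. c *\<^sub>R y) -` D) (\<lambda>y. h (c *\<^sub>R y))"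
proof -
  let ?D' = "(\<lambda>y. c *\<^sub>R y) -` D"
  have D': "?D' = (\<lambda>y. inverse c *\<^sub>R y) ` D"
    using c by (auto simp: image_iff intro!: bexI[of _ "c *\<^sub>R _"])
  have conv: "convex D" using h by (simp add: convex_on_def)
  have lin: "linear (\<lambda>y :: real^2. c *\<^sub>R y)" by (simp add: linear_scaleR)
  have det: "det (matrix (\<lambda>y :: real^2. c *\<^sub>R y)) = c\<^sup>2"
    by (simp add: det_2 matrix_def axis_def power2_eq_square)
  have "convex_on ?D' (\<lambda>y. h (c *\<^sub>R y))"
    unfolding D' using conv c
    by (intro convex_on_compose_affine[OF h(1)] convex_scaling) (auto simp: algebra_simps)
  then have int': "integral ?D' (\<lambda>y. h (c *\<^sub>R y)) = (\<integral>y. indicator (interior ?D') y * h (c *\<^sub>R y) \<partial>lborel)"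
    using h(2) bounded_scaling[OF D, of "inverse c"] unfolding D'[symmetric]
    by (intro integral_unique convex_on_has_integral[of _ _ b]) auto
  have ind: "indicator (interior D) (c *\<^sub>R y) = (indicator (interior ?D') y :: real)" for y
  proof -
    have "interior ?D' = (\<lambda>y. inverse c *\<^sub>R y) ` interior D"
      unfolding D' using c by (intro interior_injective_linear_image linear_scaleR) (auto simp: inj_def)
    then have "y \<in> interior ?D' \<longleftrightarrow> c *\<^sub>R y \<in> interior D" using c by (auto simp: image_iff intro!: bexI[of _ "c *\<^sub>R y"])
    then show ?thesis by (simp add: indicator_def)
  qed
  have int: "integral D h = (\<integral>y. indicator (interior D) y * h y \<partial>lborel)"
    by (intro integral_unique convex_on_has_integral[OF D h])
  also have "\<dots> = c\<^sup>2 * (\<integral>y. indicator (interior D) (0 + c *\<^sub>R y) * h (0 + c *\<^sub>R y) \<partial>lborel)"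
    using integral_lborel_affine(1)[OF lin _ convex_on_indicator_measurable[OF D h], of 0] c
    by (simp add: det)
  finally show ?thesis using int' ind by simp
qed

section \<open>Inscribed polygons with equal sides\<close>

text \<open>The closest point works: its angle inequality at \<open>x\<close> and at the mirror
  image of \<open>x\<close> in that point together give equality.\<close>

lemma orthogonal_foot_exists:
  fixes Z :: "'a::euclidean_space"
  assumes "affine A" "A \<noteq> {}"
  obtains c where "c \<in> A" "\<And>x. x \<in> A \<Longrightarrow> (Z - c) \<bullet> (x - c) = 0"
proof -
  let ?c = "closest_point A Z"
  have cl: "closed A" "convex A" using assms affine_closed affine_imp_convex by auto
  have c: "?c \<in> A" using closest_point_in_set cl assms by blast
  have le: "(Z - ?c) \<bullet> (x - ?c) \<le> 0" if "x \<in> A" for x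
    using closest_point_dot[OF cl(2,1) that] .
  have "(Z - ?c) \<bullet> (x - ?c) = 0" if "x \<in> A" for x
  proof -
    have "2 *\<^sub>R ?c + (-1) *\<^sub>R x \<in> A" using mem_affine[OF assms(1) c that, of 2 "-1"] by simp
    from le[OF this] have "(Z - ?c) \<bullet> (x - ?c) \<ge> 0" by (simp add: inner_simps)
    with le[OF that] show ?thesis by simp
  qed
  with c show ?thesis using that by blast
qed

lemma polytope_segment:
  fixes E :: "'a::euclidean_space set"
  assumes "polytope E" "aff_dim E = 1"
  obtains a b where "E = closed_segment a b" "a \<noteq> b"
proof -
  have "E \<noteq> {}" "collinear E" using assms by (auto simp: collinear_aff_dim)
  then obtain a b where ab: "E = closed_segment a b"
    using compact_convex_collinear_segment[of E] assms polytope_imp_compact polytope_imp_convex by metis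
  then have "a \<noteq> b" using assms by auto
  with ab show ?thesis using that by blast
qed

lemma diameter_segment: "diameter (closed_segment a b) = dist a b"
  for a b :: "'a::euclidean_space"
proof (rule antisym)
  show "diameter (closed_segment a b) \<le> dist a b"
  proof (rule diameter_le)
    fix x y assume "x \<in> closed_segment a b" "y \<in> closed_segment a b"
    then obtain s t where st: "0 \<le> s" "s \<le> 1" "0 \<le> t" "t \<le> 1" "x = (1 - s) *\<^sub>R a + s *\<^sub>R b" "y = (1 - t) *\<^sub>R a + t *\<^sub>R b"
      by (auto simp: closed_segment_def)
    have "x - y = (t - s) *\<^sub>R (a - b)" unfolding st by (simp add: algebra_simps)
    then have "norm (x - y) = \<bar>t - s\<bar> * norm (a - b)" by simp
    also have "\<dots> \<le> 1 * norm (a - b)" using st by (intro mult_right_mono) auto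
    finally show "norm (x - y) \<le> dist a b" by (simp add: dist_norm)
  qed simp
  show "dist a b \<le> diameter (closed_segment a b)"
    by (intro diameter_bounded_bound) (auto simp: compact_imp_bounded)
qed

lemma facets_eq: "aff_dim P \<ge> 1 \<Longrightarrow> facets P = {F. F facet_of P}"
  by (auto simp: facets_def facet_of_def)

lemma edges_eq_facets: "aff_dim F = 2 \<Longrightarrow> edges F = facets F"
  by (simp add: facets_def edges_def)

lemma vertices_face: "F face_of P \<Longrightarrow> vertices F = vertices P \<inter> F"
  by (auto simp: vertices_def extreme_point_of_face)

lemma vertices_segment: "vertices (closed_segment a b) = {a, b}"
  by (auto simp: vertices_def extreme_point_of_segment)

lemma finite_vertices: "polytope P \<Longrightarrow> finite (vertices P)"
  unfolding vertices_def by (intro finite_polyhedron_extreme_points polytope_imp_polyhedron)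

lemma polytope_eq_hull_vertices: "polytope P \<Longrightarrow> P = convex hull (vertices P)"
  unfolding vertices_def by (intro Krein_Milman_Minkowski polytope_imp_compact polytope_imp_convex)

lemma affine_hull_vertices: "polytope P \<Longrightarrow> affine hull (vertices P) = affine hull P"
  using polytope_eq_hull_vertices affine_hull_convex_hull by metis

lemma finite_facets: "polytope P \<Longrightarrow> finite (facets P)"
  unfolding facets_def by (rule finite_subset[OF _ finite_polytope_faces[of P]]) auto

lemma finite_edges: "polytope P \<Longrightarrow> finite (edges P)"
  unfolding edges_def by (rule finite_subset[OF _ finite_polytope_faces[of P]]) auto

text \<open>What a face inherits from \<open>B\<close>: a point of its plane equidistant from the
  vertices, and sides of one length. That \<open>c\<close> lies inside \<open>F\<close> and is the
  vertex average is derived below, not assumed.\<close>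

locale inscribed_polygon =
  fixes F :: "pt set" and c :: pt and rad len :: real
  assumes poly: "polytope F" and dim: "aff_dim F = 2"
    and center: "c \<in> affine hull F"
    and radius: "\<And>v. v \<in> vertices F \<Longrightarrow> dist c v = rad"
    and side: "\<And>E. E \<in> edges F \<Longrightarrow> diameter E = len"
begin

lemma edge_cases:
  assumes "E \<in> edges F"
  obtains a b where "E = closed_segment a b" "a \<noteq> b" "a \<in> vertices F" "b \<in> vertices F" "dist a b = len"
    "vertices E = {a, b}"
proof -
  have E: "E face_of F" "aff_dim E = 1" using assms by (auto simp: edges_def)
  then obtain a b where ab: "E = closed_segment a b" "a \<noteq> b"
    using polytope_segment[of E] face_of_polytope_polytope[OF poly] by metis
  have "vertices E = {a, b}" using ab by (simp add: vertices_segment)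
  moreover from this have "a \<in> vertices F" "b \<in> vertices F" using vertices_face[OF E(1)] by auto
  moreover have "dist a b = len" using side[OF assms] ab by (simp add: diameter_segment)
  ultimately show ?thesis using ab that by blast
qed

lemma center_orthogonal_midpoint:
  assumes "dist c a = rad" "dist c b = rad" "dist a b = len" "x \<in> closed_segment a b"
  shows "(c - midpoint a b) \<bullet> (x - midpoint a b) = 0" "(dist c (midpoint a b))\<^sup>2 = rad\<^sup>2 - len\<^sup>2 / 4"
proof -
  have eq: "(c - a) \<bullet> (c - a) = rad\<^sup>2" "(c - b) \<bullet> (c - b) = rad\<^sup>2" "(a - b) \<bullet> (a - b) = len\<^sup>2"
    using assms by (auto simp: dist_norm power2_norm_eq_inner[symmetric])
  have m: "midpoint a b = (1/2) *\<^sub>R (a + b)" by (simp add: midpoint_def)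
  obtain u where xu: "x = (1 - u) *\<^sub>R a + u *\<^sub>R b" using assms by (auto simp: closed_segment_def)
  have x: "x - midpoint a b = (1/2 - u) *\<^sub>R (a - b)"
    unfolding m xu by (simp add: vec_eq_iff field_simps)
  define A where "A = c - a"
  define B where "B = c - b"
  have AB: "c - midpoint a b = (1/2) *\<^sub>R (A + B)" "a - b = B - A"
    unfolding m A_def B_def by (simp_all add: vec_eq_iff field_simps)
  have eqAB: "A \<bullet> A = rad\<^sup>2" "B \<bullet> B = rad\<^sup>2" "(B - A) \<bullet> (B - A) = len\<^sup>2"
    using eq by (simp_all add: A_def B_def)
  have "(A + B) \<bullet> (B - A) = B \<bullet> B - A \<bullet> A"
    by (simp add: inner_diff_left inner_diff_right inner_add_left inner_add_right inner_commute)
  then show "(c - midpoint a b) \<bullet> (x - midpoint a b) = 0" using eqAB by (simp add: x AB)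
  have "(A + B) \<bullet> (A + B) = 2 * (A \<bullet> A) + 2 * (B \<bullet> B) - (B - A) \<bullet> (B - A)"
    by (simp add: inner_diff_left inner_diff_right inner_add_left inner_add_right inner_commute)
  then show "(dist c (midpoint a b))\<^sup>2 = rad\<^sup>2 - len\<^sup>2 / 4"
    unfolding dist_norm power2_norm_eq_inner AB eqAB by simp
qed

text \<open>In dimension two the facets are the edges, and the feet of the perpendiculars from
  \<open>c\<close> are their midpoints, all equally far since the sides are equal.
  \<open>face_center\<close> serves as the map from an edge to its midpoint.\<close>

lemma center_in_rel_interior: "c \<in> rel_interior F"
proof (rule equidistant_feet_imp_rel_interior[OF poly _ center])
  have mid: "face_center (closed_segment a b) = midpoint a b" if "a \<noteq> b" for a b :: pt
    using that by (simp add: face_center_def vertices_segment midpoint_def)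
  have facet: "E \<in> edges F" if "E facet_of F" for E
    using that dim by (auto simp: edges_def facet_of_def)
  show "face_center E \<in> rel_interior E" if E: "E facet_of F" for E
  proof -
    obtain a b where "E = closed_segment a b" "a \<noteq> b" using edge_cases[OF facet[OF E]] by metis
    then show ?thesis using mid by (simp add: rel_interior_closed_segment)
  qed
  show "(c - face_center E) \<bullet> (x - face_center E) = 0" if E: "E facet_of F" and x: "x \<in> E" for E x
  proof -
    obtain a b where ab: "E = closed_segment a b" "a \<noteq> b" "a \<in> vertices F" "b \<in> vertices F" "dist a b = len"
      using edge_cases[OF facet[OF E]] by metis
    then show ?thesis using mid center_orthogonal_midpoint(1)[of a b x] radius x by simp
  qed
  show "dist c (face_center E) = sqrt (rad\<^sup>2 - len\<^sup>2 / 4)" if E: "E facet_of F" for E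
  proof -
    obtain a b where ab: "E = closed_segment a b" "a \<noteq> b" "a \<in> vertices F" "b \<in> vertices F" "dist a b = len"
      using edge_cases[OF facet[OF E]] by metis
    then have "(dist c (face_center E))\<^sup>2 = rad\<^sup>2 - len\<^sup>2 / 4"
      using mid center_orthogonal_midpoint(2)[of a b a] radius by simp
    then show ?thesis by (metis real_sqrt_unique zero_le_dist)
  qed
qed (simp add: dim)

lemma card_edges_at_vertex:
  assumes "v \<in> vertices F"
  shows "card {E \<in> edges F. v \<in> E} = 2"
proof -
  have "{v} face_of F" using assms by (simp add: vertices_def face_of_singleton)
  then have "card {E. E facet_of F \<and> {v} \<subseteq> E} = 2"
    using ridge_in_two_facets[of F "{v}"] poly dim polytope_imp_polyhedron by auto
  moreover have "{E. E facet_of F \<and> {v} \<subseteq> E} = {E \<in> edges F. v \<in> E}"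
    using dim facets_eq[of F] edges_eq_facets[of F] by auto
  ultimately show ?thesis by simp
qed

text \<open>Double counting: every vertex of a polygon lies on two of its edges.\<close>

lemma sum_edges_vertices:
  fixes g :: "pt \<Rightarrow> 'b::real_vector"
  shows "(\<Sum>E\<in>edges F. \<Sum>v\<in>vertices E. g v) = 2 *\<^sub>R (\<Sum>v\<in>vertices F. g v)"
proof -
  have "vertices E = {v \<in> vertices F. v \<in> E}" if "E \<in> edges F" for E
    using vertices_face[of E F] that by (auto simp: edges_def)
  then have "(\<Sum>E\<in>edges F. \<Sum>v\<in>vertices E. g v) = (\<Sum>E\<in>edges F. \<Sum>v\<in>{v \<in> vertices F. v \<in> E}. g v)"
    by simp
  also have "\<dots> = (\<Sum>v\<in>vertices F. \<Sum>E\<in>{E \<in> edges F. v \<in> E}. g v)"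
    by (rule sum.swap_restrict) (use poly finite_edges finite_vertices in auto)
  also have "\<dots> = (\<Sum>v\<in>vertices F. 2 *\<^sub>R g v)"
    by (intro sum.cong refl) (simp add: sum_constant_scaleR card_edges_at_vertex)
  finally show ?thesis by (simp add: scaleR_sum_right)
qed

lemma edges_at_vertex:
  assumes v: "v \<in> vertices F"
  obtains u w where "u \<noteq> w" "u \<in> vertices F" "w \<in> vertices F" "dist u v = len" "dist w v = len" "u \<noteq> v" "w \<noteq> v"
    "{E \<in> edges F. v \<in> E} = {closed_segment v u, closed_segment v w}"
proof -
  obtain E1 E2 where E: "{E \<in> edges F. v \<in> E} = {E1, E2}" "E1 \<noteq> E2"
    using card_edges_at_vertex[OF v] by (meson card_2_iff)
  have other: "\<exists>u. E = closed_segment v u \<and> u \<noteq> v \<and> u \<in> vertices F \<and> dist u v = len" if E: "E \<in> edges F" "v \<in> E" for E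
  proof -
    obtain a b where ab: "E = closed_segment a b" "a \<noteq> b" "a \<in> vertices F" "b \<in> vertices F" "dist a b = len"
      "vertices E = {a, b}" using edge_cases[OF E(1)] by metis
    have "v \<in> vertices E" using vertices_face[of E F] v E by (auto simp: edges_def)
    then show ?thesis using ab by (metis closed_segment_commute dist_commute empty_iff insert_iff)
  qed
  obtain u where u: "E1 = closed_segment v u" "u \<noteq> v" "u \<in> vertices F" "dist u v = len" using other[of E1] E by blast
  obtain w where w: "E2 = closed_segment v w" "w \<noteq> v" "w \<in> vertices F" "dist w v = len" using other[of E2] E by blast
  have "u \<noteq> w" using E u w by blast
  then show ?thesis using that[of u w] u w E by simp
qed

text \<open>The factor is twice the cosine of the central angle over a side. Relative to
  \<open>c\<close>, both neighbours have the same inner product with \<open>v\<close>, so their sum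
  minus this multiple of \<open>v\<close> is orthogonal to \<open>v\<close> and to their difference;
  these two vectors already span the directions of the plane.\<close>

lemma neighbours_sum:
  assumes "u \<noteq> w" "u \<in> vertices F" "w \<in> vertices F" "v \<in> vertices F" "dist u v = len" "dist w v = len" "u \<noteq> v"
  shows "rad > 0" "(u - c) + (w - c) = (2 - len\<^sup>2 / rad\<^sup>2) *\<^sub>R (v - c)"
proof -
  define p q r where "p = u - c" and "q = w - c" and "r = v - c"
  have rad: "norm p = rad" "norm q = rad" "norm r = rad"
    using radius[OF assms(2)] radius[OF assms(3)] radius[OF assms(4)]
    by (simp_all add: p_def q_def r_def dist_norm[symmetric] dist_commute)
  have "rad \<noteq> 0" using rad assms by (auto simp: p_def r_def)
  then show pos: "rad > 0" using rad(1) norm_ge_zero[of p] by simp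
  have sq: "p \<bullet> p = rad\<^sup>2" "q \<bullet> q = rad\<^sup>2" "r \<bullet> r = rad\<^sup>2" using rad by (simp_all add: power2_norm_eq_inner[symmetric])
  have "(norm (p - r))\<^sup>2 = len\<^sup>2" "(norm (q - r))\<^sup>2 = len\<^sup>2"
    using assms by (simp_all add: p_def q_def r_def dist_norm)
  then have pr: "p \<bullet> r = rad\<^sup>2 - len\<^sup>2 / 2" "q \<bullet> r = rad\<^sup>2 - len\<^sup>2 / 2"
    unfolding power2_norm_eq_inner by (simp_all add: inner_diff_left inner_diff_right inner_commute sq)
  define k where "k = 2 - len\<^sup>2 / rad\<^sup>2"
  have k: "k * rad\<^sup>2 = 2 * (rad\<^sup>2 - len\<^sup>2 / 2)" using pos by (simp add: k_def field_simps)
  define x where "x = p + q - k *\<^sub>R r"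
  have orth: "x \<bullet> r = 0" "x \<bullet> (p - q) = 0" "r \<bullet> (p - q) = 0"
    unfolding x_def using pr
    by (simp_all add: inner_diff_left inner_diff_right inner_add_left inner_add_right inner_commute sq k)
  let ?S = "(\<lambda>x. - c + x) ` (affine hull F)"
  have sub: "subspace ?S" using affine_diffs_subspace[OF affine_affine_hull center] .
  have "aff_dim ?S = 2" using dim aff_dim_translation_eq[of "-c" "affine hull F"] by simp
  then have dimS: "dim ?S = 2" using sub aff_dim_subspace[of ?S] by simp
  have inS: "z - c \<in> ?S" if "z \<in> vertices F" for z
    using that poly by (auto simp: vertices_def extreme_point_of_def hull_inc)
  have pqr: "p \<in> ?S" "q \<in> ?S" "r \<in> ?S" using inS assms by (auto simp: p_def q_def r_def)
  then have S: "x \<in> ?S" "p - q \<in> ?S"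
    unfolding x_def using sub by (simp_all only: subspace_diff subspace_add subspace_scale)
  have "x = 0"
  proof (rule ccontr)
    assume "x \<noteq> 0"
    have nz: "r \<noteq> 0" "p - q \<noteq> 0" using pos rad assms by (auto simp: p_def q_def)
    have "pairwise orthogonal {x, r, p - q}"
      using orth by (auto simp: pairwise_def orthogonal_def inner_commute)
    then have "independent {x, r, p - q}"
      using \<open>x \<noteq> 0\<close> nz by (intro pairwise_orthogonal_independent) auto
    then have "card {x, r, p - q} \<le> 2"
      using independent_card_le_dim[of "{x, r, p - q}" ?S] S pqr dimS by simp
    moreover have "x \<noteq> r" "x \<noteq> p - q" "r \<noteq> p - q"
      using orth \<open>x \<noteq> 0\<close> nz by auto
    ultimately show False by simp
  qed
  then show "(u - c) + (w - c) = (2 - len\<^sup>2 / rad\<^sup>2) *\<^sub>R (v - c)"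
    by (simp add: x_def p_def q_def r_def k_def)
qed

lemma vertices_nonempty: "vertices F \<noteq> {}"
  using polytope_eq_hull_vertices[OF poly] dim by auto

lemma len_pos: "len > 0"
proof -
  obtain v where "v \<in> vertices F" using vertices_nonempty by blast
  then obtain u where "dist u v = len" "u \<noteq> v" by (rule edges_at_vertex)
  then show ?thesis by (metis zero_less_dist_iff)
qed

text \<open>The two neighbours of a vertex \<open>v\<close> add up to a fixed multiple of \<open>v\<close>, relative to \<open>c\<close>; summing over
  \<open>v\<close>, the sum of all vertices is a multiple \<open>\<noteq> 1\<close> of itself.\<close>

lemma face_center_eq: "face_center F = c"
proof -
  define W where "W = (\<Sum>v\<in>vertices F. v - c)"
  obtain v0 where "v0 \<in> vertices F" using vertices_nonempty by blast
  then obtain u0 w0 where "u0 \<noteq> w0" "u0 \<in> vertices F" "w0 \<in> vertices F" "dist u0 v0 = len" "dist w0 v0 = len" "u0 \<noteq> v0"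
    by (rule edges_at_vertex)
  then have pos: "rad > 0" using neighbours_sum(1) \<open>v0 \<in> vertices F\<close> by blast
  \<comment> \<open>Each of the two edges at \<open>v\<close> contributes both end points:
    \<open>v\<close> counts twice, and the two neighbours add the multiple from
    \<open>neighbours_sum\<close>.\<close>
  have at: "(\<Sum>E\<in>{E \<in> edges F. v \<in> E}. \<Sum>x\<in>vertices E. x - c) = (4 - len\<^sup>2 / rad\<^sup>2) *\<^sub>R (v - c)" if v: "v \<in> vertices F" for v
  proof -
    obtain u w where uw: "u \<noteq> w" "u \<in> vertices F" "w \<in> vertices F" "dist u v = len" "dist w v = len" "u \<noteq> v" "w \<noteq> v"
      "{E \<in> edges F. v \<in> E} = {closed_segment v u, closed_segment v w}"
      by (rule edges_at_vertex[OF v])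
    have "closed_segment v u \<noteq> closed_segment v w" using uw(1) by (auto simp: closed_segment_eq doubleton_eq_iff)
    then have "(\<Sum>E\<in>{E \<in> edges F. v \<in> E}. \<Sum>x\<in>vertices E. x - c) = (v - c) + (u - c) + ((v - c) + (w - c))"
      unfolding uw(8) using uw(6,7) by (simp add: vertices_segment)
    also have "\<dots> = 2 *\<^sub>R (v - c) + ((u - c) + (w - c))" by (simp add: algebra_simps scaleR_2)
    also have "\<dots> = (4 - len\<^sup>2 / rad\<^sup>2) *\<^sub>R (v - c)"
      unfolding neighbours_sum(2)[OF uw(1-3) v uw(4-6)] by (simp add: scaleR_left_distrib[symmetric])
    finally show ?thesis .
  qed
  have "(4 - len\<^sup>2 / rad\<^sup>2) *\<^sub>R W = (\<Sum>v\<in>vertices F. \<Sum>E\<in>{E \<in> edges F. v \<in> E}. \<Sum>x\<in>vertices E. x - c)"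
    unfolding W_def scaleR_sum_right by (intro sum.cong refl at[symmetric])
  also have "\<dots> = (\<Sum>E\<in>edges F. \<Sum>v\<in>{v \<in> vertices F. v \<in> E}. \<Sum>x\<in>vertices E. x - c)"
    by (rule sum.swap_restrict) (use poly finite_edges finite_vertices in auto)
  also have "\<dots> = (\<Sum>E\<in>edges F. 2 *\<^sub>R (\<Sum>x\<in>vertices E. x - c))"
  proof (intro sum.cong refl)
    fix E assume E: "E \<in> edges F"
    obtain a b where ab: "a \<noteq> b" "vertices E = {a, b}" using edge_cases[OF E] by metis
    have "{v \<in> vertices F. v \<in> E} = vertices E"
      using vertices_face[of E F] E by (auto simp: edges_def)
    then have "card {v \<in> vertices F. v \<in> E} = 2" using ab by simp
    then show "(\<Sum>v\<in>{v \<in> vertices F. v \<in> E}. \<Sum>x\<in>vertices E. x - c) = 2 *\<^sub>R (\<Sum>x\<in>vertices E. x - c)"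
      by (simp only: sum_constant_scaleR of_nat_numeral)
  qed
  \<comment> \<open>One factor 2 is the number of vertices of an edge, the other the number of edges
    at a vertex. Comparison with the first expression leaves
    \<open>(len\<^sup>2 / rad\<^sup>2) *\<^sub>R W = 0\<close>.\<close>
  also have "\<dots> = 4 *\<^sub>R W"
    unfolding scaleR_sum_right[symmetric] sum_edges_vertices W_def by simp
  finally have "(len\<^sup>2 / rad\<^sup>2) *\<^sub>R W = 0" by (simp add: algebra_simps)
  then have "W = 0" using len_pos pos by simp
  then have "(\<Sum>v\<in>vertices F. v) = real (card (vertices F)) *\<^sub>R c"
    using sum_constant_scaleR[of c "vertices F"] by (simp add: W_def sum_subtractf del: sum_constant)
  moreover have "card (vertices F) \<noteq> 0" using vertices_nonempty finite_vertices[OF poly] by simp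
  ultimately show ?thesis by (simp add: face_center_def)
qed

lemma card_edges: "card (edges F) = card (vertices F)"
proof -
  have "(\<Sum>E\<in>edges F. \<Sum>v\<in>vertices E. 1::real) = 2 * card (edges F)"
  proof -
    have "(\<Sum>v\<in>vertices E. 1::real) = 2" if "E \<in> edges F" for E
      using edge_cases[OF that] by (metis card_2_iff of_nat_numeral real_of_card)
    then show ?thesis by simp
  qed
  then show ?thesis using sum_edges_vertices[of "\<lambda>_. 1::real"] by simp
qed

end

section \<open>Platonic bodies\<close>

text \<open>A translation after a linear injection: faces, dimension and relative interior are then
  transported by the facts on linear and translated images.\<close>

lemma isometry_image_decomp:
  fixes g :: "pt \<Rightarrow> pt"
  assumes "isometry g"
  shows "\<exists>L. linear L \<and> inj L \<and> (\<forall>S. g ` S = (\<lambda>x. g 0 + x) ` (L ` S))"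
proof -
  let ?L = "\<lambda>x. g x - g 0"
  have "linear ?L" by (rule isometry_imp_linear[OF assms])
  moreover have "inj ?L" using isometry_inj[OF assms] by (auto simp: inj_def)
  moreover have "g ` S = (\<lambda>x. g 0 + x) ` (?L ` S)" for S by (simp add: image_image)
  ultimately show ?thesis by blast
qed

lemma isometry_face_of_iff:
  fixes g :: "pt \<Rightarrow> pt"
  assumes "isometry g"
  shows "g ` E face_of g ` F \<longleftrightarrow> E face_of F"
proof -
  obtain L where L: "linear L" "inj L" "\<And>S. g ` S = (\<lambda>x. g 0 + x) ` (L ` S)"
    using isometry_image_decomp[OF assms] by blast
  show ?thesis unfolding L(3) using face_of_linear_image[OF L(1,2)] by simp
qed

lemma isometry_aff_dim:
  fixes g :: "pt \<Rightarrow> pt"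
  assumes "isometry g"
  shows "aff_dim (g ` E) = aff_dim E"
proof -
  obtain L where L: "linear L" "inj L" "\<And>S. g ` S = (\<lambda>x. g 0 + x) ` (L ` S)"
    using isometry_image_decomp[OF assms] by blast
  show ?thesis unfolding L(3) using L aff_dim_injective_linear_image aff_dim_translation_eq by metis
qed

lemma isometry_closed_segment:
  fixes g :: "pt \<Rightarrow> pt"
  assumes "isometry g"
  shows "g ` closed_segment a b = closed_segment (g a) (g b)"
proof -
  have "g ((1 - u) *\<^sub>R a + u *\<^sub>R b) = (1 - u) *\<^sub>R g a + u *\<^sub>R g b" for u
    using isometry_affine[OF assms, of "1 - u" u a b] by simp
  then show ?thesis by (simp add: closed_segment_image_interval image_image)
qed

lemma isometry_vertices:
  fixes g :: "pt \<Rightarrow> pt"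
  assumes "isometry g"
  shows "vertices (g ` F) = g ` vertices F"
proof (intro set_eqI iffI)
  fix v assume v: "v \<in> vertices (g ` F)"
  then obtain x where x: "x \<in> F" "v = g x" by (auto simp: vertices_def extreme_point_of_def)
  have "g ` {x} face_of g ` F" using v x by (simp add: vertices_def face_of_singleton)
  then have "{x} face_of F" using isometry_face_of_iff[OF assms] by blast
  then show "v \<in> g ` vertices F" using x by (simp add: vertices_def face_of_singleton)
next
  fix v assume "v \<in> g ` vertices F"
  then obtain x where x: "v = g x" "{x} face_of F" by (auto simp: vertices_def face_of_singleton)
  then have "g ` {x} face_of g ` F" using isometry_face_of_iff[OF assms] by blast
  then show "v \<in> vertices (g ` F)" using x by (simp add: vertices_def face_of_singleton)
qed

lemma isometry_edges:
  fixes g :: "pt \<Rightarrow> pt"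
  assumes "isometry g"
  shows "edges (g ` F) = (`) g ` edges F"
proof (intro set_eqI iffI)
  fix E assume E: "E \<in> edges (g ` F)"
  then have "E \<subseteq> g ` F" by (auto simp: edges_def dest: face_of_imp_subset)
  then obtain E' where E': "E = g ` E'" by (meson subset_imageE)
  then show "E \<in> (`) g ` edges F"
    using E isometry_face_of_iff[OF assms] isometry_aff_dim[OF assms] by (auto simp: edges_def)
next
  fix E assume "E \<in> (`) g ` edges F"
  then show "E \<in> edges (g ` F)"
    using isometry_face_of_iff[OF assms] isometry_aff_dim[OF assms] by (auto simp: edges_def)
qed

text \<open>The difference of the squared distances to \<open>c\<close> and \<open>c'\<close> is an
  affine function. It is constant on the vertices, hence on the affine hull, and comparing its
  values at \<open>c\<close> and \<open>c'\<close> gives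
  \<open>(c' - c) \<bullet> (c' - c) = 0\<close>.\<close>

lemma circumcenter_unique:
  fixes P :: "pt set"
  assumes P: "polytope P" and c: "c \<in> affine hull P" "\<And>v. v \<in> vertices P \<Longrightarrow> dist c v = r"
    and c': "c' \<in> affine hull P" "\<And>v. v \<in> vertices P \<Longrightarrow> dist c' v = r'"
  shows "c = c'"
proof -
  have "affine hull P \<subseteq> {x. (c' - c) \<bullet> x = (r\<^sup>2 - r'\<^sup>2 + c' \<bullet> c' - c \<bullet> c) / 2}"
    unfolding affine_hull_vertices[OF P, symmetric]
  proof (rule hull_minimal)
    show "vertices P \<subseteq> {x. (c' - c) \<bullet> x = (r\<^sup>2 - r'\<^sup>2 + c' \<bullet> c' - c \<bullet> c) / 2}"
    proof
      fix v assume "v \<in> vertices P"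
      then have "(c - v) \<bullet> (c - v) = r\<^sup>2" "(c' - v) \<bullet> (c' - v) = r'\<^sup>2"
        using c(2)[of v] c'(2)[of v] by (auto simp: dist_norm power2_norm_eq_inner)
      then show "v \<in> {x. (c' - c) \<bullet> x = (r\<^sup>2 - r'\<^sup>2 + c' \<bullet> c' - c \<bullet> c) / 2}"
        by (simp add: inner_diff_left inner_diff_right inner_commute)
    qed
  qed (rule affine_hyperplane)
  then have "(c' - c) \<bullet> x = (r\<^sup>2 - r'\<^sup>2 + c' \<bullet> c' - c \<bullet> c) / 2" if "x \<in> affine hull P" for x
    using that by blast
  then have "(c' - c) \<bullet> c' = (c' - c) \<bullet> c" using c(1) c'(1) by metis
  then have "(c' - c) \<bullet> (c' - c) = 0" by (simp only: inner_diff_right)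
  then show ?thesis by simp
qed

text \<open>The isometry carries the circumcentre to the circumcentre, so congruence of the faces
  becomes equality of circumradius, side and number of edges.\<close>

lemma congruent_inscribed_polygons:
  assumes F: "inscribed_polygon F c r l" and G: "inscribed_polygon G c' r' l'"
    and g: "isometry g" "g ` F = G"
  shows "r' = r" "l' = l" "card (edges G) = card (edges F)"
proof -
  interpret F: inscribed_polygon F c r l by fact
  interpret G: inscribed_polygon G c' r' l' by fact
  have V: "vertices G = g ` vertices F" using isometry_vertices[OF g(1), of F] g(2) by simp
  have E: "edges G = (`) g ` edges F" using isometry_edges[OF g(1), of F] g(2) by simp
  have dist: "dist (g x) (g y) = dist x y" for x y using g(1) by (simp add: isometry_def)
  \<comment> \<open>The relative interior is transported by \<open>g\<close>; this shows that
    \<open>g c\<close> lies in the plane of \<open>G\<close>, as uniqueness of the circumcentre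
    requires.\<close>
  have "g c \<in> rel_interior G"
  proof -
    obtain L where L: "linear L" "inj L" "\<And>S. g ` S = (\<lambda>x. g 0 + x) ` (L ` S)"
      using isometry_image_decomp[OF g(1)] by blast
    have "rel_interior (g ` F) = g ` rel_interior F"
      unfolding L(3) using L rel_interior_injective_linear_image[of L F]
      by (simp add: linear_conv_bounded_linear rel_interior_translation)
    then show ?thesis using F.center_in_rel_interior g(2) by blast
  qed
  then have gc: "g c \<in> affine hull G" by (meson rel_interior_subset hull_subset subsetD)
  have gr: "dist (g c) v = r" if "v \<in> vertices G" for v
    using that F.radius by (auto simp: V dist)
  have "c' = g c" using circumcenter_unique[OF G.poly G.center G.radius gc gr] by simp
  moreover obtain v where "v \<in> vertices G" using G.vertices_nonempty by blast
  ultimately show "r' = r" using gr G.radius by metis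
  have inj: "inj g" using isometry_inj[OF g(1)] by (auto simp: inj_def)
  then have "inj_on ((`) g) (edges F)" by (simp add: inj_on_def inj_image_eq_iff)
  then show "card (edges G) = card (edges F)" unfolding E by (rule card_image)
  obtain v where v: "v \<in> vertices F" using F.vertices_nonempty by blast
  have "card {E \<in> edges F. v \<in> E} \<noteq> 0" using F.card_edges_at_vertex[OF v] by simp
  then obtain E0 where E0: "E0 \<in> edges F" by (metis (no_types, lifting) card.empty empty_Collect_eq)
  obtain a b where ab: "E0 = closed_segment a b" "dist a b = l" using F.edge_cases[OF E0] by metis
  have "diameter (g ` E0) = l'" using E0 by (intro G.side) (simp add: E)
  then show "l' = l" using ab dist by (simp add: isometry_closed_segment[OF g(1)] diameter_segment)
qed

text \<open>The data common to all faces and vertices: \<open>h\<close>, \<open>rad\<close> and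
  \<open>len\<close> fix the volume of the tetrahedra, while \<open>n\<close> and \<open>k\<close>
  serve the double counts that turn sums over tetrahedra into averages.\<close>

locale inscribed_platonic =
  fixes B :: "pt set" and Z :: pt and rad len h :: real and n k :: nat
  assumes polyB: "polytope B" and dimB: "aff_dim B = 3"
    and polygon: "\<And>F. F \<in> facets B \<Longrightarrow> inscribed_polygon F (face_center F) rad len"
    and card_edges: "\<And>F. F \<in> facets B \<Longrightarrow> card (edges F) = n"
    and height: "\<And>F. F \<in> facets B \<Longrightarrow> dist Z (face_center F) = h"
    and perp: "\<And>F x. F \<in> facets B \<Longrightarrow> x \<in> affine hull F \<Longrightarrow> (Z - face_center F) \<bullet> (x - face_center F) = 0"
    and degree: "\<And>v. v \<in> vertices B \<Longrightarrow> card {F \<in> facets B. v \<in> F} = k"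

text \<open>By Pythagoras the foot of the perpendicular from \<open>Z\<close> to a face plane is
  equidistant from the vertices of the face, so the face is an \<open>inscribed_polygon\<close>
  about it, and \<open>face_center_eq\<close> identifies the foot. Congruence equalises the radii
  \<open>r\<close>, hence the heights \<open>sqrt (R\<^sup>2 - r\<^sup>2)\<close>.\<close>

lemma platonic_imp_inscribed_platonic:
  assumes B: "platonic B" and R: "\<And>v. v \<in> vertices B \<Longrightarrow> dist Z v = R"
  obtains r l h n k where "inscribed_platonic B Z r l h n k"
proof -
  have poly: "polytope B" and dim: "aff_dim B = 3" and reg: "\<And>F. F \<in> facets B \<Longrightarrow> regular_polygon F"
    and cong: "\<And>F G. F \<in> facets B \<Longrightarrow> G \<in> facets B \<Longrightarrow> \<exists>g::pt \<Rightarrow> pt. isometry g \<and> g ` F = G"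
    and deg: "\<And>v w. v \<in> vertices B \<Longrightarrow> w \<in> vertices B \<Longrightarrow> card {F\<in>facets B. v \<in> F} = card {F\<in>facets B. w \<in> F}"
    using B unfolding platonic_def by blast+
  have ex: "\<exists>r l. inscribed_polygon F (face_center F) r l \<and>
      (\<forall>x\<in>affine hull F. (Z - face_center F) \<bullet> (x - face_center F) = 0) \<and> (dist Z (face_center F))\<^sup>2 = R\<^sup>2 - r\<^sup>2"
    if F: "F \<in> facets B" for F
  proof -
    have pF: "polytope F" and dF: "aff_dim F = 2" and eq: "\<And>E1 E2. E1 \<in> edges F \<Longrightarrow> E2 \<in> edges F \<Longrightarrow> diameter E1 = diameter E2"
      using reg[OF F] unfolding regular_polygon_def by blast+
    have FB: "F face_of B" using F by (simp add: facets_def)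
    have neF: "affine hull F \<noteq> {}" using dF by auto
    obtain c where c: "c \<in> affine hull F" "\<And>x. x \<in> affine hull F \<Longrightarrow> (Z - c) \<bullet> (x - c) = 0"
      using orthogonal_foot_exists[OF affine_affine_hull neF] by blast
    define r where "r = sqrt (R\<^sup>2 - (dist Z c)\<^sup>2)"
    have sq: "(dist c v)\<^sup>2 = R\<^sup>2 - (dist Z c)\<^sup>2" if v: "v \<in> vertices F" for v
    proof -
      have "v \<in> vertices B" "v \<in> F" using v vertices_face[OF FB] by auto
      then have "dist Z v = R" "(Z - c) \<bullet> (v - c) = 0" using R c by (auto simp: hull_inc)
      moreover have "(dist Z v)\<^sup>2 = (dist Z c)\<^sup>2 + (dist c v)\<^sup>2 - 2 * ((Z - c) \<bullet> (v - c))"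
        by (simp add: dist_norm power2_norm_eq_inner inner_diff_left inner_diff_right inner_commute)
      ultimately show ?thesis by simp
    qed
    have "dist c v = r" if "v \<in> vertices F" for v
      using sq[OF that] unfolding r_def by (metis real_sqrt_unique zero_le_dist)
    moreover obtain l where "\<And>E. E \<in> edges F \<Longrightarrow> diameter E = l" using eq by metis
    ultimately have ip: "inscribed_polygon F c r l"
      using pF dF c by unfold_locales auto
    then interpret ip: inscribed_polygon F c r l .
    have fc: "face_center F = c" by (rule ip.face_center_eq)
    obtain v where v: "v \<in> vertices F" using ip.vertices_nonempty by blast
    have "(dist Z c)\<^sup>2 = R\<^sup>2 - r\<^sup>2" using sq[OF v] ip.radius[OF v] by simp
    then show ?thesis using ip c fc by auto
  qed
  obtain F0 where "F0 facet_of B" using polytope_facet_exists[OF poly] dim by auto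
  then have F0: "F0 \<in> facets B" by (simp add: facets_def facet_of_def)
  obtain r l where rl: "inscribed_polygon F0 (face_center F0) r l" using ex[OF F0] by blast
  obtain v0 where v0F: "v0 \<in> vertices F0" using inscribed_polygon.vertices_nonempty[OF rl] by blast
  have all: "inscribed_polygon F (face_center F) r l \<and> card (edges F) = card (edges F0) \<and>
     (\<forall>x\<in>affine hull F. (Z - face_center F) \<bullet> (x - face_center F) = 0) \<and> dist Z (face_center F) = sqrt (R\<^sup>2 - r\<^sup>2)"
    if F: "F \<in> facets B" for F
  proof -
    obtain r' l' where rl': "inscribed_polygon F (face_center F) r' l'"
      "\<forall>x\<in>affine hull F. (Z - face_center F) \<bullet> (x - face_center F) = 0" "(dist Z (face_center F))\<^sup>2 = R\<^sup>2 - r'\<^sup>2"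
      using ex[OF F] by blast
    obtain g :: "pt \<Rightarrow> pt" where g: "isometry g" "g ` F0 = F" using cong[OF F0 F] by blast
    note cg = congruent_inscribed_polygons[OF rl rl'(1) g]
    have "dist Z (face_center F) = sqrt (R\<^sup>2 - r\<^sup>2)" using rl'(3) cg(1) by (metis real_sqrt_unique zero_le_dist)
    then show ?thesis using rl' cg by simp
  qed
  have v0: "v0 \<in> vertices B" using v0F vertices_face[of F0 B] F0 by (auto simp: facets_def)
  have "inscribed_platonic B Z r l (sqrt (R\<^sup>2 - r\<^sup>2)) (card (edges F0)) (card {F \<in> facets B. v0 \<in> F})"
    by (rule inscribed_platonic.intro) (use all poly dim deg[OF _ v0] in blast)+
  then show ?thesis using that by blast
qed

section \<open>Dissection into pyramids and tetrahedra\<close>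

context inscribed_platonic
begin

lemma facet_of_iff: "F \<in> facets B \<longleftrightarrow> F facet_of B"
  using facets_eq[of B] dimB by auto

lemma convB: "convex B" and polyhedronB: "polyhedron B"
  using polyB polytope_imp_convex polytope_imp_polyhedron by auto

lemma facet_polytope: "F \<in> facets B \<Longrightarrow> polytope F" and facet_dim: "F \<in> facets B \<Longrightarrow> aff_dim F = 2"
  using inscribed_polygon.poly[OF polygon] inscribed_polygon.dim[OF polygon] by auto

lemma face_center_rel_interior: "F \<in> facets B \<Longrightarrow> face_center F \<in> rel_interior F"
  using inscribed_polygon.center_in_rel_interior[OF polygon] .

lemma face_center_mem: "F \<in> facets B \<Longrightarrow> face_center F \<in> F"
  using face_center_rel_interior rel_interior_subset by blast

text \<open>The criterion used for polygons, one dimension up: the feet are the face centres, all at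
  distance \<open>h\<close>.\<close>

lemma Z_rel_interior: "Z \<in> rel_interior B"
proof (rule equidistant_feet_imp_rel_interior[OF polyB])
  have "affine hull B = UNIV" using dimB aff_dim_eq_full[of B] by simp
  then show "Z \<in> affine hull B" by simp
  show "face_center F \<in> rel_interior F" "dist Z (face_center F) = h" if "F facet_of B" for F
    using that face_center_rel_interior height by (auto simp: facet_of_iff)
  show "(Z - face_center F) \<bullet> (x - face_center F) = 0" if "F facet_of B" "x \<in> F" for F x
    using that perp[of F x] by (simp add: facet_of_iff hull_inc)
qed (simp add: dimB)

lemma facet_rel_frontier: "F \<in> facets B \<Longrightarrow> F \<subseteq> rel_frontier B"
  using rel_frontier_of_polyhedron[OF polyhedronB] by (auto simp: facet_of_iff)

lemma Z_notin_facet: "F \<in> facets B \<Longrightarrow> Z \<notin> F"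
  using facet_rel_frontier Z_rel_interior by (auto simp: rel_frontier_def)

lemma h_pos: "h > 0"
proof -
  obtain F where "F facet_of B" using polytope_facet_exists[OF polyB] dimB by auto
  then have F: "F \<in> facets B" by (simp add: facet_of_iff)
  then have "Z \<noteq> face_center F" using Z_notin_facet face_center_mem by blast
  then show ?thesis using height[OF F] by (metis zero_less_dist_iff)
qed

lemma B_eq_Union_cones: "B = (\<Union>F\<in>facets B. convex hull (insert Z F))"
  using polytope_eq_Union_cones[OF polyB _ Z_rel_interior] dimB facets_eq[of B] by simp

text \<open>Cones from an interior point over two facets meet exactly in the cone over
  \<open>F \<inter> G\<close>, which has dimension at most 2.\<close>

lemma cones_overlap_negligible:
  assumes "F \<in> facets B" "G \<in> facets B" "F \<noteq> G"
  shows "negligible (convex hull (insert Z F) \<inter> convex hull (insert Z G))"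
proof -
  have "convex hull (insert Z F) \<inter> convex hull (insert Z G) = convex hull (insert Z (F \<inter> G))"
    using assms facet_rel_frontier facet_polytope polytope_imp_convex
    by (intro convex_hull_insert_Int_eq[OF Z_rel_interior _ _ convB]) auto
  moreover have "aff_dim (F \<inter> G) \<le> 1"
    using aff_dim_Int_facets_less[OF polyhedronB, of F G] assms dimB by (simp add: facet_of_iff)
  then have "aff_dim (insert Z (F \<inter> G)) < 3" using aff_dim_insert_le[of Z "F \<inter> G"] by simp
  ultimately show ?thesis using negligible_aff_dim_lt[of "insert Z (F \<inter> G)"] by simp
qed

text \<open>Nested as a cone from \<open>Z\<close> over a triangle in the face, so that the formula
  for intersecting cones applies first at \<open>Z\<close> and then at
  \<open>face_center F\<close>.\<close>

definition tetra :: "pt set \<Rightarrow> pt set \<Rightarrow> pt set" where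
  "tetra F E = convex hull (insert Z (convex hull (insert (face_center F) E)))"

lemma edge_facet_of: "F \<in> facets B \<Longrightarrow> E \<in> edges F \<longleftrightarrow> E facet_of F"
  using edges_eq_facets[of F] facets_eq[of F] facet_dim[of F] by auto

lemma tetra_subset_cone:
  assumes F: "F \<in> facets B" and E: "E \<in> edges F"
  shows "tetra F E \<subseteq> convex hull (insert Z F)" "convex hull (insert (face_center F) E) \<subseteq> F"
proof -
  show sub: "convex hull (insert (face_center F) E) \<subseteq> F"
    using face_center_mem[OF F] E facet_polytope[OF F] polytope_imp_convex
    by (intro hull_minimal) (auto simp: edges_def dest: face_of_imp_subset)
  then show "tetra F E \<subseteq> convex hull (insert Z F)"
    unfolding tetra_def by (intro hull_mono) auto
qed

lemma cone_eq_Union_tetra: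
  assumes F: "F \<in> facets B"
  shows "convex hull (insert Z F) = (\<Union>E\<in>edges F. tetra F E)"
proof
  show "(\<Union>E\<in>edges F. tetra F E) \<subseteq> convex hull (insert Z F)"
    using tetra_subset_cone(1)[OF F] by blast
  show "convex hull (insert Z F) \<subseteq> (\<Union>E\<in>edges F. tetra F E)"
  proof
    fix x assume "x \<in> convex hull (insert Z F)"
    moreover have "F \<noteq> {}" "convex hull F = F"
      using face_center_mem[OF F] facet_polytope[OF F] polytope_imp_convex convex_hull_eq by blast+
    ultimately obtain u v p where uv: "0 \<le> u" "0 \<le> v" "u + v = 1" "p \<in> F" "x = u *\<^sub>R Z + v *\<^sub>R p"
      using convex_hull_insert[of F Z] by auto
    have "p \<in> (\<Union>E\<in>{E. E facet_of F}. convex hull (insert (face_center F) E))"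
      using polytope_eq_Union_cones[OF facet_polytope[OF F] _ face_center_rel_interior[OF F]] facet_dim[OF F] uv(4) by simp
    then obtain E where E: "E \<in> edges F" "p \<in> convex hull (insert (face_center F) E)"
      using edge_facet_of[OF F] by auto
    have "x \<in> tetra F E"
      unfolding uv(5) tetra_def using uv E(2)
      by (intro convexD[OF convex_convex_hull]) (auto intro: hull_inc)
    then show "x \<in> (\<Union>E\<in>edges F. tetra F E)" using E by blast
  qed
qed

lemma tetra_overlap_negligible:
  assumes F: "F \<in> facets B" and E: "E \<in> edges F" "E' \<in> edges F" "E \<noteq> E'"
  shows "negligible (tetra F E \<inter> tetra F E')"
proof -
  let ?c = "face_center F"
  have cF: "convex F" "polyhedron F" using facet_polytope[OF F] polytope_imp_convex polytope_imp_polyhedron by auto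
  have "tetra F E \<inter> tetra F E' = convex hull (insert Z (convex hull (insert ?c E) \<inter> convex hull (insert ?c E')))"
    unfolding tetra_def using tetra_subset_cone(2)[OF F] E facet_rel_frontier[OF F]
    by (intro convex_hull_insert_Int_eq[OF Z_rel_interior _ _ convB]) auto
  also have "convex hull (insert ?c E) \<inter> convex hull (insert ?c E') = convex hull (insert ?c (E \<inter> E'))"
    using E edge_facet_of[OF F] rel_frontier_of_polyhedron[OF cF(2)]
    by (intro convex_hull_insert_Int_eq[OF face_center_rel_interior[OF F] _ _ cF(1)])
       (auto simp: edges_def dest: face_of_imp_convex)
  finally have "tetra F E \<inter> tetra F E' = convex hull (insert Z (insert ?c (E \<inter> E')))"
    by (metis hull_insert)
  moreover have "aff_dim (E \<inter> E') \<le> 0"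
    using aff_dim_Int_facets_less[OF cF(2), of E E'] E facet_dim[OF F] by (simp add: edge_facet_of[OF F])
  then have "aff_dim (insert Z (insert ?c (E \<inter> E'))) < 3"
    using aff_dim_insert_le[of Z "insert ?c (E \<inter> E')"] aff_dim_insert_le[of ?c "E \<inter> E'"] by simp
  ultimately show ?thesis using negligible_aff_dim_lt[of "insert Z (insert ?c (E \<inter> E'))"] by simp
qed

text \<open>Six times the common volume of the tetrahedra.\<close>

definition d :: real where "d = h * len * sqrt (rad\<^sup>2 - len\<^sup>2 / 4)"

lemma edge_endpoints:
  assumes F: "F \<in> facets B" and E: "E \<in> edges F"
  obtains a b where "E = closed_segment a b" "a \<noteq> b" "vertices E = {a, b}" "dist a b = len"
    "a \<in> vertices F" "b \<in> vertices F"
  using inscribed_polygon.edge_cases[OF polygon[OF F] E] that by metis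

text \<open>The two determinants belong to two pairings of opposite edges, \<open>[Z, c]\<close>
  with \<open>[a, b]\<close> and \<open>[Z, a]\<close> with \<open>[c, b]\<close>. They differ by a
  sign, and the Gram determinant evaluates them as height times side times apothem.\<close>

lemma tetra_det:
  assumes F: "F \<in> facets B" and E: "E \<in> edges F" "E = closed_segment a b" "a \<noteq> b"
  shows "\<bar>det (matrix (columns3 (face_center F - Z) (b - a) (a - Z)))\<bar> = d" (is ?t1)
    and "\<bar>det (matrix (columns3 (a - Z) (b - face_center F) (face_center F - Z)))\<bar> = d" (is ?t2)
    and "d > 0" (is ?t3) and "tetra F E = convex hull {Z, face_center F, a, b}" (is ?t4)
proof -
  interpret F: inscribed_polygon F "face_center F" rad len by (rule polygon[OF F])
  let ?c = "face_center F"
  have vE: "vertices E = {a, b}" using E by (simp add: vertices_segment)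
  have EF: "E face_of F" using E by (simp add: edges_def)
  have V: "a \<in> vertices F" "b \<in> vertices F" "a \<in> F" "b \<in> F" using vertices_face[OF EF] vE E face_of_imp_subset[OF EF] by auto
  have rd: "dist ?c a = rad" "dist ?c b = rad" "dist a b = len"
    using F.radius V F.side[OF E(1)] E by (auto simp: diameter_segment)
  define A C D where "A = ?c - Z" and "C = a - ?c" and "D = b - ?c"
  have sq: "A \<bullet> A = h\<^sup>2" "C \<bullet> C = rad\<^sup>2" "D \<bullet> D = rad\<^sup>2" "(C - D) \<bullet> (C - D) = len\<^sup>2"
    using height[OF F] rd by (simp_all add: A_def C_def D_def dist_norm norm_minus_commute power2_norm_eq_inner[symmetric])
  have o: "A \<bullet> C = 0" "A \<bullet> D = 0"
    using perp[OF F, of a] perp[OF F, of b] V by (simp_all add: A_def C_def D_def hull_inc inner_diff_left)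
  have CD: "C \<bullet> D = rad\<^sup>2 - len\<^sup>2 / 2" using sq by (simp add: inner_diff_left inner_diff_right inner_commute)
  have e: "?c - Z = A" "b - a = D - C" "a - Z = A + C" by (simp_all add: A_def C_def D_def)
  have det_sq: "(det (matrix (columns3 (?c - Z) (b - a) (a - Z))))\<^sup>2 = h\<^sup>2 * len\<^sup>2 * (rad\<^sup>2 - len\<^sup>2 / 4)"
    unfolding e det_columns3_sq
    by (simp add: inner_diff_left inner_diff_right inner_add_left inner_add_right inner_commute sq o CD)
       (simp add: algebra_simps power2_eq_square power4_eq_xxxx)
  \<comment> \<open>The apothem of the face; it is positive because the centre is in the relative
    interior and so on no edge.\<close>
  have mid: "(dist ?c (midpoint a b))\<^sup>2 = rad\<^sup>2 - len\<^sup>2 / 4"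
    using F.center_orthogonal_midpoint(2)[OF rd] by (metis ends_in_segment(1))
  have "midpoint a b \<in> E" using E by simp
  moreover have "?c \<notin> E" using face_center_rel_interior[OF F] rel_interior_of_polyhedron[of F] E(1) F.poly
      polytope_imp_polyhedron edge_facet_of[OF F] by blast
  ultimately have "?c \<noteq> midpoint a b" by metis
  then have pos: "rad\<^sup>2 - len\<^sup>2 / 4 > 0" unfolding mid[symmetric] by simp
  show ?t3 unfolding d_def using h_pos F.len_pos pos by simp
  have d2: "d\<^sup>2 = h\<^sup>2 * len\<^sup>2 * (rad\<^sup>2 - len\<^sup>2 / 4)" unfolding d_def using pos by (simp add: power_mult_distrib)
  show t1: ?t1
    using det_sq d2 \<open>?t3\<close> by (metis abs_of_pos power2_eq_iff abs_minus_cancel)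
  have "det (matrix (columns3 (a - Z) (b - ?c) (?c - Z))) = - det (matrix (columns3 (?c - Z) (b - a) (a - Z)))"
    by (simp add: det_3 matrix_def columns3_def axis_def algebra_simps)
  then show ?t2 using t1 by simp
  have "tetra F E = convex hull (insert Z (insert ?c E))" unfolding tetra_def by (metis hull_insert)
  also have "\<dots> = convex hull (insert Z (insert ?c {a, b}))"
    unfolding E(2) segment_convex_hull by (metis hull_insert)
  finally show ?t4 .
qed

end

section \<open>Plane charts, families of equal segments, and homothetic images\<close>

lemma plane_chart_range:
  fixes \<phi> :: "real^2 \<Rightarrow> pt"
  assumes iso: "isometry \<phi>" and F: "F \<subseteq> range \<phi>" "aff_dim F = 2"
  shows "range \<phi> = affine hull F"
proof -
  let ?L = "\<lambda>x. \<phi> x - \<phi> 0"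
  have lin: "linear ?L" by (rule isometry_imp_linear[OF iso])
  have inj: "inj ?L" using isometry_inj[OF iso] by (auto simp: inj_def)
  have r: "range \<phi> = (\<lambda>x. \<phi> 0 + x) ` range ?L" by (simp add: image_image)
  have "aff_dim (range ?L) = aff_dim (UNIV :: (real^2) set)"
    by (rule aff_dim_injective_linear_image[OF lin inj])
  then have dim: "aff_dim (range \<phi>) = 2" unfolding r aff_dim_translation_eq by simp
  have "subspace (range ?L)" using linear_subspace_image[OF lin subspace_UNIV] .
  then have aff: "affine (range \<phi>)" unfolding r by (metis affine_translation subspace_imp_affine)
  then have "affine hull F \<subseteq> range \<phi>" using F by (simp add: hull_minimal)
  moreover have "F \<noteq> {}" using F by auto
  ultimately show ?thesis
    using affine_dim_equal[of "affine hull F" "range \<phi>"] aff dim F by simp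
qed

text \<open>For segments of one common length the length-weighted average is the plain mean of the
  values of \<open>segment_mean\<close>. Injectivity enters because \<open>avg_segs\<close> sums
  over a set, where coinciding segments would count once.\<close>

lemma avg_segs_image:
  fixes P Q :: "'a \<Rightarrow> pt"
  assumes fin: "finite X" and inj: "inj_on (\<lambda>x. closed_segment (P x) (Q x)) X"
    and ne: "\<And>x. x \<in> X \<Longrightarrow> P x \<noteq> Q x" and dst: "\<And>x. x \<in> X \<Longrightarrow> dist (P x) (Q x) = l"
    and int: "\<And>x. x \<in> X \<Longrightarrow> (\<lambda>u. f ((1 - u) *\<^sub>R P x + u *\<^sub>R Q x)) integrable_on {0..1}"
  shows "avg_segs f ((\<lambda>x. closed_segment (P x) (Q x)) ` X) = (\<Sum>x\<in>X. segment_mean f (P x) (Q x)) / card X"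
proof (cases "X = {}")
  case False
  then obtain x where "x \<in> X" by blast
  then have l: "l \<noteq> 0" using ne[of x] dst[of x] by auto
  have "(\<Sum>S\<in>(\<lambda>x. closed_segment (P x) (Q x)) ` X. line_integral S f) = (\<Sum>x\<in>X. l * segment_mean f (P x) (Q x))"
    unfolding sum.reindex[OF inj] o_def
    by (intro sum.cong refl) (simp add: line_integral_segment[OF ne int] dst)
  moreover have "(\<Sum>S\<in>(\<lambda>x. closed_segment (P x) (Q x)) ` X. line_length S) = card X * l"
    unfolding sum.reindex[OF inj] o_def by (simp add: line_length_segment[OF ne] dst)
  ultimately show ?thesis
    unfolding avg_segs_def using l by (simp add: sum_distrib_left[symmetric])
qed (simp add: avg_segs_def)

lemma homothety_decomp:
  assumes "c \<noteq> 0"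
  shows "homothety Z c ` S = (\<lambda>x. (Z - c *\<^sub>R Z) + x) ` ((*\<^sub>R) c ` S)"
    and "linear ((*\<^sub>R) c :: pt \<Rightarrow> pt)" "inj ((*\<^sub>R) c :: pt \<Rightarrow> pt)"
  using assms by (auto simp: image_image homothety_def algebra_simps linear_scaleR inj_def)

lemma homothety_face_of_iff:
  assumes "c \<noteq> 0"
  shows "homothety Z c ` E face_of homothety Z c ` F \<longleftrightarrow> E face_of F"
  unfolding homothety_decomp(1)[OF assms] face_of_translation_eq
  by (rule face_of_linear_image[OF homothety_decomp(2,3)[OF assms]])

lemma homothety_aff_dim:
  assumes "c \<noteq> 0"
  shows "aff_dim (homothety Z c ` E) = aff_dim E"
  unfolding homothety_decomp(1)[OF assms] aff_dim_translation_eq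
  by (rule aff_dim_injective_linear_image[OF homothety_decomp(2,3)[OF assms]])

lemma homothety_inj: "c \<noteq> 0 \<Longrightarrow> inj (homothety Z c)"
  by (auto simp: inj_def homothety_def)

lemma facets_homothety:
  assumes "c \<noteq> 0"
  shows "facets (homothety Z c ` P) = (`) (homothety Z c) ` facets P"
proof (intro set_eqI iffI)
  fix F assume F: "F \<in> facets (homothety Z c ` P)"
  then have "F \<subseteq> homothety Z c ` P" by (auto simp: facets_def dest: face_of_imp_subset)
  then obtain F' where F': "F = homothety Z c ` F'" by (meson subset_imageE)
  then show "F \<in> (`) (homothety Z c) ` facets P"
    using F homothety_face_of_iff[OF assms] homothety_aff_dim[OF assms] by (auto simp: facets_def)
next
  fix F assume "F \<in> (`) (homothety Z c) ` facets P"
  then show "F \<in> facets (homothety Z c ` P)"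
    using homothety_face_of_iff[OF assms] homothety_aff_dim[OF assms] by (auto simp: facets_def)
qed

section \<open>Decomposition of the integral and of the volume\<close>

locale platonic_convex = inscribed_platonic +
  fixes f :: "pt \<Rightarrow> real"
  assumes convex_f: "\<And>F. F \<in> facets B \<Longrightarrow> convex_on (convex hull (insert Z F)) f"
begin

lemma cone_polytope:
  assumes "F \<in> facets B"
  shows "polytope (convex hull (insert Z F))"
proof -
  obtain V where V: "finite V" "F = convex hull V" using facet_polytope[OF assms] by (auto simp: polytope_def)
  have "convex hull (insert Z F) = convex hull (insert Z V)" unfolding V(2) by (metis hull_insert)
  then show ?thesis using V by (simp add: polytope_convex_hull)
qed

lemma f_bounded_above:
  assumes "F \<in> facets B"
  obtains b where "\<And>x. x \<in> convex hull (insert Z F) \<Longrightarrow> f x \<le> b"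
  using polytope_convex_on_bounded_above[OF cone_polytope[OF assms] convex_f[OF assms]] that by blast

lemma f_integrable_on:
  assumes F: "F \<in> facets B" and K: "K \<subseteq> convex hull (insert Z F)" "convex K"
  shows "f integrable_on K"
proof -
  obtain b where b: "\<And>x. x \<in> convex hull (insert Z F) \<Longrightarrow> f x \<le> b" using f_bounded_above[OF F] by blast
  have "bounded K" using bounded_subset[OF polytope_imp_bounded[OF cone_polytope[OF F]] K(1)] .
  then show ?thesis
    using convex_on_has_integral[of K f b] convex_on_subset[OF convex_f[OF F] K] b K by (auto simp: integrable_on_def)
qed

lemma segment_integrable:
  assumes F: "F \<in> facets B" and pq: "p \<in> convex hull (insert Z F)" "q \<in> convex hull (insert Z F)"
  shows "(\<lambda>u. f ((1 - u) *\<^sub>R p + u *\<^sub>R q)) integrable_on {0..1}"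
proof -
  obtain b where b: "\<And>x. x \<in> convex hull (insert Z F) \<Longrightarrow> f x \<le> b" using f_bounded_above[OF F] by blast
  have "f ((1 - u) *\<^sub>R p + u *\<^sub>R q) \<le> b" if "u \<in> {0..1}" for u
    using that pq by (intro b convexD_alt[OF convex_convex_hull]) auto
  then show ?thesis
    using convex_on_has_integral[OF _ segment_convex_on[OF convex_f[OF F] pq], of b] by (auto simp: integrable_on_def)
qed

lemma integral_B: "integral B f = (\<Sum>F\<in>facets B. integral (convex hull (insert Z F)) f)"
proof -
  have "(f has_integral (\<Sum>F\<in>facets B. integral (convex hull (insert Z F)) f)) (\<Union>F\<in>facets B. convex hull (insert Z F))"
    using cones_overlap_negligible f_integrable_on
    by (intro has_integral_UN finite_facets polyB integrable_integral) (auto simp: pairwise_def)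
  then show ?thesis using B_eq_Union_cones integral_unique by metis
qed

lemma integral_cone:
  assumes F: "F \<in> facets B"
  shows "integral (convex hull (insert Z F)) f = (\<Sum>E\<in>edges F. integral (tetra F E) f)"
proof -
  have "convex (tetra F E)" for E by (simp add: tetra_def)
  then have "(f has_integral (\<Sum>E\<in>edges F. integral (tetra F E) f)) (\<Union>E\<in>edges F. tetra F E)"
    using tetra_overlap_negligible[OF F] f_integrable_on[OF F] tetra_subset_cone(1)[OF F]
    by (intro has_integral_UN finite_edges facet_polytope[OF F] integrable_integral) (auto simp: pairwise_def)
  then show ?thesis using cone_eq_Union_tetra[OF F] integral_unique by metis
qed

end

text \<open>The constant 1 is convex, so interpreting \<open>platonic_convex\<close> with it turns
  the decompositions of the integral into decompositions of the volume.\<close>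

lemma (in inscribed_platonic) measure_eq_sums:
  shows measure_B: "measure lebesgue B = (\<Sum>F\<in>facets B. measure lebesgue (convex hull (insert Z F)))"
    and measure_B_tetra: "measure lebesgue B = (\<Sum>F\<in>facets B. \<Sum>E\<in>edges F. measure lebesgue (tetra F E))"
proof -
  have one: "convex_on S (\<lambda>_. 1)" if "convex S" for S :: "pt set" using that by (simp add: convex_on_def flip: distrib_right)
  interpret one: platonic_convex B Z rad len h n k "\<lambda>_. 1"
    by unfold_locales (simp add: one)
  have cT: "compact (tetra F E)" if "F \<in> facets B" "E \<in> edges F" for F E
  proof -
    have "polytope E" using that facet_polytope face_of_polytope_polytope[of F E] by (auto simp: edges_def)
    then show ?thesis
      unfolding tetra_def by (intro compact_convex_hull compact_insert polytope_imp_compact)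
  qed
  have cB: "compact B" using polyB polytope_imp_compact by blast
  have cC: "compact (convex hull (insert Z F))" if "F \<in> facets B" for F
    using that facet_polytope by (intro compact_convex_hull compact_insert polytope_imp_compact)
  show 1: "measure lebesgue B = (\<Sum>F\<in>facets B. measure lebesgue (convex hull (insert Z F)))"
    using one.integral_B cB cC by (simp add: lmeasure_integral lmeasurable_compact)
  have "measure lebesgue (convex hull (insert Z F)) = (\<Sum>E\<in>edges F. measure lebesgue (tetra F E))" if F: "F \<in> facets B" for F
    using one.integral_cone[OF F] cC[OF F] cT[OF F] by (simp add: lmeasure_integral lmeasurable_compact)
  then show "measure lebesgue B = (\<Sum>F\<in>facets B. \<Sum>E\<in>edges F. measure lebesgue (tetra F E))"
    unfolding 1 by simp
qed

lemma (in inscribed_platonic) facets_nonempty: "facets B \<noteq> {}"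
  using polytope_facet_exists[OF polyB] dimB facet_of_iff by (metis empty_iff zero_less_numeral)

lemma (in inscribed_platonic) edges_nonempty: "F \<in> facets B \<Longrightarrow> edges F \<noteq> {}"
  using polytope_facet_exists[OF facet_polytope] facet_dim edge_facet_of by (metis empty_iff zero_less_numeral)

lemma (in inscribed_platonic) measure_B_eq: "measure lebesgue B = card (facets B) * n * d / 6"
    and d_pos: "d > 0" and n_pos: "n > 0"
proof -
  have t: "measure lebesgue (tetra F E) = d / 6" if FE: "F \<in> facets B" "E \<in> edges F" for F E
  proof -
    obtain a b where ab: "E = closed_segment a b" "a \<noteq> b" by (rule edge_endpoints[OF FE])
    note td = tetra_det[OF FE ab]
    show ?thesis using measure_tetrahedron[of "face_center F" Z b a] td by simp
  qed
  have "measure lebesgue B = (\<Sum>F\<in>facets B. \<Sum>E\<in>edges F. d / 6)"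
    unfolding measure_B_tetra by (intro sum.cong refl t)
  also have "\<dots> = (\<Sum>F\<in>facets B. n * (d / 6))" by (intro sum.cong refl) (simp add: card_edges)
  finally show "measure lebesgue B = card (facets B) * n * d / 6" by simp
  obtain F where F: "F \<in> facets B" using facets_nonempty by blast
  then obtain E where E: "E \<in> edges F" using edges_nonempty by blast
  obtain a b where ab: "E = closed_segment a b" "a \<noteq> b" by (rule edge_endpoints[OF F E])
  show "d > 0" using tetra_det(3)[OF F E ab] .
  show "n > 0" using card_edges[OF F] edges_nonempty[OF F] finite_edges[OF facet_polytope[OF F]] card_gt_0_iff[of "edges F"] by simp
qed

section \<open>Averages over the boundary and over its homothetic image\<close>

context platonic_convex
begin

text \<open>Stated for an arbitrary chart and not only for \<open>plane_param F\<close>, because the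
  homothetic boundary calls for a chart of \<open>F\<close> built from one of its shrunken
  copy.\<close>

lemma facet_chart:
  fixes \<phi> :: "real^2 \<Rightarrow> pt"
  assumes F: "F \<in> facets B" and \<phi>: "isometry \<phi>" "F \<subseteq> range \<phi>"
  shows "cone_factor Z \<phi> = h"
proof -
  have r: "range \<phi> = affine hull F" using plane_chart_range[OF \<phi> facet_dim[OF F]] .
  have "(face_center F - Z) \<bullet> (\<phi> y - face_center F) = 0" for y
    using perp[OF F, of "\<phi> y"] r by (simp add: inner_diff_left) (metis rangeI)
  then show ?thesis
    using cone_factor_eq_dist[OF \<phi>(1), of "face_center F" Z] face_center_mem[OF F] \<phi>(2) height[OF F] by auto
qed

lemma facet_nonempty: "F \<in> facets B \<Longrightarrow> F \<noteq> {}"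
  using face_center_mem by blast

lemma measure_B_pos: "measure lebesgue B > 0"
  unfolding measure_B_eq using d_pos n_pos facets_nonempty finite_facets[OF polyB] by (simp add: card_gt_0_iff)

text \<open>All pyramids have the height \<open>h\<close>, so their volumes are proportional to the
  areas of the faces, and summing the estimates over the pyramids reproduces the area-weighted
  average.\<close>

lemma ineq_boundary: "avg_vol f B \<le> 1/4 * f Z + 3/4 * avg_bdry f B"
proof -
  let ?S = "\<Sum>F\<in>facets B. plane_area F" and ?P = "\<Sum>F\<in>facets B. plane_integral F f"
  have chart: "isometry (plane_param F)" "F \<subseteq> range (plane_param F)" "cone_factor Z (plane_param F) = h" if F: "F \<in> facets B" for F
    using plane_param_isometry[OF facet_dim[OF F]] facet_chart[OF F] by auto
  have cone: "measure lebesgue (convex hull (insert Z F)) = h / 3 * plane_area F" if F: "F \<in> facets B" for F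
    using measure_cone[OF chart(1)[OF F] facet_polytope[OF F] facet_nonempty[OF F] chart(2)[OF F], of Z] h_pos
    by (simp add: chart(3)[OF F] plane_area_def)
  have vol: "measure lebesgue B = h / 3 * ?S"
    unfolding measure_B sum_distrib_left by (intro sum.cong refl cone)
  have S: "?S > 0" using measure_B_pos h_pos unfolding vol by (simp add: zero_less_mult_iff)
  have "integral (convex hull (insert Z F)) f \<le> h * (f Z / 12 * plane_area F + plane_integral F f / 4)" if F: "F \<in> facets B" for F
    using cone_integral_le[OF chart(1)[OF F] facet_polytope[OF F] facet_nonempty[OF F] chart(2)[OF F] _ convex_f[OF F]] h_pos
    by (simp add: chart(3)[OF F] plane_area_def plane_integral_def)
  then have "integral B f \<le> (\<Sum>F\<in>facets B. h * (f Z / 12 * plane_area F + plane_integral F f / 4))"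
    unfolding integral_B by (rule sum_mono)
  also have "\<dots> = h * (f Z / 12 * ?S + ?P / 4)"
    by (simp add: sum_distrib_left[symmetric] sum.distrib sum_divide_distrib[symmetric])
  finally have "avg_vol f B \<le> h * (f Z / 12 * ?S + ?P / 4) / (h / 3 * ?S)"
    unfolding avg_vol_def vol using h_pos S by (intro divide_right_mono) auto
  also have "\<dots> = 1/4 * f Z + 3/4 * avg_bdry f B"
    unfolding avg_bdry_def using h_pos S by (simp add: field_simps)
  finally show ?thesis .
qed

lemma ineq_homothetic_boundary: "avg_bdry f (homothety Z (3/4) ` B) \<le> avg_vol f B"
proof -
  let ?H = "homothety Z (3/4)"
  let ?Q = "\<Sum>F\<in>facets B. plane_integral (?H ` F) f" and ?A = "\<Sum>F\<in>facets B. plane_area (?H ` F)"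
  have inj: "inj_on ((`) ?H) (facets B)"
    using homothety_inj[of "3/4" Z] by (simp add: inj_on_def inj_image_eq_iff)
  have avg: "avg_bdry f (?H ` B) = ?Q / ?A"
    unfolding avg_bdry_def facets_homothety[of "3/4" Z B, simplified] sum.reindex[OF inj] by simp
  \<comment> \<open>\<open>16/9\<close> is the area of a face divided by the area of its image under
    the homothety.\<close>
  have main: "measure lebesgue (convex hull (insert Z F)) = h / 3 * (16/9) * plane_area (?H ` F)"
     "h / 3 * (16/9) * plane_integral (?H ` F) f \<le> integral (convex hull (insert Z F)) f" if F: "F \<in> facets B" for F
  proof -
    define \<psi> where "\<psi> = plane_param (?H ` F)"
    \<comment> \<open>\<open>plane_param\<close> of the shrunken face is a choice unrelated to
      \<open>plane_param F\<close>. Conjugating it with the scalings of ratio \<open>3/4\<close>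
      gives a chart of \<open>F\<close> that is again isometric and matches the slice at height
      \<open>3/4\<close>.\<close>
    define \<phi> where "\<phi> y = Z + (4/3) *\<^sub>R (\<psi> ((3/4) *\<^sub>R y) - Z)" for y
    have "aff_dim (?H ` F) = 2" using homothety_aff_dim[of "3/4" Z F] facet_dim[OF F] by simp
    then have \<psi>: "isometry \<psi>" "?H ` F \<subseteq> range \<psi>" using plane_param_isometry by (auto simp: \<psi>_def)
    have H\<phi>: "Z + (3/4) *\<^sub>R (\<phi> y - Z) = \<psi> ((3/4) *\<^sub>R y)" for y by (simp add: \<phi>_def)
    have iso: "isometry \<phi>"
      unfolding isometry_def
    proof (intro allI)
      fix x y
      have "\<phi> x - \<phi> y = (4/3) *\<^sub>R (\<psi> ((3/4) *\<^sub>R x) - \<psi> ((3/4) *\<^sub>R y))" by (simp add: \<phi>_def algebra_simps)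
      then have "dist (\<phi> x) (\<phi> y) = 4/3 * dist (\<psi> ((3/4) *\<^sub>R x)) (\<psi> ((3/4) *\<^sub>R y))" by (simp add: dist_norm)
      also have "\<dots> = 4/3 * dist ((3/4) *\<^sub>R x) ((3/4) *\<^sub>R y)" using \<psi>(1) by (simp add: isometry_def)
      also have "\<dots> = dist x y" by (simp add: dist_norm flip: scaleR_diff_right)
      finally show "dist (\<phi> x) (\<phi> y) = dist x y" .
    qed
    have sub: "F \<subseteq> range \<phi>"
    proof
      fix x assume "x \<in> F"
      then obtain y where y: "?H x = \<psi> y" using \<psi>(2) by blast
      have "\<phi> ((4/3) *\<^sub>R y) = Z + (4/3) *\<^sub>R (?H x - Z)" by (simp add: \<phi>_def y)
      also have "\<dots> = x" by (simp add: homothety_def)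
      finally show "x \<in> range \<phi>" by (metis rangeI)
    qed
    define D' where "D' = \<psi> -` (?H ` F)"
    have pre: "\<phi> -` F = (\<lambda>y. (3/4) *\<^sub>R y) -` D'"
    proof (intro set_eqI)
      fix y
      have "\<phi> y \<in> F \<longleftrightarrow> ?H (\<phi> y) \<in> ?H ` F" using homothety_inj[of "3/4" Z] by (simp add: inj_image_mem_iff)
      also have "?H (\<phi> y) = \<psi> ((3/4) *\<^sub>R y)" using H\<phi>[of y] by (simp add: homothety_def)
      finally show "y \<in> \<phi> -` F \<longleftrightarrow> y \<in> (\<lambda>y. (3/4) *\<^sub>R y) -` D'" by (simp add: D'_def)
    qed
    have polyH: "polytope (?H ` F)"
    proof -
      have "polytope ((\<lambda>x. (Z - (3/4) *\<^sub>R Z) + x) ` ((*\<^sub>R) (3/4) ` F))"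
        unfolding polytope_translation_eq
        by (rule polytope_linear_image[OF homothety_decomp(2) facet_polytope[OF F]]) simp
      then show ?thesis using homothety_decomp(1)[of "3/4" Z F] by simp
    qed
    note D' = plane_chart_preimage[OF \<psi>(1) polyH, folded D'_def]
    have HK: "?H ` F \<subseteq> convex hull (insert Z F)"
    proof
      fix x assume "x \<in> ?H ` F"
      then obtain y where y: "y \<in> F" "x = ?H y" by blast
      have x: "x = (1 - 3/4) *\<^sub>R Z + (3/4) *\<^sub>R y" unfolding y(2) homothety_def by (simp add: algebra_simps flip: scaleR_left_distrib)
      show "x \<in> convex hull (insert Z F)"
        unfolding x using y(1) by (intro convexD_alt[OF convex_convex_hull]) (auto intro: hull_inc)
    qed
    obtain b where b: "\<And>x. x \<in> convex hull (insert Z F) \<Longrightarrow> f x \<le> b" using f_bounded_above[OF F] by blast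
    have "convex_on D' (\<lambda>y. f (\<psi> y))"
      using HK isometry_affine[OF \<psi>(1)] by (intro convex_on_compose_affine[OF convex_f[OF F] D'(1)]) (auto simp: D'_def)
    then have "integral D' (\<lambda>y. f (\<psi> y)) = (3/4)\<^sup>2 * integral (\<phi> -` F) (\<lambda>y. f (\<psi> ((3/4) *\<^sub>R y)))"
      unfolding pre using b HK by (intro convex_integral_scale[OF D'(2), of _ b]) (auto simp: D'_def)
    then have pint: "plane_integral (?H ` F) f = 9/16 * integral (\<phi> -` F) (\<lambda>y. f (Z + (3/4) *\<^sub>R (\<phi> y - Z)))"
      unfolding plane_integral_def \<psi>_def[symmetric] H\<phi> by (simp add: D'_def o_def power2_eq_square)
    have "convex_on D' (\<lambda>_. 1)" using D'(1) by (simp add: convex_on_def flip: distrib_right)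
    then have "integral D' (\<lambda>_. 1) = (3/4)\<^sup>2 * integral (\<phi> -` F) (\<lambda>_. 1::real)"
      unfolding pre by (intro convex_integral_scale[OF D'(2), of _ 1]) auto
    then have area: "plane_area (?H ` F) = 9/16 * measure lebesgue (\<phi> -` F)"
      unfolding plane_area_def \<psi>_def[symmetric] D'_def[symmetric] lmeasure_integral[OF D'(3)]
        lmeasure_integral[OF plane_chart_preimage(3)[OF iso facet_polytope[OF F]]] by (simp add: power2_eq_square)
    have cf: "cone_factor Z \<phi> = h" using facet_chart[OF F iso sub] .
    show "measure lebesgue (convex hull (insert Z F)) = h / 3 * (16/9) * plane_area (?H ` F)"
      using measure_cone[OF iso facet_polytope[OF F] facet_nonempty[OF F] sub, of Z] h_pos by (simp add: cf area)
    show "h / 3 * (16/9) * plane_integral (?H ` F) f \<le> integral (convex hull (insert Z F)) f"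
      using cone_integral_ge[OF iso facet_polytope[OF F] facet_nonempty[OF F] sub _ convex_f[OF F]] h_pos
      unfolding cf pint by simp
  qed
  have vol: "measure lebesgue B = h / 3 * (16/9) * ?A"
    unfolding measure_B sum_distrib_left by (intro sum.cong refl main(1))
  have A: "?A > 0" using measure_B_pos h_pos unfolding vol by (simp add: zero_less_mult_iff)
  have "h / 3 * (16/9) * ?Q \<le> integral B f"
    unfolding integral_B sum_distrib_left by (intro sum_mono main(2))
  then have "(h / 3 * (16/9) * ?Q) / (h / 3 * (16/9) * ?A) \<le> avg_vol f B"
    unfolding avg_vol_def vol using h_pos A by (intro divide_right_mono) auto
  then show ?thesis unfolding avg using h_pos by simp
qed

section \<open>Sums over tetrahedra and the average over the edges\<close>

lemma integral_B_tetra: "integral B f = (\<Sum>F\<in>facets B. \<Sum>E\<in>edges F. integral (tetra F E) f)"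
  unfolding integral_B by (intro sum.cong refl integral_cone)

lemma edge_mem:
  assumes F: "F \<in> facets B" and E: "E \<in> edges F" "E = closed_segment a b"
  shows "a \<in> convex hull (insert Z F)" "b \<in> convex hull (insert Z F)" "face_center F \<in> convex hull (insert Z F)" "Z \<in> convex hull (insert Z F)"
  using assms face_center_mem[OF F] by (auto simp: edges_def intro!: hull_inc dest!: face_of_imp_subset)

lemma tetra_integral_le:
  assumes F: "F \<in> facets B" and E: "E \<in> edges F" "E = closed_segment a b" "a \<noteq> b"
  shows "integral (tetra F E) f \<le> d / 12 * (segment_mean f Z (face_center F) + segment_mean f a b)"
    and "integral (tetra F E) f \<le> d / 12 * (segment_mean f Z a + segment_mean f (face_center F) b)"
proof -
  note td = tetra_det[OF F E]
  have conv: "convex_on (convex hull {Z, face_center F, a, b}) f"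
    using convex_on_subset[OF convex_f[OF F] tetra_subset_cone(1)[OF F E(1)]] by (simp add: td(4))
  show "integral (tetra F E) f \<le> d / 12 * (segment_mean f Z (face_center F) + segment_mean f a b)"
    using tetrahedron_integral_le[of "face_center F" Z b a f] conv td by (simp add: segment_mean_def)
  have "{Z, a, face_center F, b} = {Z, face_center F, a, b}" by auto
  then show "integral (tetra F E) f \<le> d / 12 * (segment_mean f Z a + segment_mean f (face_center F) b)"
    using tetrahedron_integral_le[of a Z b "face_center F" f] conv td by (simp add: segment_mean_def)
qed

lemma edges_facet: "F \<in> facets B \<Longrightarrow> edges F = {E \<in> edges B. E \<subseteq> F}"
  using face_of_face[of F B] by (auto simp: edges_def facets_def)

text \<open>Double counting with \<open>ridge_in_two_facets\<close>: an edge has dimension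
  \<open>3 - 2\<close>.\<close>

lemma sum_facets_edges:
  fixes g :: "pt set \<Rightarrow> real"
  shows "(\<Sum>F\<in>facets B. \<Sum>E\<in>edges F. g E) = 2 * (\<Sum>E\<in>edges B. g E)"
proof -
  have "(\<Sum>F\<in>facets B. \<Sum>E\<in>edges F. g E) = (\<Sum>F\<in>facets B. \<Sum>E\<in>{E \<in> edges B. E \<subseteq> F}. g E)"
    using edges_facet by simp
  also have "\<dots> = (\<Sum>E\<in>edges B. \<Sum>F\<in>{F \<in> facets B. E \<subseteq> F}. g E)"
    by (rule sum.swap_restrict) (use polyB finite_edges finite_facets in auto)
  also have "\<dots> = (\<Sum>E\<in>edges B. 2 * g E)"
  proof (intro sum.cong refl)
    fix E assume E: "E \<in> edges B"
    have "{F \<in> facets B. E \<subseteq> F} = {F. F facet_of B \<and> E \<subseteq> F}" by (auto simp: facet_of_iff)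
    moreover have "card {F. F facet_of B \<and> E \<subseteq> F} = 2"
      using E dimB by (intro ridge_in_two_facets[OF polyhedronB]) (auto simp: edges_def)
    ultimately show "(\<Sum>F\<in>{F \<in> facets B. E \<subseteq> F}. g E) = 2 * g E" by simp
  qed
  finally show ?thesis by (simp add: sum_distrib_left)
qed

lemma ineq_edges:
  "avg_vol f B \<le> 1/2 * avg_segs f ((\<lambda>F. closed_segment Z (face_center F)) ` facets B) + 1/2 * avg_segs f (edges B)"
proof -
  let ?N = "card (facets B)"
  \<comment> \<open>The mean of \<open>f\<close> over the edge, written without end points: these
    are obtained separately for each face and edge, while the sum has to be regrouped by edges of
    \<open>B\<close>.\<close>
  define M where "M E = line_integral E f / len" for E
  have edge: "line_integral E f = len * M E \<and> line_length E = len \<and> len > 0 \<and>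
      integral (tetra F E) f \<le> d / 12 * (segment_mean f Z (face_center F) + M E)"
    if FE: "F \<in> facets B" "E \<in> edges F" for F E
  proof -
    obtain a b where ab: "E = closed_segment a b" "a \<noteq> b" "dist a b = len" by (rule edge_endpoints[OF FE])
    have l: "len > 0" using ab by auto
    have "line_integral E f = len * segment_mean f a b"
      unfolding ab(1) using edge_mem[OF FE ab(1)] ab(2,3)
      by (subst line_integral_segment) (auto intro!: segment_integrable[OF FE(1)])
    moreover from this have "M E = segment_mean f a b" using l by (simp add: M_def)
    ultimately show ?thesis
      using tetra_integral_le(1)[OF FE ab(1,2)] line_length_segment[OF ab(2)] ab l by simp
  qed
  have facet_of_edge: "\<exists>F\<in>facets B. E \<in> edges F" if E: "E \<in> edges B" for E
  proof -
    have "E face_of B" "E \<noteq> {}" "E \<noteq> B" using E dimB by (auto simp: edges_def)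
    then obtain F where "F facet_of B" "E \<subseteq> F" using face_of_polyhedron_subset_facet[OF polyhedronB] by blast
    then show ?thesis using E edges_facet[of F] by (auto simp: facet_of_iff)
  qed
  have len: "len > 0" using facets_nonempty edges_nonempty edge by blast
  have avgE: "avg_segs f (edges B) = (\<Sum>E\<in>edges B. M E) / card (edges B)"
  proof -
    have "(\<Sum>E\<in>edges B. line_integral E f) = (\<Sum>E\<in>edges B. len * M E)" "(\<Sum>E\<in>edges B. line_length E) = (\<Sum>E\<in>edges B. len)"
      using facet_of_edge edge by (intro sum.cong refl; blast)+
    then show ?thesis unfolding avg_segs_def using len by (simp add: sum_distrib_left[symmetric])
  qed
  have avgO: "avg_segs f ((\<lambda>F. closed_segment Z (face_center F)) ` facets B) = (\<Sum>F\<in>facets B. segment_mean f Z (face_center F)) / ?N"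
  proof (rule avg_segs_image[of _ "\<lambda>_. Z" face_center h])
    show "inj_on (\<lambda>F. closed_segment Z (face_center F)) (facets B)"
    proof (rule inj_onI)
      fix F G assume FG: "F \<in> facets B" "G \<in> facets B" "closed_segment Z (face_center F) = closed_segment Z (face_center G)"
      \<comment> \<open>Distinct faces have distinct centres, because their relative interiors are
        disjoint.\<close>
      then have "face_center F = face_center G" by (auto simp: closed_segment_eq doubleton_eq_iff)
      then have "rel_interior F \<inter> rel_interior G \<noteq> {}" using face_center_rel_interior FG by (metis IntI empty_iff)
      then show "F = G" using face_of_eq[of F B G] FG by (auto simp: facets_def)
    qed
    show "Z \<noteq> face_center F" if "F \<in> facets B" for F using that face_center_mem Z_notin_facet by blast
    show "(\<lambda>u. f ((1 - u) *\<^sub>R Z + u *\<^sub>R face_center F)) integrable_on {0..1}" if F: "F \<in> facets B" for F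
      using face_center_mem[OF F] by (intro segment_integrable[OF F]) (auto intro: hull_inc)
  qed (use finite_facets[OF polyB] height in auto)
  have N: "?N > 0" using facets_nonempty finite_facets[OF polyB] by (simp add: card_gt_0_iff)
  have "integral B f \<le> (\<Sum>F\<in>facets B. \<Sum>E\<in>edges F. d / 12 * (segment_mean f Z (face_center F) + M E))"
    unfolding integral_B_tetra using edge by (intro sum_mono) blast
  also have "\<dots> = d / 12 * (\<Sum>F\<in>facets B. \<Sum>E\<in>edges F. segment_mean f Z (face_center F) + M E)"
    by (simp only: sum_distrib_left)
  also have "(\<Sum>F\<in>facets B. \<Sum>E\<in>edges F. segment_mean f Z (face_center F) + M E)
     = n * (\<Sum>F\<in>facets B. segment_mean f Z (face_center F)) + 2 * (\<Sum>E\<in>edges B. M E)"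
    by (simp add: sum.distrib sum_facets_edges card_edges sum_distrib_left)
  finally have int: "integral B f \<le> d / 12 * (n * (\<Sum>F\<in>facets B. segment_mean f Z (face_center F)) + 2 * (\<Sum>E\<in>edges B. M E))" .
  \<comment> \<open>The same regrouping applied to the constant 1 counts edges, so the denominator
    \<open>?N * n\<close> is twice their number and cancels the factor 2.\<close>
  have "real ?N * n = (\<Sum>F\<in>facets B. \<Sum>E\<in>edges F. 1)" by (simp add: card_edges)
  also have "\<dots> = 2 * card (edges B)" unfolding sum_facets_edges by simp
  finally have cnt: "real ?N * n = 2 * card (edges B)" .
  have "avg_vol f B \<le> d / 12 * (n * (\<Sum>F\<in>facets B. segment_mean f Z (face_center F)) + 2 * (\<Sum>E\<in>edges B. M E)) / (?N * n * d / 6)"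
    unfolding avg_vol_def measure_B_eq using int d_pos by (intro divide_right_mono) auto
  also have "\<dots> = 1/2 * ((\<Sum>F\<in>facets B. segment_mean f Z (face_center F)) / ?N) + 1/2 * (2 * (\<Sum>E\<in>edges B. M E) / (?N * n))"
    using d_pos n_pos N by (simp add: field_simps)
  also have "2 * (\<Sum>E\<in>edges B. M E) / (?N * n) = (\<Sum>E\<in>edges B. M E) / card (edges B)" by (simp add: cnt)
  finally show ?thesis unfolding avgE avgO .
qed

end

section \<open>The averages over segments to the vertices\<close>

context platonic_convex
begin

lemma vertices_facet: "F \<in> facets B \<Longrightarrow> vertices F = {v \<in> vertices B. v \<in> F}"
  using vertices_face[of F B] by (auto simp: facets_def)

lemma facet_of_vertex:
  assumes "v \<in> vertices B"
  obtains F where "F \<in> facets B" "v \<in> vertices F"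
proof -
  have v: "{v} face_of B" using assms by (simp add: vertices_def face_of_singleton)
  moreover have "{v} \<noteq> B" using dimB by auto
  ultimately obtain F where "F facet_of B" "{v} \<subseteq> F"
    using face_of_polyhedron_subset_facet[OF polyhedronB v] by blast
  then show ?thesis using that[of F] assms vertices_facet[of F] by (simp add: facet_of_iff)
qed

lemma sum_facets_vertices:
  fixes g :: "pt \<Rightarrow> real"
  shows "(\<Sum>F\<in>facets B. \<Sum>v\<in>vertices F. g v) = k * (\<Sum>v\<in>vertices B. g v)"
proof -
  have "(\<Sum>F\<in>facets B. \<Sum>v\<in>vertices F. g v) = (\<Sum>F\<in>facets B. \<Sum>v\<in>{v \<in> vertices B. v \<in> F}. g v)"
    using vertices_facet by simp
  also have "\<dots> = (\<Sum>v\<in>vertices B. \<Sum>F\<in>{F \<in> facets B. v \<in> F}. g v)"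
    by (rule sum.swap_restrict) (use polyB finite_vertices finite_facets in auto)
  also have "\<dots> = (\<Sum>v\<in>vertices B. k * g v)"
    by (intro sum.cong refl) (simp add: degree)
  finally show ?thesis by (simp add: sum_distrib_left)
qed

lemma vertex_dist:
  assumes F: "F \<in> facets B" and v: "v \<in> vertices F"
  shows "dist (face_center F) v = rad" "(dist Z v)\<^sup>2 = h\<^sup>2 + rad\<^sup>2" "v \<in> F"
proof -
  show vF: "v \<in> F" using v by (simp add: vertices_def extreme_point_of_def)
  show r: "dist (face_center F) v = rad" using inscribed_polygon.radius[OF polygon[OF F] v] .
  have "(dist Z v)\<^sup>2 = (dist Z (face_center F))\<^sup>2 + (dist (face_center F) v)\<^sup>2
      - 2 * ((Z - face_center F) \<bullet> (v - face_center F))"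
    by (simp add: dist_norm power2_norm_eq_inner inner_diff_left inner_diff_right inner_commute)
  then show "(dist Z v)\<^sup>2 = h\<^sup>2 + rad\<^sup>2"
    using perp[OF F, of v] vF r height[OF F] by (simp add: hull_inc)
qed

text \<open>A vertex is a face of \<open>B\<close>; if it met the relative interior of
  \<open>F\<close> it would contain \<open>F\<close>, which has dimension 2.\<close>

lemma vertex_not_face_center:
  assumes "F \<in> facets B" "v \<in> vertices B"
  shows "face_center F \<noteq> v"
proof
  assume "face_center F = v"
  then have "{v} \<inter> rel_interior F \<noteq> {}" using face_center_rel_interior[OF assms(1)] by auto
  moreover have "{v} face_of B" "F \<subseteq> B"
    using assms by (auto simp: vertices_def face_of_singleton facets_def dest: face_of_imp_subset)
  ultimately have "F \<subseteq> {v}" using subset_of_face_of by blast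
  then have "aff_dim F \<le> 0" using aff_dim_subset[of F "{v}"] by simp
  then show False using facet_dim[OF assms(1)] by simp
qed

lemma card_vertices_facet: "F \<in> facets B \<Longrightarrow> card (vertices F) = n"
  using inscribed_polygon.card_edges[OF polygon] card_edges by metis

lemma ineq_vertices:
  "avg_vol f B \<le> 1/2 * avg_segs f ((\<lambda>v. closed_segment Z v) ` vertices B)
     + 1/2 * avg_segs f {closed_segment (face_center F) v | F v. F \<in> facets B \<and> v \<in> vertices F}"
proof -
  let ?N = "card (facets B)" and ?X = "SIGMA F:facets B. vertices F"
  have finV: "finite (vertices F)" if "F \<in> facets B" for F using that facet_polytope finite_vertices by blast
  have avgS: "avg_segs f ((\<lambda>v. closed_segment Z v) ` vertices B) = (\<Sum>v\<in>vertices B. segment_mean f Z v) / card (vertices B)"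
  proof (rule avg_segs_image[of _ "\<lambda>_. Z" "\<lambda>v. v" "sqrt (h\<^sup>2 + rad\<^sup>2)"])
    show "inj_on (\<lambda>v. closed_segment Z v) (vertices B)"
      by (rule inj_onI) (auto simp: closed_segment_eq doubleton_eq_iff)
    fix v assume v: "v \<in> vertices B"
    obtain F where F: "F \<in> facets B" "v \<in> vertices F" by (rule facet_of_vertex[OF v])
    note vd = vertex_dist[OF F]
    show "Z \<noteq> v" using vd(3) Z_notin_facet[OF F(1)] by blast
    show "dist Z v = sqrt (h\<^sup>2 + rad\<^sup>2)" using vd(2) by (metis real_sqrt_unique zero_le_dist)
    show "(\<lambda>u. f ((1 - u) *\<^sub>R Z + u *\<^sub>R v)) integrable_on {0..1}"
      using vd(3) by (intro segment_integrable[OF F(1)]) (auto intro: hull_inc)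
  qed (use finite_vertices[OF polyB] in auto)
  \<comment> \<open>Pairs of a face and one of its vertices are the index set that suits the double
    sums; distinct pairs are shown to give distinct segments.\<close>
  have Xset: "{closed_segment (face_center F) v | F v. F \<in> facets B \<and> v \<in> vertices F}
      = (\<lambda>x. closed_segment (face_center (fst x)) (snd x)) ` ?X"
  proof (intro set_eqI iffI)
    fix S assume "S \<in> {closed_segment (face_center F) v | F v. F \<in> facets B \<and> v \<in> vertices F}"
    then obtain F v where "S = closed_segment (face_center F) v" "F \<in> facets B" "v \<in> vertices F" by blast
    then show "S \<in> (\<lambda>x. closed_segment (face_center (fst x)) (snd x)) ` ?X"
      by (intro image_eqI[of _ _ "(F, v)"]) simp_all
  next
    fix S assume "S \<in> (\<lambda>x. closed_segment (face_center (fst x)) (snd x)) ` ?X"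
    then obtain x where "S = closed_segment (face_center (fst x)) (snd x)" "fst x \<in> facets B" "snd x \<in> vertices (fst x)" by auto
    then show "S \<in> {closed_segment (face_center F) v | F v. F \<in> facets B \<and> v \<in> vertices F}" by blast
  qed
  have avgD: "avg_segs f {closed_segment (face_center F) v | F v. F \<in> facets B \<and> v \<in> vertices F}
     = (\<Sum>x\<in>?X. segment_mean f (face_center (fst x)) (snd x)) / card ?X"
    unfolding Xset
  proof (rule avg_segs_image[of _ "\<lambda>x. face_center (fst x)" snd rad])
    show "finite ?X" using finite_facets[OF polyB] finV by auto
    show "inj_on (\<lambda>x. closed_segment (face_center (fst x)) (snd x)) ?X"
    proof (rule inj_onI)
      fix x y assume x: "x \<in> ?X" and y: "y \<in> ?X"
        and eq: "closed_segment (face_center (fst x)) (snd x) = closed_segment (face_center (fst y)) (snd y)"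
      have F: "fst x \<in> facets B" "fst y \<in> facets B" and "snd x \<in> vertices (fst x)" "snd y \<in> vertices (fst y)"
        using x y by auto
      then have v: "snd x \<in> vertices B" "snd y \<in> vertices B" using vertices_facet by auto
      \<comment> \<open>A segment determines only the unordered pair of its ends. They cannot be
        interchanged, because a face centre is never a vertex of \<open>B\<close>.\<close>
      have "{face_center (fst x), snd x} = {face_center (fst y), snd y}" using eq by (simp add: closed_segment_eq)
      then have c: "face_center (fst x) = face_center (fst y)" "snd x = snd y"
        using vertex_not_face_center[OF F(1) v(2)] vertex_not_face_center[OF F(2) v(1)] by (auto simp: doubleton_eq_iff)
      then have "rel_interior (fst x) \<inter> rel_interior (fst y) \<noteq> {}" using face_center_rel_interior F by (metis IntI empty_iff)
      then have "fst x = fst y" using face_of_eq[of "fst x" B "fst y"] F by (auto simp: facets_def)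
      then show "x = y" using c(2) by (simp add: prod_eq_iff)
    qed
    fix x assume "x \<in> ?X"
    then have F: "fst x \<in> facets B" "snd x \<in> vertices (fst x)" by auto
    show "dist (face_center (fst x)) (snd x) = rad" using vertex_dist(1)[OF F] .
    show "face_center (fst x) \<noteq> snd x"
      using F vertices_facet[OF F(1)] vertex_not_face_center[OF F(1)] by auto
    show "(\<lambda>u. f ((1 - u) *\<^sub>R face_center (fst x) + u *\<^sub>R snd x)) integrable_on {0..1}"
      using vertex_dist(3)[OF F] face_center_mem[OF F(1)] by (intro segment_integrable[OF F(1)]) (auto intro: hull_inc)
  qed
  let ?g = "\<lambda>F v. segment_mean f Z v + segment_mean f (face_center F) v"
  have tet: "integral (tetra F E) f \<le> d / 24 * (\<Sum>v\<in>vertices E. ?g F v)" if FE: "F \<in> facets B" "E \<in> edges F" for F E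
  proof -
    obtain a b where ab: "E = closed_segment a b" "a \<noteq> b" "vertices E = {a, b}" by (rule edge_endpoints[OF FE])
    \<comment> \<open>Reversing the edge gives the other pairing. Averaging the two bounds treats
      both end points alike and turns \<open>d / 12\<close> into \<open>d / 24\<close>.\<close>
    have ba: "E = closed_segment b a" using ab by (simp add: closed_segment_commute)
    have "integral (tetra F E) f \<le> d / 12 * (segment_mean f Z a + segment_mean f (face_center F) b)"
      "integral (tetra F E) f \<le> d / 12 * (segment_mean f Z b + segment_mean f (face_center F) a)"
      using tetra_integral_le(2)[OF FE ab(1,2)] tetra_integral_le(2)[OF FE ba] ab(2) by auto
    moreover have "(\<Sum>v\<in>vertices E. ?g F v) = ?g F a + ?g F b" using ab by simp
    ultimately show ?thesis by (simp add: field_simps)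
  qed
  have "integral B f \<le> (\<Sum>F\<in>facets B. \<Sum>E\<in>edges F. d / 24 * (\<Sum>v\<in>vertices E. ?g F v))"
    unfolding integral_B_tetra using tet by (intro sum_mono) blast
  \<comment> \<open>Each vertex of \<open>F\<close> lies on two edges of \<open>F\<close>, which
    doubles \<open>d / 24\<close>.\<close>
  also have "\<dots> = (\<Sum>F\<in>facets B. d / 12 * (\<Sum>v\<in>vertices F. ?g F v))"
  proof (intro sum.cong refl)
    fix F assume F: "F \<in> facets B"
    have "(\<Sum>E\<in>edges F. d / 24 * (\<Sum>v\<in>vertices E. ?g F v)) = d / 24 * (\<Sum>E\<in>edges F. \<Sum>v\<in>vertices E. ?g F v)"
      by (simp only: sum_distrib_left)
    also have "\<dots> = d / 24 * (2 *\<^sub>R (\<Sum>v\<in>vertices F. ?g F v))"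
      by (simp only: inscribed_polygon.sum_edges_vertices[OF polygon[OF F]])
    finally show "(\<Sum>E\<in>edges F. d / 24 * (\<Sum>v\<in>vertices E. ?g F v)) = d / 12 * (\<Sum>v\<in>vertices F. ?g F v)" by simp
  qed
  also have "\<dots> = d / 12 * (\<Sum>F\<in>facets B. \<Sum>v\<in>vertices F. ?g F v)" by (simp only: sum_distrib_left)
  also have "(\<Sum>F\<in>facets B. \<Sum>v\<in>vertices F. ?g F v) = k * (\<Sum>v\<in>vertices B. segment_mean f Z v)
      + (\<Sum>x\<in>?X. segment_mean f (face_center (fst x)) (snd x))"
    using finV finite_facets[OF polyB] by (simp add: sum.distrib sum_facets_vertices sum.Sigma split_beta)
  finally have int: "integral B f \<le> d / 12 * (k * (\<Sum>v\<in>vertices B. segment_mean f Z v)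
      + (\<Sum>x\<in>?X. segment_mean f (face_center (fst x)) (snd x)))" .
  have cX: "real (card ?X) = real ?N * n"
    using finV finite_facets[OF polyB] by (simp add: card_SigmaI card_vertices_facet)
  \<comment> \<open>A face has as many vertices as edges, so \<open>?N * n\<close> counts the
    incidences of faces and vertices; counted from the vertices there are \<open>k\<close> for
    each.\<close>
  have "real ?N * n = (\<Sum>F\<in>facets B. \<Sum>v\<in>vertices F. 1)" by (simp add: card_vertices_facet)
  also have "\<dots> = k * card (vertices B)" unfolding sum_facets_vertices by simp
  finally have cnt: "real ?N * n = k * card (vertices B)" by simp
  have N: "?N > 0" using facets_nonempty finite_facets[OF polyB] by (simp add: card_gt_0_iff)
  then have "real k * real (card (vertices B)) \<noteq> 0" using cnt n_pos by (metis mult_eq_0_iff of_nat_0_eq_iff less_irrefl of_nat_mult)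
  then have k: "k \<noteq> 0" "card (vertices B) \<noteq> 0" by auto
  have "avg_vol f B \<le> d / 12 * (k * (\<Sum>v\<in>vertices B. segment_mean f Z v)
      + (\<Sum>x\<in>?X. segment_mean f (face_center (fst x)) (snd x))) / (?N * n * d / 6)"
    unfolding avg_vol_def measure_B_eq using int d_pos by (intro divide_right_mono) auto
  also have "\<dots> = 1/2 * (k * (\<Sum>v\<in>vertices B. segment_mean f Z v) / (real ?N * n))
      + 1/2 * ((\<Sum>x\<in>?X. segment_mean f (face_center (fst x)) (snd x)) / (real ?N * n))"
    using d_pos n_pos N by (simp add: field_simps)
  also have "k * (\<Sum>v\<in>vertices B. segment_mean f Z v) / (real ?N * n) = (\<Sum>v\<in>vertices B. segment_mean f Z v) / card (vertices B)"
    unfolding cnt using k by simp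
  finally show ?thesis unfolding avgS avgD cX .
qed

end

theorem theorem6p1:
  fixes B :: "pt set" and Z :: pt and f :: "pt \<Rightarrow> real"
  assumes "platonic B"
    and "\<exists>r. \<forall>v\<in>vertices B. dist Z v = r"
    and "\<forall>F\<in>facets B. convex_on (convex hull (insert Z F)) f"
  shows "avg_vol f B \<le> 1/4 * f Z + 3/4 * avg_bdry f B \<and>
        avg_vol f B \<le>
           1/2 * avg_segs f ((\<lambda>F. closed_segment Z (face_center F)) ` facets B)
         + 1/2 * avg_segs f (edges B) \<and>
        avg_vol f B \<le>
           1/2 * avg_segs f ((\<lambda>v. closed_segment Z v) ` vertices B)
         + 1/2 * avg_segs f {closed_segment (face_center F) v | F v. F \<in> facets B \<and> v \<in> vertices F} \<and>
        (avg_bdry f (homothety Z (3/4) ` B) \<le> avg_vol f B)"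
proof -
  obtain R where R: "\<And>v. v \<in> vertices B \<Longrightarrow> dist Z v = R" using assms(2) by blast
  obtain r l h n k where "inscribed_platonic B Z r l h n k"
    using platonic_imp_inscribed_platonic[OF assms(1) R] by blast
  then interpret inscribed_platonic B Z r l h n k .
  interpret platonic_convex B Z r l h n k f
    by unfold_locales (use assms(3) in blast)
  show ?thesis
    using ineq_boundary ineq_edges ineq_vertices ineq_homothetic_boundary by blast
qed

end
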